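(* Let $T\in\mathcal{BC}(X)$ and $f\in N(\sigma_S(T))$. If $g\in SH_L(\sigma_S(T))$, then $$(\mathcal D(fg))(T)=f(T)(\mathcal Dg)(T)+(\mathcal Df)(T)g(T)+(\mathcal Df)(T)\,\underline T\,(\mathcal Dg)(T).$$ If $g\in SH_R(\sigma_S(T))$, then $$((gf)\mathcal D)(T)=g(T)(\mathcal Df)(T)+(g\mathcal D)(T)f(T)+(g\mathcal D)(T)\,\underline T\,(\mathcal Df)(T).$$ Here $\underline T=T_1e_1+T_2e_2+T_3e_3$.
   Context: $\mathbb H$: quaternions with units $e_1,e_2,e_3$. $\mathbb S$: imaginary units ($J^2=-1$). $\mathbb C_J=\mathbb R+J\mathbb R$. $\mathcal D=\partial_{q_0}+\sum_{i=1}^3e_i\partial_{q_i}$ (acting from the left as $\mathcal Df$, from the right as $f\mathcal D$). A set $U\subseteq\mathbb H$ is axially symmetric if $u+Iv\in U$ implies $u+Jv\in U$ for all $J\in\mathbb S$. A slice Cauchy domain is an axially symmetric open $U$ such that for every $J\in\mathbb S$ the boundary of $U\cap\mathbb C_J$ is a finite union of nonintersecting piecewise $C^1$ Jordan curves. On an axially symmetric open $U$, $f$ is left (right) slice hyperholomorphic if $f(u+Jv)=\alpha(u,v)+J\beta(u,v)$ (resp. $\alpha(u,v)+\beta(u,v)J$) with $\mathbb H$-valued differentiable $\alpha$ even in $v$, $\beta$ odd in $v$, and $\partial_u\alpha=\partial_v\beta$, $\partial_v\alpha=-\partial_u\beta$; it is intrinsic if $\alpha,\beta$ are real valued. $X=X_{\mathbb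 R}\otimes\mathbb H$ is a two-sided quaternionic Banach module, $X_{\mathbb R}$ a real Banach space; $\mathcal B(X)$ is the space of bounded right linear operators; $(aT)(x)=aT(x)$, $(Ta)(x)=T(ax)$ for $a\in\mathbb H$. $\mathcal{BC}(X)$: operators $T=T_0+T_1e_1+T_2e_2+T_3e_3$ with pairwise commuting $T_i\in\mathcal B(X_{\mathbb R})$; $\overline T=T_0-T_1e_1-T_2e_2-T_3e_3$. $\rho_S(T)=\{s\in\mathbb H:(T^2-2\mathrm{Re}(s)T+|s|^2\mathcal I)^{-1}\in\mathcal B(X)\}$, $\sigma_S(T)=\mathbb H\setminus\rho_S(T)$; for $T\in\mathcal{BC}(X)$, $\rho_S(T)$ is also the set of $s$ with $\mathcal Q_{c,s}(T):=s^2-s(T+\overline T)+T\overline T$ invertible in $\mathcal B(X)$. $SH_L(\sigma_S(T))$, $SH_R(\sigma_S(T))$, $N(\sigma_S(T))$: left, right, intrinsic slice hyperholomorphic functions whose (axially symmetric open) domain contains $\sigma_S(T)$. For $s\in\rho_S(T)$: $S^{-1}_L(s,T)=(s\mathcal I-\overline T)\mathcal Q_{c,s}(T)^{-1}$, $S^{-1}_R(s,T)=\mathcal Q_{c,s}(T)^{-1}(s\mathcal I-\overline T)$. Functional calculi: let $J\in\mathbb S$, $ds_J=ds(-J)$, and $U$ a bounded slice Cauchy domain with $\sigma_S(T)\subset U$, $\overline U\subset\mathrm{dom}(f)$ (the integrals do not depend on $U,J$). For $f$ left slice hyperholomorphic: $f(T)=\frac1{2\pi}\int_{\partial(U\cap\mathbb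 C_J)}S_L^{-1}(s,T)ds_Jf(s)$, $(\mathcal Df)(T)=-\frac1\pi\int_{\partial(U\cap\mathbb C_J)}\mathcal Q_{c,s}(T)^{-1}ds_Jf(s)$. For $f$ right slice hyperholomorphic: $f(T)=\frac1{2\pi}\int f(s)ds_JS_R^{-1}(s,T)$, $(f\mathcal D)(T)=-\frac1\pi\int f(s)ds_J\mathcal Q_{c,s}(T)^{-1}$, over the same contour. For intrinsic $f$ left and right versions coincide. *)

theory Defs
  imports "HOL-Complex_Analysis.Complex_Analysis"
begin

section \<open>Quaternions\<close>

datatype quat = Quat (QRe: real) (QI1: real) (QI2: real) (QI3: real)

lemma quat_eq_iff:
  "p = q \<longleftrightarrow> QRe p = QRe q \<and> QI1 p = QI1 q \<and> QI2 p = QI2 q \<and> QI3 p = QI3 q"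
  by (cases p; cases q) auto

instantiation quat :: real_vector
begin

definition zero_quat where "0 = Quat 0 0 0 0"

definition plus_quat where
  "p + q = Quat (QRe p + QRe q) (QI1 p + QI1 q) (QI2 p + QI2 q) (QI3 p + QI3 q)"

definition uminus_quat where
  "- q = Quat (- QRe q) (- QI1 q) (- QI2 q) (- QI3 q)"

definition minus_quat where
  "p - q = Quat (QRe p - QRe q) (QI1 p - QI1 q) (QI2 p - QI2 q) (QI3 p - QI3 q)"

definition scaleR_quat where
  "r *\<^sub>R q = Quat (r * QRe q) (r * QI1 q) (r * QI2 q) (r * QI3 q)"

instance
  by standard
    (simp_all add: quat_eq_iff zero_quat_def plus_quat_def uminus_quat_def minus_quat_def
      scaleR_quat_def algebra_simps)

end

instantiation quat :: real_inner
begin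

definition inner_quat where
  "inner p q = QRe p * QRe q + QI1 p * QI1 q + QI2 p * QI2 q + QI3 p * QI3 q"

definition norm_quat where
  "norm q = sqrt ((QRe q)\<^sup>2 + (QI1 q)\<^sup>2 + (QI2 q)\<^sup>2 + (QI3 q)\<^sup>2)"

definition sgn_quat where "sgn (q::quat) = q /\<^sub>R norm q"

definition dist_quat where "dist p (q::quat) = norm (p - q)"

definition uniformity_quat where
  "(uniformity :: (quat \<times> quat) filter) = (INF e\<in>{0<..}. principal {(x, y). dist x y < e})"

definition open_quat where
  "open (U :: quat set) \<longleftrightarrow> (\<forall>x\<in>U. eventually (\<lambda>(x', y). x' = x \<longrightarrow> y \<in> U) uniformity)"

instance
proof
  fix x y z :: quat and r :: real and U :: "quat set"
  note defs = quat_eq_iff zero_quat_def plus_quat_def scaleR_quat_def inner_quat_def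
  show "dist x y = norm (x - y)" by (rule dist_quat_def)
  show "sgn x = x /\<^sub>R norm x" by (rule sgn_quat_def)
  show "uniformity = (INF e\<in>{0<..}. principal {(x :: quat, y). dist x y < e})"
    by (rule uniformity_quat_def)
  show "open U \<longleftrightarrow> (\<forall>x\<in>U. eventually (\<lambda>(x', y). x' = x \<longrightarrow> y \<in> U) uniformity)"
    by (rule open_quat_def)
  show "inner x y = inner y x" "inner (x + y) z = inner x z + inner y z"
    "inner (r *\<^sub>R x) y = r * inner x y"
    by (simp_all add: defs algebra_simps)
  show "0 \<le> inner x x" by (simp add: inner_quat_def)
  have "inner x x = (QRe x)\<^sup>2 + (QI1 x)\<^sup>2 + ((QI2 x)\<^sup>2 + (QI3 x)\<^sup>2)"
    by (simp add: inner_quat_def power2_eq_square)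
  then show "inner x x = 0 \<longleftrightarrow> x = 0"
    by (simp add: add_nonneg_eq_0_iff quat_eq_iff zero_quat_def)
  show "norm x = sqrt (inner x x)"
    by (simp add: norm_quat_def inner_quat_def power2_eq_square)
qed

end

instantiation quat :: real_normed_div_algebra
begin

definition one_quat where "1 = Quat 1 0 0 0"

definition times_quat where
  "p * q = Quat
    (QRe p * QRe q - QI1 p * QI1 q - QI2 p * QI2 q - QI3 p * QI3 q)
    (QRe p * QI1 q + QI1 p * QRe q + QI2 p * QI3 q - QI3 p * QI2 q)
    (QRe p * QI2 q - QI1 p * QI3 q + QI2 p * QRe q + QI3 p * QI1 q)
    (QRe p * QI3 q + QI1 p * QI2 q - QI2 p * QI1 q + QI3 p * QRe q)"

definition inverse_quat where
  "inverse q = Quat (QRe q) (- QI1 q) (- QI2 q) (- QI3 q) /\<^sub>R (norm q)\<^sup>2"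

definition divide_quat where "p div q = p * inverse (q::quat)"

instance
proof
  fix x y z :: quat and a :: real
  note defs = quat_eq_iff zero_quat_def one_quat_def plus_quat_def times_quat_def
    scaleR_quat_def
  show "x * y * z = x * (y * z)" "(x + y) * z = x * z + y * z" "x * (y + z) = x * y + x * z"
    "1 * x = x" "x * 1 = x"
    by (simp_all add: defs algebra_simps)
  show "(0::quat) \<noteq> 1" by (simp add: defs)
  show "a *\<^sub>R x * y = a *\<^sub>R (x * y)" "x * a *\<^sub>R y = a *\<^sub>R (x * y)"
    by (simp_all add: defs algebra_simps)
  show "x div y = x * inverse y" by (rule divide_quat_def)
  show "inverse (0::quat) = 0" by (simp add: inverse_quat_def defs)
  show "norm (x * y) = norm x * norm y"
    unfolding norm_quat_def real_sqrt_mult [symmetric]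
    by (rule arg_cong [of _ _ sqrt]) (simp add: times_quat_def power2_eq_square algebra_simps)
  have sq: "(norm x)\<^sup>2 = QRe x * QRe x + QI1 x * QI1 x + QI2 x * QI2 x + QI3 x * QI3 x"
    by (simp add: norm_quat_def power2_eq_square)
  show "inverse x * x = 1" "x * inverse x = 1" if "x \<noteq> 0"
  proof -
    have nz: "(norm x)\<^sup>2 \<noteq> 0" using that by simp
    have eq: "Quat (QRe x) (- QI1 x) (- QI2 x) (- QI3 x) * x = (norm x)\<^sup>2 *\<^sub>R 1"
      "x * Quat (QRe x) (- QI1 x) (- QI2 x) (- QI3 x) = (norm x)\<^sup>2 *\<^sub>R 1"
      by (simp_all add: sq defs algebra_simps)
    have sl: "a *\<^sub>R p * q = a *\<^sub>R (p * q)" "p * a *\<^sub>R q = a *\<^sub>R (p * q)" for a and p q :: quat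
      by (simp_all add: defs algebra_simps)
    show "inverse x * x = 1" "x * inverse x = 1"
      unfolding inverse_quat_def sl eq using nz by simp_all
  qed
qed

end

definition qe1 :: quat where "qe1 = Quat 0 1 0 0"
definition qe2 :: quat where "qe2 = Quat 0 0 1 0"
definition qe3 :: quat where "qe3 = Quat 0 0 0 1"

lemma qe_times:
  "qe1 * qe1 = - 1" "qe2 * qe2 = - 1" "qe3 * qe3 = - 1"
  "qe1 * qe2 = qe3" "qe2 * qe3 = qe1" "qe3 * qe1 = qe2"
  "qe2 * qe1 = - qe3" "qe3 * qe2 = - qe1" "qe1 * qe3 = - qe2"
  by (simp_all add: qe1_def qe2_def qe3_def quat_eq_iff times_quat_def uminus_quat_def one_quat_def)

definition imag_units :: "quat set" where
  "imag_units = {J. J * J = - 1}"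

text \<open>The identification \<open>u + \<i> v \<mapsto> u + J v\<close> of the complex plane with \<open>\<complex>\<^sub>J\<close>.\<close>

definition to_slice :: "quat \<Rightarrow> complex \<Rightarrow> quat" where
  "to_slice J z = of_real (Re z) + J * of_real (Im z)"

text \<open>\<open>U \<inter> \<complex>\<^sub>J\<close>, transported to the complex plane along this identification.\<close>

definition slice :: "quat \<Rightarrow> quat set \<Rightarrow> complex set" where
  "slice J U = {z. to_slice J z \<in> U}"

section \<open>Slice Cauchy domains and slice hyperholomorphic functions\<close>

definition axially_symmetric :: "quat set \<Rightarrow> bool" where
  "axially_symmetric U \<longleftrightarrow>
     (\<forall>u v. \<forall>I\<in>imag_units. of_real u + I * of_real v \<in> U \<longrightarrow>
        (\<forall>J\<in>imag_units. of_real u + J * of_real v \<in> U))"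

text \<open>The boundary of \<open>V\<close> is the union of the finitely many, pairwise disjoint,
  piecewise \<open>C\<^sup>1\<close> Jordan curves in \<open>\<Gamma>\<close>.\<close>

definition jordan_boundary :: "(real \<Rightarrow> complex) set \<Rightarrow> complex set \<Rightarrow> bool" where
  "jordan_boundary \<Gamma> V \<longleftrightarrow>
     finite \<Gamma> \<and>
     (\<forall>\<gamma>\<in>\<Gamma>. valid_path \<gamma> \<and> simple_path \<gamma> \<and> pathfinish \<gamma> = pathstart \<gamma>) \<and>
     disjoint_family_on path_image \<Gamma> \<and>
     frontier V = (\<Union>\<gamma>\<in>\<Gamma>. path_image \<gamma>)"

definition slice_cauchy_domain :: "quat set \<Rightarrow> bool" where
  "slice_cauchy_domain U \<longleftrightarrow>
     open U \<and> axially_symmetric U \<and>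
     (\<forall>J\<in>imag_units. \<exists>\<Gamma>. jordan_boundary \<Gamma> (slice J U))"

text \<open>The curves in \<open>\<Gamma>\<close> parametrize the boundary of \<open>V\<close> with its positive orientation
  (\<open>V\<close> on the left), expressed by the total winding number around points of \<open>V\<close> and
  around points off its closure.\<close>

definition oriented_boundary :: "(real \<Rightarrow> complex) set \<Rightarrow> complex set \<Rightarrow> bool" where
  "oriented_boundary \<Gamma> V \<longleftrightarrow>
     jordan_boundary \<Gamma> V \<and>
     (\<forall>z\<in>V. (\<Sum>\<gamma>\<in>\<Gamma>. winding_number \<gamma> z) = 1) \<and>
     (\<forall>z\<in>- closure V. (\<Sum>\<gamma>\<in>\<Gamma>. winding_number \<gamma> z) = 0)"

text \<open>\<open>(\<alpha>, \<beta>)\<close> is a pair of component functions on the axially symmetric open set \<open>U\<close>: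
  total derivatives \<open>A\<close> and \<open>B\<close> of \<open>\<alpha>\<close> and \<open>\<beta>\<close> at \<open>(u, v)\<close>
  exist and satisfy the Cauchy--Riemann equations.\<close>

definition slice_components ::
  "quat set \<Rightarrow> (real \<times> real \<Rightarrow> quat) \<Rightarrow> (real \<times> real \<Rightarrow> quat) \<Rightarrow> bool" where
  "slice_components U \<alpha> \<beta> \<longleftrightarrow>
     open U \<and> axially_symmetric U \<and>
     (\<forall>u v. (\<forall>J\<in>imag_units. of_real u + J * of_real v \<in> U) \<longrightarrow>
        \<alpha> (u, - v) = \<alpha> (u, v) \<and> \<beta> (u, - v) = - \<beta> (u, v) \<and>
        (\<exists>A B. (\<alpha> has_derivative A) (at (u, v)) \<and> (\<beta> has_derivative B) (at (u, v)) \<and>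
           A (1, 0) = B (0, 1) \<and> A (0, 1) = - B (1, 0)))"

definition left_slice_hyperholomorphic_on :: "quat set \<Rightarrow> (quat \<Rightarrow> quat) \<Rightarrow> bool" where
  "left_slice_hyperholomorphic_on U f \<longleftrightarrow>
     (\<exists>\<alpha> \<beta>. slice_components U \<alpha> \<beta> \<and>
        (\<forall>u v. \<forall>J\<in>imag_units. of_real u + J * of_real v \<in> U \<longrightarrow>
           f (of_real u + J * of_real v) = \<alpha> (u, v) + J * \<beta> (u, v)))"

definition right_slice_hyperholomorphic_on :: "quat set \<Rightarrow> (quat \<Rightarrow> quat) \<Rightarrow> bool" where
  "right_slice_hyperholomorphic_on U f \<longleftrightarrow>
     (\<exists>\<alpha> \<beta>. slice_components U \<alpha> \<beta> \<and>
        (\<forall>u v. \<forall>J\<in>imag_units. of_real u + J * of_real v \<in> U \<longrightarrow>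
           f (of_real u + J * of_real v) = \<alpha> (u, v) + \<beta> (u, v) * J))"

definition intrinsic_slice_hyperholomorphic_on :: "quat set \<Rightarrow> (quat \<Rightarrow> quat) \<Rightarrow> bool" where
  "intrinsic_slice_hyperholomorphic_on U f \<longleftrightarrow>
     (\<exists>\<alpha> \<beta>. slice_components U \<alpha> \<beta> \<and>
        (\<forall>u v. \<forall>J\<in>imag_units. of_real u + J * of_real v \<in> U \<longrightarrow>
           \<alpha> (u, v) \<in> range of_real \<and> \<beta> (u, v) \<in> range of_real \<and>
           f (of_real u + J * of_real v) = \<alpha> (u, v) + J * \<beta> (u, v)))"

section \<open>The module \<open>X = X\<^sub>\<real> \<otimes> \<H>\<close> and its operators\<close>

text \<open>The quadruple \<open>(x\<^sub>0, x\<^sub>1, x\<^sub>2, x\<^sub>3)\<close> stands for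
  \<open>x\<^sub>0 \<otimes> 1 + x\<^sub>1 \<otimes> e\<^sub>1 + x\<^sub>2 \<otimes> e\<^sub>2 + x\<^sub>3 \<otimes> e\<^sub>3\<close>.
  The norm is that of the product type; all reasonable norms on \<open>X\<^sub>\<real> \<otimes> \<H>\<close> are
  equivalent, and only the topology enters below.\<close>

type_synonym 'a qmod = "'a \<times> 'a \<times> 'a \<times> 'a"

fun lscale :: "quat \<Rightarrow> 'a::real_vector qmod \<Rightarrow> 'a qmod" where
  "lscale (Quat a b c d) (x0, x1, x2, x3) =
    (a *\<^sub>R x0 - b *\<^sub>R x1 - c *\<^sub>R x2 - d *\<^sub>R x3,
     a *\<^sub>R x1 + b *\<^sub>R x0 + c *\<^sub>R x3 - d *\<^sub>R x2,
     a *\<^sub>R x2 - b *\<^sub>R x3 + c *\<^sub>R x0 + d *\<^sub>R x1,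
     a *\<^sub>R x3 + b *\<^sub>R x2 - c *\<^sub>R x1 + d *\<^sub>R x0)"

fun rscale :: "'a::real_vector qmod \<Rightarrow> quat \<Rightarrow> 'a qmod" where
  "rscale (x0, x1, x2, x3) (Quat a b c d) =
    (a *\<^sub>R x0 - b *\<^sub>R x1 - c *\<^sub>R x2 - d *\<^sub>R x3,
     b *\<^sub>R x0 + a *\<^sub>R x1 + d *\<^sub>R x2 - c *\<^sub>R x3,
     c *\<^sub>R x0 - d *\<^sub>R x1 + a *\<^sub>R x2 + b *\<^sub>R x3,
     d *\<^sub>R x0 + c *\<^sub>R x1 - b *\<^sub>R x2 + a *\<^sub>R x3)"

lemma lscale_assoc: "lscale (p * q) x = lscale p (lscale q x)"
  by (cases p; cases q; cases x) (simp add: times_quat_def algebra_simps)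

lemma rscale_assoc: "rscale x (p * q) = rscale (rscale x p) q"
  by (cases p; cases q; cases x) (simp add: times_quat_def algebra_simps)

lemma lscale_rscale: "lscale p (rscale x q) = rscale (lscale p x) q"
  by (cases p; cases q; cases x) (simp add: algebra_simps)

lemma lscale_sel:
  "lscale q x =
    (QRe q *\<^sub>R fst x - QI1 q *\<^sub>R fst (snd x) - QI2 q *\<^sub>R fst (snd (snd x)) - QI3 q *\<^sub>R snd (snd (snd x)),
     QRe q *\<^sub>R fst (snd x) + QI1 q *\<^sub>R fst x + QI2 q *\<^sub>R snd (snd (snd x)) - QI3 q *\<^sub>R fst (snd (snd x)),
     QRe q *\<^sub>R fst (snd (snd x)) - QI1 q *\<^sub>R snd (snd (snd x)) + QI2 q *\<^sub>R fst x + QI3 q *\<^sub>R fst (snd x),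
     QRe q *\<^sub>R snd (snd (snd x)) + QI1 q *\<^sub>R fst (snd (snd x)) - QI2 q *\<^sub>R fst (snd x) + QI3 q *\<^sub>R fst x)"
  by (cases q; cases x) simp

text \<open>The operator \<open>a \<I>\<close>, so that \<open>a T\<close> and \<open>T a\<close> are
  \<open>lmul a o\<^sub>L T\<close> and \<open>T o\<^sub>L lmul a\<close>.\<close>

lift_definition lmul :: "quat \<Rightarrow> 'a::real_normed_vector qmod \<Rightarrow>\<^sub>L 'a qmod" is lscale
  unfolding lscale_sel by (intro bounded_linear_intros)

text \<open>The componentwise action of an operator on \<open>X\<^sub>\<real>\<close>.\<close>

lift_definition ext_op ::
  "('a::real_normed_vector \<Rightarrow>\<^sub>L 'a) \<Rightarrow> 'a qmod \<Rightarrow>\<^sub>L 'a qmod" is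
  "\<lambda>A x. (A (fst x), A (fst (snd x)), A (fst (snd (snd x))), A (snd (snd (snd x))))"
  by (intro bounded_linear_Pair; rule bounded_linear_compose, assumption,
      intro bounded_linear_intros)

text \<open>\<open>T\<^sub>0 + T\<^sub>1 e\<^sub>1 + T\<^sub>2 e\<^sub>2 + T\<^sub>3 e\<^sub>3\<close>\<close>

definition quat_op ::
  "('a::real_normed_vector \<Rightarrow>\<^sub>L 'a) \<Rightarrow> ('a \<Rightarrow>\<^sub>L 'a) \<Rightarrow> ('a \<Rightarrow>\<^sub>L 'a) \<Rightarrow> ('a \<Rightarrow>\<^sub>L 'a) \<Rightarrow>
    'a qmod \<Rightarrow>\<^sub>L 'a qmod" where
  "quat_op T0 T1 T2 T3 =
     ext_op T0 + (ext_op T1 o\<^sub>L lmul qe1) + (ext_op T2 o\<^sub>L lmul qe2) + (ext_op T3 o\<^sub>L lmul qe3)"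

text \<open>Applied to \<open>x \<otimes> 1\<close>, the operator above yields \<open>(T\<^sub>0 x, T\<^sub>1 x, T\<^sub>2 x, T\<^sub>3 x)\<close>,
  so its components can be read off.\<close>

lift_definition op_part0 :: "('a::real_normed_vector qmod \<Rightarrow>\<^sub>L 'a qmod) \<Rightarrow> 'a \<Rightarrow>\<^sub>L 'a" is
  "\<lambda>T x. fst (T (x, 0, 0, 0))"
  by (intro bounded_linear_intros, rule bounded_linear_compose, assumption,
      intro bounded_linear_intros)

lift_definition op_part1 :: "('a::real_normed_vector qmod \<Rightarrow>\<^sub>L 'a qmod) \<Rightarrow> 'a \<Rightarrow>\<^sub>L 'a" is
  "\<lambda>T x. fst (snd (T (x, 0, 0, 0)))"
  by (intro bounded_linear_intros, rule bounded_linear_compose, assumption,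
      intro bounded_linear_intros)

lift_definition op_part2 :: "('a::real_normed_vector qmod \<Rightarrow>\<^sub>L 'a qmod) \<Rightarrow> 'a \<Rightarrow>\<^sub>L 'a" is
  "\<lambda>T x. fst (snd (snd (T (x, 0, 0, 0))))"
  by (intro bounded_linear_intros, rule bounded_linear_compose, assumption,
      intro bounded_linear_intros)

lift_definition op_part3 :: "('a::real_normed_vector qmod \<Rightarrow>\<^sub>L 'a qmod) \<Rightarrow> 'a \<Rightarrow>\<^sub>L 'a" is
  "\<lambda>T x. snd (snd (snd (T (x, 0, 0, 0))))"
  by (intro bounded_linear_intros, rule bounded_linear_compose, assumption,
      intro bounded_linear_intros)

lemma op_part_quat_op:
  "op_part0 (quat_op T0 T1 T2 T3) = T0" "op_part1 (quat_op T0 T1 T2 T3) = T1"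
  "op_part2 (quat_op T0 T1 T2 T3) = T2" "op_part3 (quat_op T0 T1 T2 T3) = T3"
  by (rule blinfun_eqI;
      simp add: quat_op_def op_part0.rep_eq op_part1.rep_eq op_part2.rep_eq op_part3.rep_eq
        blinfun.add_left ext_op.rep_eq lmul.rep_eq qe1_def qe2_def qe3_def)+

definition op_conj :: "('a::real_normed_vector qmod \<Rightarrow>\<^sub>L 'a qmod) \<Rightarrow> 'a qmod \<Rightarrow>\<^sub>L 'a qmod" where
  "op_conj T = quat_op (op_part0 T) (- op_part1 T) (- op_part2 T) (- op_part3 T)"

text \<open>\<open>T\<^sub>1 e\<^sub>1 + T\<^sub>2 e\<^sub>2 + T\<^sub>3 e\<^sub>3\<close>\<close>

definition op_vec :: "('a::real_normed_vector qmod \<Rightarrow>\<^sub>L 'a qmod) \<Rightarrow> 'a qmod \<Rightarrow>\<^sub>L 'a qmod" where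
  "op_vec T = quat_op 0 (op_part1 T) (op_part2 T) (op_part3 T)"

text \<open>\<open>\<B>(X)\<close>: additivity, real homogeneity and boundedness are part of the type.\<close>

definition right_linear_ops :: "('a::real_normed_vector qmod \<Rightarrow>\<^sub>L 'a qmod) set" where
  "right_linear_ops = {T. \<forall>x a. blinfun_apply T (rscale x a) = rscale (blinfun_apply T x) a}"

text \<open>\<open>\<B>\<C>(X)\<close>: operators whose components commute pairwise.\<close>

definition commuting_ops :: "('a::real_normed_vector qmod \<Rightarrow>\<^sub>L 'a qmod) set" where
  "commuting_ops = {quat_op T0 T1 T2 T3 | T0 T1 T2 T3.
     \<forall>A\<in>{T0, T1, T2, T3}. \<forall>B\<in>{T0, T1, T2, T3}. A o\<^sub>L B = B o\<^sub>L A}"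

lemma commuting_ops_subset: "commuting_ops \<subseteq> right_linear_ops"
proof -
  have "quat_op T0 T1 T2 T3 (rscale x a) = rscale (quat_op T0 T1 T2 T3 x) a"
    for T0 T1 T2 T3 :: "'a::real_normed_vector \<Rightarrow>\<^sub>L 'a" and x a
    by (cases x; cases a)
      (simp add: quat_op_def blinfun.add_left blinfun.add_right blinfun.diff_right
        blinfun.scaleR_right ext_op.rep_eq lmul.rep_eq qe1_def qe2_def qe3_def algebra_simps
        blinfun.minus_right)
  then show ?thesis
    by (auto simp: commuting_ops_def right_linear_ops_def)
qed

definition op_invertible :: "('a::real_normed_vector qmod \<Rightarrow>\<^sub>L 'a qmod) \<Rightarrow> bool" where
  "op_invertible A \<longleftrightarrow>
     (\<exists>B\<in>right_linear_ops. A o\<^sub>L B = id_blinfun \<and> B o\<^sub>L A = id_blinfun)"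

definition op_inv :: "('a::real_normed_vector qmod \<Rightarrow>\<^sub>L 'a qmod) \<Rightarrow> 'a qmod \<Rightarrow>\<^sub>L 'a qmod" where
  "op_inv A = (THE B. B \<in> right_linear_ops \<and> A o\<^sub>L B = id_blinfun \<and> B o\<^sub>L A = id_blinfun)"

section \<open>S-spectrum and functional calculi\<close>

definition S_resolvent_set :: "('a::real_normed_vector qmod \<Rightarrow>\<^sub>L 'a qmod) \<Rightarrow> quat set" where
  "S_resolvent_set T =
     {s. op_invertible ((T o\<^sub>L T) - (2 * QRe s) *\<^sub>R T + (norm s)\<^sup>2 *\<^sub>R id_blinfun)}"

definition S_spectrum :: "('a::real_normed_vector qmod \<Rightarrow>\<^sub>L 'a qmod) \<Rightarrow> quat set" where
  "S_spectrum T = - S_resolvent_set T"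

definition Qc :: "quat \<Rightarrow> ('a::real_normed_vector qmod \<Rightarrow>\<^sub>L 'a qmod) \<Rightarrow> 'a qmod \<Rightarrow>\<^sub>L 'a qmod" where
  "Qc s T = lmul (s\<^sup>2) - (lmul s o\<^sub>L (T + op_conj T)) + (T o\<^sub>L op_conj T)"

definition S_left_resolvent ::
  "quat \<Rightarrow> ('a::real_normed_vector qmod \<Rightarrow>\<^sub>L 'a qmod) \<Rightarrow> 'a qmod \<Rightarrow>\<^sub>L 'a qmod" where
  "S_left_resolvent s T = (lmul s - op_conj T) o\<^sub>L op_inv (Qc s T)"

definition S_right_resolvent ::
  "quat \<Rightarrow> ('a::real_normed_vector qmod \<Rightarrow>\<^sub>L 'a qmod) \<Rightarrow> 'a qmod \<Rightarrow>\<^sub>L 'a qmod" where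
  "S_right_resolvent s T = op_inv (Qc s T) o\<^sub>L (lmul s - op_conj T)"

text \<open>The line integrals of \<open>K(s) ds\<^sub>J f(s)\<close> and \<open>f(s) ds\<^sub>J K(s)\<close>, where
  \<open>ds\<^sub>J = ds (-J)\<close>, over the curves in \<open>\<Gamma>\<close> transported to \<open>\<complex>\<^sub>J\<close>.\<close>

definition left_slice_integral ::
  "quat \<Rightarrow> (real \<Rightarrow> complex) set \<Rightarrow> (quat \<Rightarrow> 'a::banach qmod \<Rightarrow>\<^sub>L 'a qmod) \<Rightarrow>
    (quat \<Rightarrow> quat) \<Rightarrow> 'a qmod \<Rightarrow>\<^sub>L 'a qmod" where
  "left_slice_integral J \<Gamma> K f =
     (\<Sum>\<gamma>\<in>\<Gamma>. integral {0..1} (\<lambda>t.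
        K (to_slice J (\<gamma> t)) o\<^sub>L
        lmul (to_slice J (vector_derivative \<gamma> (at t within {0..1})) * (- J)) o\<^sub>L
        lmul (f (to_slice J (\<gamma> t)))))"

definition right_slice_integral ::
  "quat \<Rightarrow> (real \<Rightarrow> complex) set \<Rightarrow> (quat \<Rightarrow> 'a::banach qmod \<Rightarrow>\<^sub>L 'a qmod) \<Rightarrow>
    (quat \<Rightarrow> quat) \<Rightarrow> 'a qmod \<Rightarrow>\<^sub>L 'a qmod" where
  "right_slice_integral J \<Gamma> K f =
     (\<Sum>\<gamma>\<in>\<Gamma>. integral {0..1} (\<lambda>t.
        lmul (f (to_slice J (\<gamma> t))) o\<^sub>L
        lmul (to_slice J (vector_derivative \<gamma> (at t within {0..1})) * (- J)) o\<^sub>L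
        K (to_slice J (\<gamma> t))))"

text \<open>The contours \<open>\<partial>(U \<inter> \<complex>\<^sub>J)\<close> over which the functional calculi may be computed, for
  a function with domain \<open>D\<close>.  That the integrals do not depend on the contour is a theorem,
  which is not built into the definitions: the contour remains an explicit argument of each
  calculus.\<close>

definition calc_contours ::
  "('a::real_normed_vector qmod \<Rightarrow>\<^sub>L 'a qmod) \<Rightarrow> quat set \<Rightarrow> (quat \<times> (real \<Rightarrow> complex) set) set" where
  "calc_contours T D = {(J, \<Gamma>). J \<in> imag_units \<and>
     (\<exists>U. bounded U \<and> slice_cauchy_domain U \<and> S_spectrum T \<subseteq> U \<and> closure U \<subseteq> D \<and>
        oriented_boundary \<Gamma> (slice J U))}"

text \<open>\<open>f(T)\<close>, \<open>(\<D> f)(T)\<close> for left, and \<open>f(T)\<close>, \<open>(f \<D>)(T)\<close> for right slice hyperholomorphic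
  \<open>f\<close>\<close>

definition left_S_calc ::
  "quat \<times> (real \<Rightarrow> complex) set \<Rightarrow> ('a::banach qmod \<Rightarrow>\<^sub>L 'a qmod) \<Rightarrow> (quat \<Rightarrow> quat) \<Rightarrow>
    'a qmod \<Rightarrow>\<^sub>L 'a qmod" where
  "left_S_calc C T f =
     (1 / (2 * pi)) *\<^sub>R left_slice_integral (fst C) (snd C) (\<lambda>s. S_left_resolvent s T) f"

definition left_Q_calc ::
  "quat \<times> (real \<Rightarrow> complex) set \<Rightarrow> ('a::banach qmod \<Rightarrow>\<^sub>L 'a qmod) \<Rightarrow> (quat \<Rightarrow> quat) \<Rightarrow>
    'a qmod \<Rightarrow>\<^sub>L 'a qmod" where
  "left_Q_calc C T f =
     (- 1 / pi) *\<^sub>R left_slice_integral (fst C) (snd C) (\<lambda>s. op_inv (Qc s T)) f"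

definition right_S_calc ::
  "quat \<times> (real \<Rightarrow> complex) set \<Rightarrow> ('a::banach qmod \<Rightarrow>\<^sub>L 'a qmod) \<Rightarrow> (quat \<Rightarrow> quat) \<Rightarrow>
    'a qmod \<Rightarrow>\<^sub>L 'a qmod" where
  "right_S_calc C T f =
     (1 / (2 * pi)) *\<^sub>R right_slice_integral (fst C) (snd C) (\<lambda>s. S_right_resolvent s T) f"

definition right_Q_calc ::
  "quat \<times> (real \<Rightarrow> complex) set \<Rightarrow> ('a::banach qmod \<Rightarrow>\<^sub>L 'a qmod) \<Rightarrow> (quat \<Rightarrow> quat) \<Rightarrow>
    'a qmod \<Rightarrow>\<^sub>L 'a qmod" where
  "right_Q_calc C T f =
     (- 1 / pi) *\<^sub>R right_slice_integral (fst C) (snd C) (\<lambda>s. op_inv (Qc s T)) f"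

end

theory Submission
  imports Defs
begin

text \<open>
  Put \<open>P f = (2 \<pi>)\<^sup>-\<^sup>1 \<integral> Q\<^sub>c\<^sub>,\<^sub>s(T)\<^sup>-\<^sup>1 ds\<^sub>J f(s)\<close>. For intrinsic \<open>f\<close> one has
  \<open>(\<D> f)(T) = - 2 P f\<close> and \<open>f(T) = P (s f) - T* P f\<close>, where \<open>T*\<close> is the conjugate of \<open>T\<close>. The
  operator \<open>P f\<close> depends neither on the contour nor on \<open>J\<close> and commutes with all quaternions: conjugation
  by a unit orthogonal to \<open>J\<close> reflects the contour in the real axis. Writing a left slice
  hyperholomorphic \<open>g\<close> as \<open>\<Sum> g\<^sub>k e\<^sub>k\<close> with intrinsic \<open>g\<^sub>k\<close> reduces everything to
  \<open>P (f g) = P (s f) P g + P f P (s g) - (T + T*) P f P g\<close> for intrinsic \<open>f\<close> and \<open>g\<close>.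

  Write \<open>q(z)\<close> for the inverse of \<open>Q\<^sub>c\<^sub>,\<^sub>z(T)\<close>. Since
  \<open>q(z) - q(w) = (w - z) (w + z - T - T*) q(z) q(w)\<close>, the operator
  \<open>q(z) (P (s g) + (z - T - T*) P g)\<close> equals \<open>g(z) q(z)\<close> minus the Cauchy transform of \<open>g q\<close> whenever the
  contour winds once around \<open>z\<close>. So \<open>g(z) q(z) - q(z) (P (s g) + (z - T - T*) P g)\<close>, which is defined off the
  spectrum, extends by the Cauchy transform to a holomorphic function on the whole domain of \<open>g\<close>; multiplied
  by \<open>f\<close> its contour integral vanishes, which is the formula. No nested contours are needed. Banach-valued
  identities are tested on functionals, so that only the scalar Cauchy theorem for cycles, proved by Dixon's
  argument, enters.
\<close>

section \<open>The Hahn--Banach theorem for norms\<close>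

text \<open>The five contours of the statement, each with its own imaginary unit, are unrelated, so
  independence of contour and unit is part of what has to be shown: only over one common contour can
  the terms be compared. Write \<open>T'\<close> for \<open>op_conj T\<close> and
  \<open>a = P (s f)\<close>, \<open>b = P f\<close>, \<open>c = P g\<close>,
  \<open>d = P (s g)\<close>. The left side is -2 (a c + b d - (T + T') b c), while the first two
  products on the right give -2 (a c + b d) + 4 T' b c. What is missing is 4 b ((T + T') / 2 - T')
  c, and (T + T') / 2 - T' is the vector part of T: this is the origin of the third term. The
  computation needs b to commute with \<open>T'\<close>. Left composition with \<open>lmul J\<close>
  is a complex structure on the operators. Real functionals extend to complex linear ones for it,
  which is how operator-valued statements become scalar ones.\<close>

definition dominated_graphs :: "('a::real_normed_vector \<times> real) set set" where
  "dominated_graphs = {G. subspace G \<and> (\<forall>(x, r)\<in>G. r \<le> norm x)}"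

text \<open>Partial functionals are encoded by their graphs. Only a dominated subspace is asked for:
  if \<open>(0, r)\<close> belongs to it, so does \<open>(0, - r)\<close>, and domination gives
  \<open>r = 0\<close>, so the graph is single-valued by itself.\<close>

lemma dominated_graphs_Union:
  assumes "C \<noteq> {}" and "subset.chain dominated_graphs C"
  shows "\<Union>C \<in> dominated_graphs"
proof -
  have sub: "\<And>G. G \<in> C \<Longrightarrow> G \<in> dominated_graphs"
    and lin: "\<And>G H. G \<in> C \<Longrightarrow> H \<in> C \<Longrightarrow> G \<subseteq> H \<or> H \<subseteq> G"
    using assms(2) by (auto simp: subset_chain_def)
  have "subspace (\<Union>C)"
  proof (rule subspaceI)
    show "0 \<in> \<Union>C"
      using assms(1) sub by (auto simp: dominated_graphs_def subspace_0)
    show "c *\<^sub>R p \<in> \<Union>C" if "p \<in> \<Union>C" for c p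
      using that sub by (auto simp: dominated_graphs_def intro!: subspace_scale)
    show "p + q \<in> \<Union>C" if "p \<in> \<Union>C" "q \<in> \<Union>C" for p q
    proof -
      obtain G H where "p \<in> G" "q \<in> H" "G \<in> C" "H \<in> C" using \<open>p \<in> \<Union>C\<close> \<open>q \<in> \<Union>C\<close> by blast
      with lin obtain K where "p \<in> K" "q \<in> K" "K \<in> C" by blast
      with sub show ?thesis by (auto simp: dominated_graphs_def intro: subspace_add)
    qed
  qed
  then show ?thesis using sub by (auto simp: dominated_graphs_def)
qed

text \<open>A value at \<open>x0\<close> is admissible iff it lies above every
  \<open>r - norm (x - x0)\<close> and below every \<open>norm (y + x0) - s\<close>. The triangle
  inequality makes the two families compatible, and \<open>c\<close> is the supremum of the lower
  one.\<close>

lemma dominated_graphs_extend: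
  assumes G: "G \<in> dominated_graphs" and x0: "x0 \<notin> fst ` G"
  obtains G' where "G' \<in> dominated_graphs" "G \<subset> G'"
proof -
  have sub: "subspace G" and dom: "\<And>x r. (x, r) \<in> G \<Longrightarrow> r \<le> norm x"
    using G by (auto simp: dominated_graphs_def)
  have gap: "r - norm (x - x0) \<le> norm (y + x0) - s" if "(x, r) \<in> G" "(y, s) \<in> G" for x r y s
  proof -
    have "(x, r) + (y, s) \<in> G" using that sub by (blast intro: subspace_add)
    then have "r + s \<le> norm (x + y)" by (simp add: dom)
    also have "\<dots> \<le> norm (x - x0) + norm (y + x0)"
      using norm_triangle_ineq [of "x - x0" "y + x0"] by simp
    finally show ?thesis by simp
  qed
  define L where "L = (\<lambda>(x, r). r - norm (x - x0)) ` G"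
  define c where "c = Sup L"
  have G0: "(0, 0) \<in> G" using subspace_0 [OF sub] by (simp add: zero_prod_def)
  have bdd: "bdd_above L"
    unfolding bdd_above_def
  proof (intro exI ballI)
    fix m assume "m \<in> L"
    then obtain p where p: "p \<in> G" "m = (\<lambda>(x, r). r - norm (x - x0)) p" unfolding L_def by (rule imageE)
    obtain x r where "p = (x, r)" by (rule prod.exhaust)
    with p have "(x, r) \<in> G" "m = r - norm (x - x0)" by simp_all
    then show "m \<le> norm x0" using gap [OF _ G0] by simp
  qed
  have lo: "r - norm (x - x0) \<le> c" if "(x, r) \<in> G" for x r
    unfolding c_def by (rule cSup_upper [OF _ bdd]) (use that in \<open>force simp: L_def\<close>)
  have up: "c \<le> norm (x + x0) - r" if "(x, r) \<in> G" for x r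
    unfolding c_def by (rule cSup_least) (use that G0 gap in \<open>auto simp: L_def\<close>)
  define G' where "G' = {p + t *\<^sub>R (x0, c) | p t. p \<in> G}"
  have "G' = {p + q | p q. p \<in> G \<and> q \<in> span {(x0, c)}}"
  proof (intro equalityI subsetI)
    fix p assume "p \<in> G'"
    then obtain q t where "q \<in> G" "p = q + t *\<^sub>R (x0, c)" unfolding G'_def by blast
    then show "p \<in> {p + q | p q. p \<in> G \<and> q \<in> span {(x0, c)}}"
      using span_scale [OF span_base [of "(x0, c)" "{(x0, c)}"], of t] by blast
  next
    fix p assume "p \<in> {p + q | p q. p \<in> G \<and> q \<in> span {(x0, c)}}"
    then obtain q t where "q \<in> G" "p = q + t *\<^sub>R (x0, c)" unfolding span_singleton by blast
    then show "p \<in> G'" unfolding G'_def by blast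
  qed
  then have "subspace G'"
    by (simp only: subspace_sums [OF sub subspace_span])
  moreover have "s \<le> norm y" if "(y, s) \<in> G'" for y s
  proof -
    obtain x r t where xr: "(x, r) \<in> G" and y: "y = x + t *\<^sub>R x0" and s: "s = r + t * c"
      using \<open>(y, s) \<in> G'\<close> by (auto simp: G'_def)
    have sc: "(x /\<^sub>R a, r / a) \<in> G" for a
      using subspace_scale [OF sub xr, of "inverse a"] by (simp add: field_simps)
    \<comment> \<open>After division by the modulus of \<open>t\<close>, the sign of
      \<open>t\<close> decides whether the upper or the lower bound on \<open>c\<close>
      applies.\<close>
    consider "t = 0" | "t > 0" | "t < 0" by linarith
    then show ?thesis
    proof cases
      case 1
      then show ?thesis using dom [OF xr] by (simp add: y s)
    next
      case 2
      have "c \<le> norm (x /\<^sub>R t + x0) - r / t" by (rule up [OF sc])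
      then have "t * c \<le> t * norm (x /\<^sub>R t + x0) - r"
        using 2 by (simp add: field_simps)
      also have "t * norm (x /\<^sub>R t + x0) = norm (t *\<^sub>R (x /\<^sub>R t + x0))" using 2 by simp
      also have "t *\<^sub>R (x /\<^sub>R t + x0) = y" using 2 by (simp add: y scaleR_add_right)
      finally show ?thesis by (simp add: s)
    next
      case 3
      have "r / (- t) - norm (x /\<^sub>R (- t) - x0) \<le> c" by (rule lo [OF sc])
      then have "r - (- t) * norm (x /\<^sub>R (- t) - x0) \<le> (- t) * c"
        using 3 by (simp add: field_simps)
      also have "(- t) * norm (x /\<^sub>R (- t) - x0) = norm ((- t) *\<^sub>R (x /\<^sub>R (- t) - x0))" using 3 by simp
      also have "(- t) *\<^sub>R (x /\<^sub>R (- t) - x0) = y" using 3 by (simp add: y scaleR_diff_right)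
      finally show ?thesis by (simp add: s)
    qed
  qed
  ultimately have "G' \<in> dominated_graphs" by (auto simp: dominated_graphs_def)
  moreover have "G \<subseteq> G'"
  proof
    fix p assume "p \<in> G"
    then show "p \<in> G'" unfolding G'_def by (intro CollectI exI [of _ p] exI [of _ 0]) (simp flip: zero_prod_def)
  qed
  moreover have "(x0, c) \<in> G'"
    unfolding G'_def using G0 by (intro CollectI exI [of _ "(0, 0)"] exI [of _ 1]) simp
  then have "G \<noteq> G'" using x0 by (metis fst_conv image_eqI)
  ultimately show thesis using that by blast
qed

text \<open>Zorn's lemma is applied to the graphs that contain the line through
  \<open>(x0, norm x0)\<close>; a maximal one has the whole space as its domain, since otherwise it
  could be extended.\<close>

lemma Hahn_Banach_norming_functional:
  fixes x0 :: "'a::real_normed_vector"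
  obtains \<phi> :: "'a \<Rightarrow> real" where "bounded_linear \<phi>" "\<phi> x0 = norm x0"
proof -
  define G0 where "G0 = span {(x0, norm x0)}"
  have G0: "G0 \<in> dominated_graphs"
  proof -
    have "\<forall>(x, r)\<in>G0. r \<le> norm x"
      by (auto simp: G0_def span_singleton mult_right_mono)
    then show ?thesis
      by (simp add: dominated_graphs_def G0_def del: span_singleton)
  qed
  have "\<exists>M\<in>{G \<in> dominated_graphs. G0 \<subseteq> G}. \<forall>X\<in>{G \<in> dominated_graphs. G0 \<subseteq> G}. M \<subseteq> X \<longrightarrow> X = M"
  proof (rule subset_Zorn_nonempty)
    show "{G \<in> dominated_graphs. G0 \<subseteq> G} \<noteq> {}" using G0 by blast
    fix C :: "('a \<times> real) set set"
    assume "C \<noteq> {}" and ch: "subset.chain {G \<in> dominated_graphs. G0 \<subseteq> G} C"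
    then have "subset.chain dominated_graphs C" by (auto simp: subset_chain_def)
    then have "\<Union>C \<in> dominated_graphs" by (rule dominated_graphs_Union [OF \<open>C \<noteq> {}\<close>])
    moreover obtain G where "G \<in> C" using \<open>C \<noteq> {}\<close> by blast
    then have "G0 \<subseteq> G" using ch by (auto simp: subset_chain_def)
    with \<open>G \<in> C\<close> have "G0 \<subseteq> \<Union>C" by (meson Union_upper order_trans)
    ultimately show "\<Union>C \<in> {G \<in> dominated_graphs. G0 \<subseteq> G}" by simp
  qed
  then obtain M where M0: "M \<in> {G \<in> dominated_graphs. G0 \<subseteq> G}"
    and max0: "\<forall>X\<in>{G \<in> dominated_graphs. G0 \<subseteq> G}. M \<subseteq> X \<longrightarrow> X = M" ..
  have M: "M \<in> dominated_graphs" "G0 \<subseteq> M" using M0 by simp_all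
  have max: "X = M" if "X \<in> dominated_graphs" "M \<subseteq> X" for X
    using max0 that order_trans [OF M(2) that(2)] by simp
  have sub: "subspace M" and dom: "\<And>x r. (x, r) \<in> M \<Longrightarrow> r \<le> norm x"
    using M by (auto simp: dominated_graphs_def)
  have total: "\<exists>r. (x, r) \<in> M" for x
  proof (rule ccontr)
    assume "\<nexists>r. (x, r) \<in> M"
    then have "x \<notin> fst ` M" by force
    then obtain G' where "G' \<in> dominated_graphs" "M \<subset> G'"
      using dominated_graphs_extend M(1) by blast
    then show False using max [of G'] by (simp add: psubset_eq)
  qed
  define \<phi> where "\<phi> x = (SOME r. (x, r) \<in> M)" for x
  have \<phi>: "(x, \<phi> x) \<in> M" for x unfolding \<phi>_def using total by (rule someI_ex)
  have abs: "\<bar>r\<bar> \<le> norm x" if "(x, r) \<in> M" for x r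
    using dom [OF that] dom [of "- x" "- r"] subspace_neg [OF sub that] by auto
  \<comment> \<open>The difference is the vertical vector \<open>(0, r - s)\<close>, which
    domination forces to vanish.\<close>
  have uniq: "r = s" if "(x, r) \<in> M" "(x, s) \<in> M" for x r s
    using abs [of 0 "r - s"] subspace_diff [OF sub that] by simp
  have "bounded_linear \<phi>"
  proof (rule bounded_linear_intro)
    show "\<phi> (x + y) = \<phi> x + \<phi> y" for x y
      using subspace_add [OF sub \<phi> \<phi>, of x y] by (auto intro: uniq [OF \<phi>])
    show "\<phi> (c *\<^sub>R x) = c *\<^sub>R \<phi> x" for c x
      using subspace_scale [OF sub \<phi>, of c x] by (auto intro: uniq [OF \<phi>])
    show "norm (\<phi> x) \<le> norm x * 1" for x using abs [OF \<phi>] by simp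
  qed
  moreover have "(x0, norm x0) \<in> M" using M(2) span_base [of "(x0, norm x0)" "{(x0, norm x0)}"] unfolding G0_def
    by (meson singletonI subsetD)
  then have "\<phi> x0 = norm x0" by (rule uniq [OF \<phi>])
  ultimately show thesis by (rule that)
qed

lemma eq_if_functionals_eq:
  fixes x y :: "'a::real_normed_vector"
  assumes "\<And>\<phi> :: 'a \<Rightarrow> real. bounded_linear \<phi> \<Longrightarrow> \<phi> x = \<phi> y"
  shows "x = y"
proof -
  obtain \<phi> :: "'a \<Rightarrow> real" where \<phi>: "bounded_linear \<phi>" "\<phi> (x - y) = norm (x - y)"
    by (rule Hahn_Banach_norming_functional)
  have "\<phi> (x - y) = 0" using assms [OF \<phi>(1)] by (simp add: linear_simps(2) [OF \<phi>(1)])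
  then show ?thesis using \<phi>(2) by simp
qed

section \<open>Cauchy's theorem for weighted cycles\<close>

text \<open>The derivative of a \<open>valid_path\<close> may be unbounded near its exceptional points, so such a path need
  not be rectifiable. Integrals along it are therefore moved to polynomial paths, and operator-valued
  integrands are integrated by means of local primitives.\<close>

lemma valid_path_polynomial_approx:
  assumes "open S" "valid_path \<gamma>" "path_image \<gamma> \<subseteq> S"
  obtains p where "polynomial_function p" "path_image p \<subseteq> S"
    "\<And>f. f holomorphic_on S \<Longrightarrow> contour_integral \<gamma> f = contour_integral p f"
proof -
  have "path \<gamma>" using assms(2) by (rule valid_path_imp_path)
  then obtain d where "d > 0" and d: "\<And>g h. \<lbrakk>valid_path g; valid_path h;
      \<forall>t\<in>{0..1}. norm (g t - \<gamma> t) < d \<and> norm (h t - \<gamma> t) < d;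
      pathstart h = pathstart g \<and> pathfinish h = pathfinish g\<rbrakk> \<Longrightarrow>
      path_image g \<subseteq> S \<and> path_image h \<subseteq> S \<and>
      (\<forall>f. f holomorphic_on S \<longrightarrow> contour_integral h f = contour_integral g f)"
    using contour_integral_nearby_ends [OF assms(1) _ assms(3)] by metis
  obtain p where p: "polynomial_function p" "pathstart p = pathstart \<gamma>" "pathfinish p = pathfinish \<gamma>"
    "\<And>t. t \<in> {0..1} \<Longrightarrow> norm (p t - \<gamma> t) < d"
    using path_approx_polynomial_function [OF \<open>path \<gamma>\<close> \<open>d > 0\<close>] by metis
  show thesis
    by (rule that [of p])
      (use p \<open>d > 0\<close> d [of p \<gamma>] assms(2) in \<open>auto simp: valid_path_polynomial_function\<close>)
qed

text \<open>This class covers the paths that are integrated over directly: polynomial replacements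
  of a contour, and the segments in Morera's theorem. A derivative continuous up to the ends gives
  bounded speed and continuous integrands, neither of which a \<open>valid_path\<close>
  guarantees.\<close>

definition smooth_path :: "(real \<Rightarrow> complex) \<Rightarrow> bool" where
  "smooth_path \<gamma> \<longleftrightarrow> valid_path \<gamma> \<and> continuous_on {0..1} (\<lambda>t. vector_derivative \<gamma> (at t))"

lemma smooth_path_polynomial:
  assumes "polynomial_function p"
  shows "smooth_path p"
proof -
  obtain p' where p': "polynomial_function p'" "\<And>t. (p has_vector_derivative p' t) (at t)"
    using has_vector_derivative_polynomial_function [OF assms] by blast
  then have "vector_derivative p (at t) = p' t" for t by (simp add: vector_derivative_at)
  then show ?thesis
    using assms p'(1)
    by (simp add: smooth_path_def valid_path_polynomial_function continuous_on_polymonial_function)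
qed

lemma smooth_path_linepath: "smooth_path (linepath a b)"
  by (simp add: smooth_path_def)

lemma smooth_path_bounded_derivative:
  assumes "smooth_path \<gamma>"
  obtains B where "\<And>t. t \<in> {0..1} \<Longrightarrow> norm (vector_derivative \<gamma> (at t)) \<le> B"
proof -
  have "bounded ((\<lambda>t. vector_derivative \<gamma> (at t)) ` {0..1})"
    using assms by (auto simp: smooth_path_def intro!: compact_imp_bounded compact_continuous_image)
  then obtain B where "\<forall>y\<in>(\<lambda>t. vector_derivative \<gamma> (at t)) ` {0..1}. norm y \<le> B"
    unfolding bounded_iff ..
  then show thesis by (intro that [of B]) simp
qed

lemma contour_integrable_smooth_path:
  assumes "smooth_path \<gamma>" "continuous_on (path_image \<gamma>) f"
  shows "f contour_integrable_on \<gamma>"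
proof -
  have "continuous_on {0..1} \<gamma>"
    using assms(1) valid_path_imp_path by (auto simp: smooth_path_def path_def)
  then have "continuous_on {0..1} (\<lambda>t. f (\<gamma> t))"
    by (rule continuous_on_compose2 [OF assms(2)]) (simp add: path_image_def)
  then show ?thesis
    using assms(1) unfolding contour_integrable_on smooth_path_def
    by (intro integrable_continuous_real continuous_on_mult) auto
qed

lemma continuous_on_contour_integral_param:
  fixes k :: "complex \<Rightarrow> complex \<Rightarrow> complex"
  assumes "smooth_path \<gamma>" "continuous_on (U \<times> path_image \<gamma>) (\<lambda>(z, w). k z w)"
  shows "continuous_on U (\<lambda>z. contour_integral \<gamma> (k z))"
proof -
  have g: "continuous_on {0..1} \<gamma>" "continuous_on {0..1} (\<lambda>t. vector_derivative \<gamma> (at t))"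
    using assms(1) valid_path_imp_path by (auto simp: smooth_path_def path_def)
  have "continuous_on (U \<times> {0..1}) (\<lambda>(z, t). k z (\<gamma> t) * vector_derivative \<gamma> (at t))"
    unfolding split_beta
    by (intro continuous_on_mult continuous_on_compose2 [OF assms(2), of _ "\<lambda>p. (fst p, \<gamma> (snd p))", simplified]
        continuous_on_compose2 [OF g(1)] continuous_on_compose2 [OF g(2)] continuous_intros)
      (auto simp: path_image_def)
  then have "continuous_on U (\<lambda>z. integral (cbox 0 1) (\<lambda>t. k z (\<gamma> t) * vector_derivative \<gamma> (at t)))"
    by (intro integral_continuous_on_param) simp
  then show ?thesis by (simp add: contour_integral_integral)
qed

text \<open>Morera's theorem: the integral over a triangle may be exchanged with the one over
  \<open>\<gamma>\<close>, and the inner triangle integral vanishes by holomorphy in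
  \<open>z\<close>.\<close>

lemma holomorphic_contour_integral_param:
  fixes k :: "complex \<Rightarrow> complex \<Rightarrow> complex"
  assumes "open U" and sm: "smooth_path \<gamma>"
    and cont: "continuous_on (U \<times> path_image \<gamma>) (\<lambda>(z, w). k z w)"
    and hol: "\<And>w. w \<in> path_image \<gamma> \<Longrightarrow> (\<lambda>z. k z w) holomorphic_on U"
  shows "(\<lambda>z. contour_integral \<gamma> (k z)) holomorphic_on U"
proof -
  let ?h = "\<lambda>z. contour_integral \<gamma> (k z)"
  have "?h analytic_on U"
  proof (rule Morera_triangle [OF continuous_on_contour_integral_param [OF sm cont] \<open>open U\<close>], rule impI)
    fix a b c :: complex
    assume abc: "convex hull {a, b, c} \<subseteq> U"
    have seg: "closed_segment a b \<subseteq> U" "closed_segment b c \<subseteq> U" "closed_segment c a \<subseteq> U"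
      by (rule order_trans [OF segments_subset_convex_hull(1) [of a b c] abc]
          order_trans [OF segments_subset_convex_hull(3) [of b c a] abc]
          order_trans [OF segments_subset_convex_hull(5) [of c a b] abc])+
    have swap: "contour_integral (linepath x y) ?h
        = contour_integral \<gamma> (\<lambda>w. contour_integral (linepath x y) (\<lambda>z. k z w))"
      if "closed_segment x y \<subseteq> U" for x y
      by (rule contour_integral_swap)
        (use sm that in \<open>auto simp: smooth_path_def intro: continuous_on_subset [OF cont]\<close>)
    have int: "(\<lambda>w. contour_integral (linepath x y) (\<lambda>z. k z w)) contour_integrable_on \<gamma>"
      if "closed_segment x y \<subseteq> U" for x y
    proof -
      have "continuous_on (path_image \<gamma> \<times> path_image (linepath x y)) (\<lambda>(w, z). k z w)"
        by (rule continuous_on_swap_args [OF continuous_on_subset [OF cont]]) (use that in auto)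
      then show ?thesis
        by (intro contour_integrable_smooth_path [OF sm] continuous_on_contour_integral_param
            smooth_path_linepath)
    qed
    have "contour_integral (linepath a b) (\<lambda>z. k z w) + contour_integral (linepath b c) (\<lambda>z. k z w)
        + contour_integral (linepath c a) (\<lambda>z. k z w) = 0" if "w \<in> path_image \<gamma>" for w
    proof -
      have hl: "(\<lambda>z. k z w) holomorphic_on convex hull {a, b, c}"
        using hol [OF that] abc by (rule holomorphic_on_subset)
      have *: "(\<lambda>z. k z w) contour_integrable_on linepath x y" if "closed_segment x y \<subseteq> U" for x y
        using that hol [OF \<open>w \<in> path_image \<gamma>\<close>] \<open>open U\<close>
        by (intro contour_integrable_holomorphic_simple) auto
      show ?thesis
        using contour_integral_unique [OF Cauchy_theorem_triangle [OF hl]] * seg by (simp add: add.assoc)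
    qed
    then have "contour_integral \<gamma> (\<lambda>w. contour_integral (linepath a b) (\<lambda>z. k z w)
        + contour_integral (linepath b c) (\<lambda>z. k z w) + contour_integral (linepath c a) (\<lambda>z. k z w)) = 0"
      by (intro contour_integral_eq_0) auto
    then show "contour_integral (linepath a b) ?h + contour_integral (linepath b c) ?h
        + contour_integral (linepath c a) ?h = 0"
      using swap [OF seg(1)] swap [OF seg(2)] swap [OF seg(3)] int [OF seg(1)] int [OF seg(2)] int [OF seg(3)]
      by (simp add: contour_integral_add contour_integrable_add)
  qed
  then show ?thesis by (rule analytic_imp_holomorphic)
qed

text \<open>Around \<open>z0\<close> the contour is replaced by a polynomial path in
  \<open>S\<close> minus a closed disc about \<open>z0\<close>. One replacement serves all
  \<open>z\<close> in the open disc, because the integrals agree for every function holomorphic on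
  that set.\<close>

lemma Cauchy_transform_holomorphic:
  assumes S: "open S" "f holomorphic_on S" and \<gamma>: "valid_path \<gamma>" "path_image \<gamma> \<subseteq> S"
  shows "(\<lambda>z. contour_integral \<gamma> (\<lambda>w. f w / (w - z))) holomorphic_on - path_image \<gamma>"
proof -
  have op: "open (- path_image \<gamma>)"
    using \<gamma>(1) by (simp add: closed_valid_path_image open_Compl)
  have "(\<lambda>z. contour_integral \<gamma> (\<lambda>w. f w / (w - z))) field_differentiable at z0"
    if z0: "z0 \<in> - path_image \<gamma>" for z0
  proof -
    obtain r where r: "r > 0" "cball z0 r \<subseteq> - path_image \<gamma>"
      using op z0 open_contains_cball by blast
    define S' where "S' = S - cball z0 r"
    have S': "open S'" "path_image \<gamma> \<subseteq> S'" "f holomorphic_on S'"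
      using S \<gamma> r by (auto simp: S'_def open_Diff intro: holomorphic_on_subset)
    obtain p where p: "polynomial_function p" "path_image p \<subseteq> S'"
      "\<And>f. f holomorphic_on S' \<Longrightarrow> contour_integral \<gamma> f = contour_integral p f"
      using valid_path_polynomial_approx [OF S'(1) \<gamma>(1) S'(2)] by metis
    have eq: "contour_integral \<gamma> (\<lambda>w. f w / (w - z)) = contour_integral p (\<lambda>w. f w / (w - z))"
      if "z \<in> ball z0 r" for z
      by (rule p(3)) (use that S' in \<open>auto simp: S'_def intro!: holomorphic_intros\<close>)
    have "(\<lambda>z. contour_integral p (\<lambda>w. f w / (w - z))) holomorphic_on ball z0 r"
    proof (rule holomorphic_contour_integral_param)
      show "smooth_path p" using p(1) by (rule smooth_path_polynomial)
      have contf: "continuous_on (path_image p) f"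
        using S'(3) p(2) holomorphic_on_imp_continuous_on continuous_on_subset by blast
      have "continuous_on (ball z0 r \<times> path_image p) (\<lambda>x. f (snd x))"
        by (rule continuous_on_compose2 [OF contf]) (auto intro: continuous_intros)
      then show "continuous_on (ball z0 r \<times> path_image p) (\<lambda>(z, w). f w / (w - z))"
        unfolding split_beta
        by (intro continuous_on_divide continuous_intros) (use p(2) in \<open>auto simp: S'_def\<close>)
      show "(\<lambda>z. f w / (w - z)) holomorphic_on ball z0 r" if "w \<in> path_image p" for w
        using that p(2) by (intro holomorphic_intros) (auto simp: S'_def)
    qed auto
    then have "(\<lambda>z. contour_integral \<gamma> (\<lambda>w. f w / (w - z))) holomorphic_on ball z0 r"
      by (subst holomorphic_cong [OF refl eq])
    then show ?thesis
      using r(1) by (simp add: holomorphic_on_imp_differentiable_at)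
  qed
  then show ?thesis
    by (simp add: holomorphic_on_def field_differentiable_at_within)
qed

text \<open>On a polynomial replacement inside \<open>ball 0 R\<close> the speed is bounded, so the
  uniform limit of the integrand passes to the integral.\<close>

lemma Cauchy_transform_tendsto_0:
  assumes S: "open S" "f holomorphic_on S" and \<gamma>: "valid_path \<gamma>" "path_image \<gamma> \<subseteq> S"
  shows "((\<lambda>z. contour_integral \<gamma> (\<lambda>w. f w / (w - z))) \<longlongrightarrow> 0) at_infinity"
proof -
  have "bounded (path_image \<gamma>)"
    using \<gamma>(1) by (simp add: compact_imp_bounded compact_valid_path_image)
  then obtain R where R: "R > 0" "path_image \<gamma> \<subseteq> ball 0 R"
    using bounded_subset_ballD by blast
  define S' where "S' = S \<inter> ball 0 R"
  have S': "open S'" "path_image \<gamma> \<subseteq> S'" "f holomorphic_on S'"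
    using S \<gamma> R by (auto simp: S'_def intro: holomorphic_on_subset)
  obtain p where p: "polynomial_function p" "path_image p \<subseteq> S'"
    "\<And>f. f holomorphic_on S' \<Longrightarrow> contour_integral \<gamma> f = contour_integral p f"
    using valid_path_polynomial_approx [OF S'(1) \<gamma>(1) S'(2)] by metis
  have sm: "smooth_path p" using p(1) by (rule smooth_path_polynomial)
  obtain B where B: "\<And>t. t \<in> {0..1} \<Longrightarrow> norm (vector_derivative p (at t)) \<le> B"
    using smooth_path_bounded_derivative [OF sm] by blast
  have contf: "continuous_on (path_image p) f"
    using S'(3) p(2) holomorphic_on_imp_continuous_on continuous_on_subset by blast
  have "bounded (f ` path_image p)"
    using contf sm by (intro compact_imp_bounded compact_continuous_image)
      (auto simp: smooth_path_def compact_valid_path_image)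
  then obtain M where M: "\<And>w. w \<in> path_image p \<Longrightarrow> norm (f w) \<le> M" "M > 0"
    by (auto simp: bounded_pos)
  have far: "R \<le> norm z \<Longrightarrow> w \<in> S' \<Longrightarrow> w \<noteq> z" for w z by (auto simp: S'_def)
  have ev: "eventually (\<lambda>z. R \<le> norm z) at_infinity"
    by (auto simp: eventually_at_infinity)
  have "((\<lambda>z. contour_integral p (\<lambda>w. f w / (w - z))) \<longlongrightarrow> contour_integral p (\<lambda>w. 0)) at_infinity"
  proof (rule contour_integral_uniform_limit [OF _ _ B])
    show "\<forall>\<^sub>F z in at_infinity. (\<lambda>w. f w / (w - z)) contour_integrable_on p"
      using ev
    proof eventually_elim
      case (elim z)
      show ?case
        by (intro contour_integrable_smooth_path sm continuous_on_divide contf continuous_intros)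
          (use elim p(2) far in auto)
    qed
    show "uniform_limit (path_image p) (\<lambda>z w. f w / (w - z)) (\<lambda>w. 0) at_infinity"
      unfolding uniform_limit_iff
    proof (intro allI impI)
      fix e :: real assume "e > 0"
      \<comment> \<open>For \<open>norm w < R\<close> this leaves a distance above
        \<open>M / e\<close> between \<open>w\<close> and \<open>z\<close>, where \<open>M\<close>
        bounds \<open>f\<close> on the path.\<close>
      have "\<forall>\<^sub>F z :: complex in at_infinity. R + M / e + 1 \<le> norm z"
        by (auto simp: eventually_at_infinity)
      then show "\<forall>\<^sub>F z in at_infinity. \<forall>w\<in>path_image p. dist (f w / (w - z)) 0 < e"
      proof eventually_elim
        case (elim z)
        show ?case
        proof
          fix w assume w: "w \<in> path_image p"
          then have "norm w < R" using p(2) by (auto simp: S'_def)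
          then have d: "M / e < norm (w - z)"
            using elim norm_triangle_ineq2 [of z w] by (simp add: norm_minus_commute)
          have "0 < M / e" using M(2) \<open>e > 0\<close> by simp
          then have "norm (f w) / norm (w - z) < e"
            using d M(1) [OF w] \<open>e > 0\<close>
            by (smt (verit) divide_less_eq mult.commute)
          then show "dist (f w / (w - z)) 0 < e" by (simp add: norm_divide)
        qed
      qed
    qed
  qed (use sm in \<open>simp_all add: smooth_path_def trivial_limit_at_infinity\<close>)
  moreover have "\<forall>\<^sub>F z in at_infinity. contour_integral p (\<lambda>w. f w / (w - z)) = contour_integral \<gamma> (\<lambda>w. f w / (w - z))"
    using ev
  proof eventually_elim
    case (elim z)
    show ?case
      by (rule p(3) [symmetric]) (use elim far S'(3) in \<open>auto intro!: holomorphic_intros\<close>)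
  qed
  ultimately show ?thesis by (simp add: Lim_transform_eventually)
qed

section \<open>Dixon's kernel and the cycle version of Cauchy's formula\<close>

definition difference_quotient :: "(complex \<Rightarrow> complex) \<Rightarrow> complex \<Rightarrow> complex \<Rightarrow> complex" where
  "difference_quotient f z w = (if w = z then deriv f z else (f w - f z) / (w - z))"

lemma difference_quotient_commute: "difference_quotient f z w = difference_quotient f w z"
  by (simp add: difference_quotient_def divide_simps) (simp add: algebra_simps)

lemma difference_quotient_holomorphic:
  assumes "f holomorphic_on S" "open S"
  shows "difference_quotient f z holomorphic_on S" "(\<lambda>z. difference_quotient f z w) holomorphic_on S"
proof -
  show *: "difference_quotient f z holomorphic_on S" for z
    using pole_lemma_open [OF assms, of z] by (simp add: difference_quotient_def [abs_def])
  show "(\<lambda>z. difference_quotient f z w) holomorphic_on S"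
    using * [of w] by (subst difference_quotient_commute)
qed

lemma segment_point_in_ball:
  fixes z w :: complex
  assumes "z \<in> ball a r" "w \<in> ball a r" "t \<in> {0..1}"
  shows "z + of_real t * (w - z) \<in> ball a r"
proof -
  have "(1 - t) *\<^sub>R z + t *\<^sub>R w \<in> ball a r"
    using assms by (intro convexD [OF convex_ball]) auto
  then show ?thesis by (simp add: scaleR_conv_of_real algebra_simps)
qed

text \<open>Near the diagonal the quotient is the mean of \<open>deriv f\<close> over the segment
  from \<open>z\<close> to \<open>w\<close>, and this depends jointly continuously on the two
  endpoints; away from the diagonal the quotient is an ordinary one.\<close>

lemma continuous_on_difference_quotient:
  assumes f: "f holomorphic_on S" and "open S"
  shows "continuous_on (S \<times> S) (\<lambda>(z, w). difference_quotient f z w)"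
proof -
  have f': "deriv f holomorphic_on S" using f \<open>open S\<close> by (rule holomorphic_deriv)
  have "isCont (\<lambda>(z, w). difference_quotient f z w) (x, y)" if "x \<in> S" "y \<in> S" for x y
  proof (cases "x = y")
    case False
    have op: "open {p \<in> S \<times> S. fst p \<noteq> snd p}"
    proof -
      have "{p \<in> S \<times> S. fst p \<noteq> snd p} = (S \<times> S) \<inter> - {p. fst p = snd p}" by auto
      then show ?thesis
        by (simp only:) (intro open_Int open_Times \<open>open S\<close> open_Compl closed_Collect_eq continuous_intros)
    qed
    have cf: "continuous_on S f" using f by (rule holomorphic_on_imp_continuous_on)
    have "continuous_on {p \<in> S \<times> S. fst p \<noteq> snd p} (\<lambda>p. (f (snd p) - f (fst p)) / (snd p - fst p))"
      by (intro continuous_on_divide continuous_on_diff continuous_on_compose2 [OF cf] continuous_intros) auto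
    then have "continuous_on {p \<in> S \<times> S. fst p \<noteq> snd p} (\<lambda>(z, w). difference_quotient f z w)"
      by (rule continuous_on_eq) (auto simp: difference_quotient_def)
    then show ?thesis
      using op False that by (simp add: continuous_on_eq_continuous_at)
  next
    case True
    obtain r where r: "r > 0" "ball x r \<subseteq> S" by (rule openE [OF \<open>open S\<close> \<open>x \<in> S\<close>])
    let ?B = "ball x r"
    have eq: "integral (cbox 0 1) (\<lambda>s. deriv f (z + of_real s * (w - z))) = difference_quotient f z w"
      if "z \<in> ?B" "w \<in> ?B" for z w
    proof (cases "w = z")
      case True
      then show ?thesis by (simp add: difference_quotient_def)
    next
      case False
      have "((\<lambda>s. deriv f (z + of_real s * (w - z)) * (w - z)) has_integral f (z + of_real 1 * (w - z)) - f (z + of_real 0 * (w - z))) {0..1}"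
      proof (rule fundamental_theorem_of_calculus)
        fix s :: real assume s: "s \<in> {0..1}"
        have "(f has_field_derivative deriv f (z + of_real s * (w - z))) (at (z + of_real s * (w - z)))"
          by (rule holomorphic_derivI [OF f \<open>open S\<close>]) (use segment_point_in_ball [OF that s] r in auto)
        moreover have "((\<lambda>s. z + of_real s * (w - z)) has_vector_derivative (w - z)) (at s within {0..1})"
          by (auto intro!: derivative_eq_intros simp: has_vector_derivative_def scaleR_conv_of_real)
        ultimately show "((\<lambda>s. f (z + of_real s * (w - z))) has_vector_derivative
            deriv f (z + of_real s * (w - z)) * (w - z)) (at s within {0..1})"
          using field_vector_diff_chain_within [of "\<lambda>s. z + of_real s * (w - z)" _ _ _ f]
          by (simp add: o_def mult.commute has_field_derivative_at_within)
      qed simp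
      from has_integral_mult_left [OF this, of "inverse (w - z)"] False
      have "((\<lambda>s. deriv f (z + of_real s * (w - z))) has_integral (f w - f z) * inverse (w - z)) {0..1}"
        by (simp add: mult.assoc)
      then show ?thesis
        using False by (simp add: difference_quotient_def integral_unique divide_inverse)
    qed
    have "continuous_on ((?B \<times> ?B) \<times> cbox 0 1) (\<lambda>(p, s). deriv f (fst p + of_real s * (snd p - fst p)))"
      unfolding split_beta
      by (intro continuous_on_compose2 [OF holomorphic_on_imp_continuous_on [OF f']] continuous_intros)
        (use segment_point_in_ball r in auto)
    then have "continuous_on (?B \<times> ?B) (\<lambda>p. integral (cbox 0 1) (\<lambda>s. deriv f (fst p + of_real s * (snd p - fst p))))"
      by (rule integral_continuous_on_param)
    then have "continuous_on (?B \<times> ?B) (\<lambda>(z, w). difference_quotient f z w)"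
      by (rule continuous_on_eq) (use eq in auto)
    then show ?thesis
      using r True by (simp add: continuous_on_eq_continuous_at open_Times)
  qed
  then show ?thesis
    using \<open>open S\<close> by (auto simp: continuous_on_eq_continuous_at open_Times)
qed

lemma difference_quotient_integral_holomorphic:
  assumes S: "open S" "f holomorphic_on S" and \<gamma>: "valid_path \<gamma>" "path_image \<gamma> \<subseteq> S"
  shows "(\<lambda>z. contour_integral \<gamma> (difference_quotient f z)) holomorphic_on S"
proof -
  obtain p where p: "polynomial_function p" "path_image p \<subseteq> S"
    "\<And>f. f holomorphic_on S \<Longrightarrow> contour_integral \<gamma> f = contour_integral p f"
    using valid_path_polynomial_approx [OF S(1) \<gamma>] by metis
  have "(\<lambda>z. contour_integral p (difference_quotient f z)) holomorphic_on S"
    using p(1,2) S difference_quotient_holomorphic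
    by (intro holomorphic_contour_integral_param smooth_path_polynomial
        continuous_on_subset [OF continuous_on_difference_quotient]) auto
  then show ?thesis
    using p(3) S difference_quotient_holomorphic by simp
qed

lemma contour_integral_difference_quotient:
  assumes S: "open S" "f holomorphic_on S" and \<gamma>: "valid_path \<gamma>" "path_image \<gamma> \<subseteq> S"
    and z: "z \<notin> path_image \<gamma>"
  shows "contour_integral \<gamma> (difference_quotient f z)
    = contour_integral \<gamma> (\<lambda>w. f w / (w - z)) - 2 * pi * \<i> * winding_number \<gamma> z * f z"
proof -
  have o: "open (S - {z})" "path_image \<gamma> \<subseteq> S - {z}" using S \<gamma> z by auto
  have i1: "(\<lambda>w. f w / (w - z)) contour_integrable_on \<gamma>" 
    by (rule contour_integrable_holomorphic_simple [OF _ o(1) \<gamma>(1) o(2)])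
      (auto intro!: holomorphic_intros holomorphic_on_subset [OF S(2)])
  have i2: "(\<lambda>w. f z * (1 / (w - z))) contour_integrable_on \<gamma>" 
    by (rule contour_integrable_holomorphic_simple [OF _ o(1) \<gamma>(1) o(2)])
      (auto intro!: holomorphic_intros)
  have "contour_integral \<gamma> (difference_quotient f z) = contour_integral \<gamma> (\<lambda>w. f w / (w - z) - f z * (1 / (w - z)))"
    using z by (intro contour_integral_cong) (auto simp: difference_quotient_def diff_divide_distrib)
  also have "\<dots> = contour_integral \<gamma> (\<lambda>w. f w / (w - z)) - contour_integral \<gamma> (\<lambda>w. f z * (1 / (w - z)))"
    by (rule contour_integral_diff [OF i1 i2])
  also have "((\<lambda>w. f z * (1 / (w - z))) has_contour_integral f z * (2 * pi * \<i> * winding_number \<gamma> z)) \<gamma>"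
    using has_contour_integral_lmul [OF has_contour_integral_winding_number [OF \<gamma>(1) z]] .
  then have "contour_integral \<gamma> (\<lambda>w. f z * (1 / (w - z))) = 2 * pi * \<i> * winding_number \<gamma> z * f z"
    by (simp add: contour_integral_unique mult_ac)
  finally show ?thesis .
qed

text \<open>Winding numbers of closed paths are constant on discs that avoid the paths.\<close>

lemma open_winding_number_sum_level:
  fixes c :: "'i \<Rightarrow> complex"
  assumes "finite I" and \<gamma>: "\<And>i. i \<in> I \<Longrightarrow> path (\<gamma> i) \<and> pathfinish (\<gamma> i) = pathstart (\<gamma> i)"
  shows "open {z \<in> - (\<Union>i\<in>I. path_image (\<gamma> i)). (\<Sum>i\<in>I. c i * winding_number (\<gamma> i) z) = k}"
    (is "open ?V")
proof -
  define P where "P = (\<Union>i\<in>I. path_image (\<gamma> i))"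
  have "closed P"
    unfolding P_def using \<gamma> \<open>finite I\<close> by (intro closed_UN) (auto simp: closed_path_image)
  have "\<exists>e>0. ball z e \<subseteq> ?V" if "z \<in> ?V" for z
  proof -
    have "z \<in> - P" using that by (simp add: P_def)
    moreover have "open (- P)" using \<open>closed P\<close> by (rule open_Compl)
    ultimately obtain e where e: "e > 0" "ball z e \<subseteq> - P" by (auto elim: openE)
    have eq: "winding_number (\<gamma> i) y = winding_number (\<gamma> i) z" if "i \<in> I" "y \<in> ball z e" for i y
    proof (rule winding_number_eq)
      show "connected (ball z e)" by (rule connected_ball)
      show "ball z e \<inter> path_image (\<gamma> i) = {}" using e \<open>i \<in> I\<close> by (auto simp: P_def)
    qed (use \<gamma> that e in auto)
    have "y \<in> ?V" if "y \<in> ball z e" for y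
    proof -
      have "(\<Sum>i\<in>I. c i * winding_number (\<gamma> i) y) = (\<Sum>i\<in>I. c i * winding_number (\<gamma> i) z)"
        using that eq by (intro sum.cong) simp_all
      then show ?thesis using subsetD [OF e(2) that] \<open>z \<in> ?V\<close> by (simp add: P_def)
    qed
    with e(1) show ?thesis by (intro exI [of _ e] conjI subsetI) simp_all
  qed
  then show ?thesis by (simp only: open_contains_ball) blast
qed

text \<open>The integral \<open>K\<close> of the difference quotient extends to an entire function
  that vanishes at infinity, so it is zero, which is the formula. The weights \<open>c\<close> allow
  a multiple of one cycle to be subtracted from another.\<close>

theorem Cauchy_integral_formula_cycle:
  fixes c :: "'i \<Rightarrow> complex"
  assumes "finite I" and S: "open S" "f holomorphic_on S"
    and \<gamma>: "\<And>i. i \<in> I \<Longrightarrow> valid_path (\<gamma> i) \<and> pathfinish (\<gamma> i) = pathstart (\<gamma> i) \<and> path_image (\<gamma> i) \<subseteq> S"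
    and zero: "\<And>w. w \<notin> S \<Longrightarrow> (\<Sum>i\<in>I. c i * winding_number (\<gamma> i) w) = 0"
    and z: "z \<in> S" "\<And>i. i \<in> I \<Longrightarrow> z \<notin> path_image (\<gamma> i)"
  shows "(\<Sum>i\<in>I. c i * contour_integral (\<gamma> i) (\<lambda>w. f w / (w - z)))
    = 2 * pi * \<i> * f z * (\<Sum>i\<in>I. c i * winding_number (\<gamma> i) z)"
proof -
  define K where "K z = (\<Sum>i\<in>I. c i * contour_integral (\<gamma> i) (difference_quotient f z))" for z
  define C where "C z = (\<Sum>i\<in>I. c i * contour_integral (\<gamma> i) (\<lambda>w. f w / (w - z)))" for z
  define W where "W z = (\<Sum>i\<in>I. c i * winding_number (\<gamma> i) z)" for z
  define P where "P = (\<Union>i\<in>I. path_image (\<gamma> i))"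
  have "closed P" 
    unfolding P_def using \<gamma> \<open>finite I\<close> by (intro closed_UN) (auto simp: closed_valid_path_image)
  have KC: "K z = C z - 2 * pi * \<i> * f z * W z" if "z \<in> - P" for z
  proof -
    have "K z = (\<Sum>i\<in>I. c i * (contour_integral (\<gamma> i) (\<lambda>w. f w / (w - z)) - 2 * pi * \<i> * winding_number (\<gamma> i) z * f z))"
      unfolding K_def using that S \<gamma>
      by (intro sum.cong refl) (auto simp: contour_integral_difference_quotient P_def)
    then show ?thesis
      by (simp add: C_def W_def sum_subtractf sum_distrib_left algebra_simps)
  qed
  have Kh: "K holomorphic_on S"
    unfolding K_def using S \<gamma> by (intro holomorphic_intros difference_quotient_integral_holomorphic) auto
  have Ch: "C holomorphic_on - P"
    unfolding C_def
  proof (intro holomorphic_intros)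
    fix i assume "i \<in> I"
    then show "(\<lambda>z. contour_integral (\<gamma> i) (\<lambda>w. f w / (w - z))) holomorphic_on - P"
      using S \<gamma> by (intro holomorphic_on_subset [OF Cauchy_transform_holomorphic]) (auto simp: P_def)
  qed
  define V where "V = {z \<in> - P. W z = 0}"
  have "open V"
    unfolding V_def P_def W_def using open_winding_number_sum_level [OF \<open>finite I\<close>, of \<gamma> c 0] \<gamma>
    by (simp add: valid_path_imp_path)
  \<comment> \<open>The branches agree on \<open>S \<inter> V\<close>, where the winding term in
    \<open>KC\<close> is zero. As the paths lie in \<open>S\<close>, \<open>zero\<close> puts the
    complement of \<open>S\<close> into \<open>V\<close>, so \<open>H\<close> is entire.\<close>
  define H where "H z = (if z \<in> S then K z else C z)" for z
  have "H holomorphic_on S \<union> V"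
    unfolding H_def
  proof (rule holomorphic_on_If_Un [OF Kh _ S(1) \<open>open V\<close>])
    show "C holomorphic_on V" using Ch by (rule holomorphic_on_subset) (auto simp: V_def)
  qed (use KC in \<open>auto simp: V_def\<close>)
  moreover have "S \<union> V = UNIV"
    using \<gamma> zero by (auto simp: V_def P_def W_def)
  ultimately have Hh: "H holomorphic_on UNIV" by simp
  have "bounded P"
    unfolding P_def using \<gamma> \<open>finite I\<close> by (intro bounded_UN) (auto simp: compact_imp_bounded compact_valid_path_image)
  then obtain R where "\<forall>y\<in>P. dist 0 y \<le> R" unfolding bounded_any_center [where a = 0] ..
  then have R: "P \<subseteq> cball 0 R" by auto
  \<comment> \<open>Outside a disc containing the paths all winding numbers vanish, so
    \<open>H\<close> is the Cauchy transform there even at points of \<open>S\<close>.\<close>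
  have HC: "H z = C z" if "norm z > R" for z
  proof -
    have "winding_number (\<gamma> i) z = 0" if "i \<in> I" for i
      by (rule winding_number_zero_outside [of _ "cball 0 R"])
        (use that \<gamma> R \<open>norm z > R\<close> in \<open>auto simp: P_def valid_path_imp_path\<close>)
    then have "W z = 0" by (simp add: W_def)
    moreover have "z \<notin> P" using R that by auto
    ultimately show ?thesis by (simp add: H_def KC)
  qed
  have "(C \<longlongrightarrow> (\<Sum>i\<in>I. c i * 0)) at_infinity"
    unfolding C_def using S \<gamma>
    by (intro tendsto_sum tendsto_mult tendsto_const Cauchy_transform_tendsto_0) auto
  moreover have "\<forall>\<^sub>F z in at_infinity. C z = H z"
    unfolding eventually_at_infinity by (intro exI [of _ "R + 1"]) (use HC in auto)
  ultimately have "(H \<longlongrightarrow> 0) at_infinity" by (simp add: Lim_transform_eventually)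
  then have "H z = 0" by (rule Liouville_weak_0 [OF Hh])
  then show ?thesis
    using z KC [of z] by (simp add: H_def C_def W_def P_def)
qed

text \<open>The integral formula is applied to \<open>f w * (w - z)\<close> at a point
  \<open>z\<close> of \<open>S\<close> off the paths: the pole cancels, and the value at
  \<open>z\<close> is zero.\<close>

corollary Cauchy_theorem_cycle:
  fixes c :: "'i \<Rightarrow> complex"
  assumes "finite I" and S: "open S" "f holomorphic_on S"
    and \<gamma>: "\<And>i. i \<in> I \<Longrightarrow> valid_path (\<gamma> i) \<and> pathfinish (\<gamma> i) = pathstart (\<gamma> i) \<and> path_image (\<gamma> i) \<subseteq> S"
    and zero: "\<And>w. w \<notin> S \<Longrightarrow> (\<Sum>i\<in>I. c i * winding_number (\<gamma> i) w) = 0"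
  shows "(\<Sum>i\<in>I. c i * contour_integral (\<gamma> i) f) = 0"
proof (cases "S = {}")
  case True
  then have "I = {}" using \<gamma> path_image_nonempty by blast
  then show ?thesis by simp
next
  case False
  let ?P = "\<Union>i\<in>I. path_image (\<gamma> i)"
  have "compact ?P" using \<gamma> \<open>finite I\<close> by (intro compact_UN) (auto simp: compact_valid_path_image)
  \<comment> \<open>A nonempty open subset of the plane is not compact, so the paths cannot fill
    \<open>S\<close>.\<close>
  then have "?P \<noteq> S" using compact_open [of S] S(1) False by auto
  moreover have "?P \<subseteq> S" using \<gamma> by (simp add: UN_subset_iff)
  ultimately obtain z where z: "z \<in> S" "z \<notin> ?P" by (meson psubset_imp_ex_mem psubsetI DiffD1 DiffD2)
  have "(\<Sum>i\<in>I. c i * contour_integral (\<gamma> i) (\<lambda>w. f w * (w - z) / (w - z))) = 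
      2 * pi * \<i> * (f z * (z - z)) * (\<Sum>i\<in>I. c i * winding_number (\<gamma> i) z)"
    by (rule Cauchy_integral_formula_cycle [OF \<open>finite I\<close> S(1) _ \<gamma> zero])
      (use S z in \<open>auto intro!: holomorphic_intros\<close>)
  moreover have "contour_integral (\<gamma> i) (\<lambda>w. f w * (w - z) / (w - z)) = contour_integral (\<gamma> i) f" if "i \<in> I" for i
    by (rule contour_integral_cong) (use that z in auto)
  ultimately show ?thesis by simp
qed

section \<open>Operators on quaternionic modules\<close>

type_synonym 'a qop = "'a qmod \<Rightarrow>\<^sub>L 'a qmod"

lemma compose_simps:
  "(a o\<^sub>L b) o\<^sub>L c = a o\<^sub>L (b o\<^sub>L c)"
  "(a + b) o\<^sub>L c = (a o\<^sub>L c) + (b o\<^sub>L c)" "a o\<^sub>L (b + c) = (a o\<^sub>L b) + (a o\<^sub>L c)"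
  "(a - b) o\<^sub>L c = (a o\<^sub>L c) - (b o\<^sub>L c)" "a o\<^sub>L (b - c) = (a o\<^sub>L b) - (a o\<^sub>L c)"
  "(- a) o\<^sub>L c = - (a o\<^sub>L c)" "a o\<^sub>L (- c) = - (a o\<^sub>L c)"
  "(r *\<^sub>R a) o\<^sub>L c = r *\<^sub>R (a o\<^sub>L c)" "a o\<^sub>L (r *\<^sub>R c) = r *\<^sub>R (a o\<^sub>L c)"
  "id_blinfun o\<^sub>L a = a" "a o\<^sub>L id_blinfun = a"
  by (rule blinfun_eqI; simp add: blinfun.bilinear_simps)+

lemma bounded_linear_compose_op: "bounded_linear (\<lambda>X. X o\<^sub>L c)" "bounded_linear ((o\<^sub>L) c)"
  by (rule bounded_bilinear.bounded_linear_left bounded_bilinear.bounded_linear_right,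
      rule bounded_bilinear_blinfun_compose)+

lemma compose_sum:
  "sum f I o\<^sub>L c = (\<Sum>i\<in>I. f i o\<^sub>L c)" "c o\<^sub>L sum f I = (\<Sum>i\<in>I. c o\<^sub>L f i)"
  by (simp_all add: bounded_bilinear.sum_left [OF bounded_bilinear_blinfun_compose]
      bounded_bilinear.sum_right [OF bounded_bilinear_blinfun_compose])

section \<open>Left multiplication by quaternions\<close>

lemma lmul_mult: "lmul (p * q) = lmul p o\<^sub>L lmul q"
  by (rule blinfun_eqI) (simp add: lmul.rep_eq lscale_assoc)

lemma lmul_1: "lmul 1 = id_blinfun"
  by (rule blinfun_eqI) (simp add: lmul.rep_eq lscale_sel one_quat_def)

lemma lmul_add: "lmul (p + q) = lmul p + lmul q"
  by (rule blinfun_eqI) (simp add: lmul.rep_eq lscale_sel plus_quat_def blinfun.bilinear_simps algebra_simps)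

lemma lmul_scaleR: "lmul (r *\<^sub>R p) = r *\<^sub>R lmul p"
  by (rule blinfun_eqI)
    (simp add: lmul.rep_eq lscale_sel scaleR_quat_def blinfun.bilinear_simps scaleR_diff_right scaleR_add_right)

lemma lmul_minus: "lmul (- p) = - lmul p"
  using lmul_scaleR [of "-1" p] by simp

lemma lmul_diff: "lmul (p - q) = lmul p - lmul q"
  using lmul_add [of p "- q"] by (simp add: lmul_minus)

lemma lmul_of_real: "lmul (of_real r) = r *\<^sub>R id_blinfun"
  by (simp add: of_real_def lmul_scaleR lmul_1)

lemma quat_expansion: "p = QRe p *\<^sub>R 1 + QI1 p *\<^sub>R qe1 + QI2 p *\<^sub>R qe2 + QI3 p *\<^sub>R qe3"
  by (simp add: quat_eq_iff plus_quat_def scaleR_quat_def one_quat_def qe1_def qe2_def qe3_def)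

lemma lmul_expansion:
  "lmul p = QRe p *\<^sub>R id_blinfun + QI1 p *\<^sub>R lmul qe1 + QI2 p *\<^sub>R lmul qe2 + QI3 p *\<^sub>R lmul qe3"
  by (subst quat_expansion [of p]) (simp only: lmul_add lmul_scaleR lmul_1)

lemma norm_quat_component_le:
  "\<bar>QRe p\<bar> \<le> norm p" "\<bar>QI1 p\<bar> \<le> norm p" "\<bar>QI2 p\<bar> \<le> norm p" "\<bar>QI3 p\<bar> \<le> norm p"
  by (auto simp: norm_quat_def intro!: real_le_rsqrt)

lemma bounded_linear_quat_components:
  "bounded_linear QRe" "bounded_linear QI1" "bounded_linear QI2" "bounded_linear QI3"
  by (rule bounded_linear_intro [where K = 1];
      simp add: plus_quat_def scaleR_quat_def norm_quat_component_le)+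

lemma bounded_linear_lmul: "bounded_linear lmul"
proof -
  have sc: "bounded_linear (\<lambda>p. f p *\<^sub>R c)" if "bounded_linear f"
    for f :: "quat \<Rightarrow> real" and c :: "'a qop"
    using bounded_linear_compose [OF bounded_linear_scaleR_left that] .
  have "bounded_linear (\<lambda>p. QRe p *\<^sub>R id_blinfun + QI1 p *\<^sub>R lmul qe1 + QI2 p *\<^sub>R lmul qe2
      + QI3 p *\<^sub>R lmul qe3 :: 'a qop)"
    by (rule bounded_linear_add sc bounded_linear_quat_components)+
  then show ?thesis by (simp flip: lmul_expansion)
qed

section \<open>Componentwise operators and the quaternionic composition rule\<close>

lemma ext_op_simps:
  "ext_op (A + B) = ext_op A + ext_op B" "ext_op (A - B) = ext_op A - ext_op B"
  "ext_op (r *\<^sub>R A) = r *\<^sub>R ext_op A" "ext_op (A o\<^sub>L B) = ext_op A o\<^sub>L ext_op B"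
  "ext_op id_blinfun = id_blinfun"
  by (rule blinfun_eqI; simp add: ext_op.rep_eq blinfun.bilinear_simps)+

lemma ext_op_lmul_commute: "ext_op A o\<^sub>L lmul p = lmul p o\<^sub>L ext_op A"
  by (rule blinfun_eqI) (simp add: ext_op.rep_eq lmul.rep_eq lscale_sel blinfun.bilinear_simps)

lemma quat_op_apply:
  "quat_op t0 t1 t2 t3 (x0, x1, x2, x3) =
    (t0 x0 - t1 x1 - t2 x2 - t3 x3, t0 x1 + t1 x0 + t2 x3 - t3 x2,
     t0 x2 - t1 x3 + t2 x0 + t3 x1, t0 x3 + t1 x2 - t2 x1 + t3 x0)"
  by (simp add: quat_op_def ext_op.rep_eq lmul.rep_eq qe1_def qe2_def qe3_def blinfun.bilinear_simps)

lemma quat_op_eqI: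
  fixes A B :: "'a::real_normed_vector qop"
  assumes "\<And>x0 x1 x2 x3. A (x0, x1, x2, x3) = B (x0, x1, x2, x3)"
  shows "A = B"
proof (rule blinfun_eqI)
  fix x
  show "A x = B x" by (cases x rule: prod_cases4) (simp add: assms)
qed

lemma ext_op_eq_quat_op: "ext_op A = quat_op A 0 0 0"
  by (rule quat_op_eqI) (simp add: quat_op_apply ext_op.rep_eq)

lemma quat_op_compose:
  "quat_op a0 a1 a2 a3 o\<^sub>L quat_op b0 b1 b2 b3 =
    quat_op ((a0 o\<^sub>L b0) - (a1 o\<^sub>L b1) - (a2 o\<^sub>L b2) - (a3 o\<^sub>L b3))
      ((a0 o\<^sub>L b1) + (a1 o\<^sub>L b0) + (a2 o\<^sub>L b3) - (a3 o\<^sub>L b2))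
      ((a0 o\<^sub>L b2) - (a1 o\<^sub>L b3) + (a2 o\<^sub>L b0) + (a3 o\<^sub>L b1))
      ((a0 o\<^sub>L b3) + (a1 o\<^sub>L b2) - (a2 o\<^sub>L b1) + (a3 o\<^sub>L b0))"
  by (rule quat_op_eqI) (simp add: quat_op_apply blinfun.bilinear_simps)

lemma quat_op_add:
  "quat_op a0 a1 a2 a3 + quat_op b0 b1 b2 b3 = quat_op (a0 + b0) (a1 + b1) (a2 + b2) (a3 + b3)"
  by (rule quat_op_eqI) (simp add: quat_op_apply blinfun.bilinear_simps)

lemma quat_op_inject:
  "quat_op a0 a1 a2 a3 = quat_op b0 b1 b2 b3 \<longleftrightarrow> a0 = b0 \<and> a1 = b1 \<and> a2 = b2 \<and> a3 = b3"
  by (metis op_part_quat_op)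

section \<open>Right linear operators\<close>

lemma right_linear_opsD: "B \<in> right_linear_ops \<Longrightarrow> blinfun_apply B (rscale x a) = rscale (blinfun_apply B x) a"
  unfolding right_linear_ops_def by blast

lemma right_linear_opsI:
  "(\<And>x a. blinfun_apply B (rscale x a) = rscale (blinfun_apply B x) a) \<Longrightarrow> B \<in> right_linear_ops"
  unfolding right_linear_ops_def by blast

text \<open>Right multiplication by the units moves \<open>(x, 0, 0, 0)\<close> into the other
  coordinates, so a right linear operator is determined by its values on such vectors. Inverses
  therefore have four components as well, which permits componentwise arguments about them.\<close>

lemma right_linear_ops_eq_quat_op:
  assumes "B \<in> right_linear_ops"
  shows "B = quat_op (op_part0 B) (op_part1 B) (op_part2 B) (op_part3 B)"
proof (rule quat_op_eqI)
  fix x0 x1 x2 x3 :: 'a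
  have rl: "B (rscale x a) = rscale (B x) a" for x a
    using assms by (rule right_linear_opsD)
  have emb: "rscale (x, 0, 0, 0) qe1 = (0, x, 0, 0)" "rscale (x, 0, 0, 0) qe2 = (0, 0, x, 0)"
    "rscale (x, 0, 0, 0) qe3 = (0, 0, 0, x)" for x :: 'a
    by (simp_all add: qe1_def qe2_def qe3_def)
  have col: "B (x, 0, 0, 0) = (op_part0 B x, op_part1 B x, op_part2 B x, op_part3 B x)" for x
    by (simp add: op_part0.rep_eq op_part1.rep_eq op_part2.rep_eq op_part3.rep_eq)
  have "(x0, x1, x2, x3) = (x0, 0, 0, 0) + rscale (x1, 0, 0, 0) qe1 + rscale (x2, 0, 0, 0) qe2
      + rscale (x3, 0, 0, 0) qe3"
    unfolding emb by simp
  then have "B (x0, x1, x2, x3) = B (x0, 0, 0, 0) + rscale (B (x1, 0, 0, 0)) qe1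
      + rscale (B (x2, 0, 0, 0)) qe2 + rscale (B (x3, 0, 0, 0)) qe3"
    by (simp only: blinfun.add_right rl)
  then show "B (x0, x1, x2, x3)
      = quat_op (op_part0 B) (op_part1 B) (op_part2 B) (op_part3 B) (x0, x1, x2, x3)"
    unfolding col quat_op_apply by (simp add: qe1_def qe2_def qe3_def)
qed

lemma quat_op_right_linear: "quat_op t0 t1 t2 t3 \<in> right_linear_ops"
proof (rule right_linear_opsI)
  fix x :: "'a qmod" and a
  show "quat_op t0 t1 t2 t3 (rscale x a) = rscale (quat_op t0 t1 t2 t3 x) a"
    by (cases x; cases a)
      (simp add: quat_op_apply blinfun.bilinear_simps algebra_simps)
qed

lemma rscale_add: "rscale (x + y) a = rscale x a + rscale y a"
  by (cases x; cases y; cases a) (simp add: algebra_simps)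

lemma rscale_scaleR: "rscale (r *\<^sub>R x) a = r *\<^sub>R rscale x a"
  by (cases x; cases a) (simp add: algebra_simps)

lemma right_linear_ops_closed:
  "A \<in> right_linear_ops \<Longrightarrow> B \<in> right_linear_ops \<Longrightarrow> A + B \<in> right_linear_ops"
  "A \<in> right_linear_ops \<Longrightarrow> r *\<^sub>R A \<in> right_linear_ops"
  "A \<in> right_linear_ops \<Longrightarrow> B \<in> right_linear_ops \<Longrightarrow> A - B \<in> right_linear_ops"
  "A \<in> right_linear_ops \<Longrightarrow> B \<in> right_linear_ops \<Longrightarrow> A o\<^sub>L B \<in> right_linear_ops"
  "id_blinfun \<in> right_linear_ops" "lmul p \<in> right_linear_ops" "ext_op R \<in> right_linear_ops"
proof -
  show add: "A + B \<in> right_linear_ops" if "A \<in> right_linear_ops" "B \<in> right_linear_ops" for A B :: "'a qop"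
    by (rule right_linear_opsI) (simp add: that blinfun.add_left rscale_add right_linear_opsD)
  show scale: "r *\<^sub>R A \<in> right_linear_ops" if "A \<in> right_linear_ops" for r and A :: "'a qop"
    by (rule right_linear_opsI) (simp add: that blinfun.scaleR_left rscale_scaleR right_linear_opsD)
  show "A - B \<in> right_linear_ops" if "A \<in> right_linear_ops" "B \<in> right_linear_ops"
    using add [OF that(1) scale [OF that(2), of "-1"]] by simp
  show "A o\<^sub>L B \<in> right_linear_ops" if "A \<in> right_linear_ops" "B \<in> right_linear_ops"
    by (rule right_linear_opsI) (simp add: that right_linear_opsD)
  show "id_blinfun \<in> right_linear_ops" "lmul p \<in> right_linear_ops"
    by (rule right_linear_opsI, simp add: lmul.rep_eq lscale_rscale)+
  show "ext_op R \<in> right_linear_ops"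
    by (simp add: ext_op_eq_quat_op quat_op_right_linear)
qed

section \<open>Inverses\<close>

lemma blinfun_inverse_right_linear:
  assumes A: "A \<in> right_linear_ops" and "A o\<^sub>L B = id_blinfun" "B o\<^sub>L A = id_blinfun"
  shows "B \<in> right_linear_ops"
proof (rule right_linear_opsI)
  fix x :: "'a qmod" and a
  have AB: "A (B y) = y" and BA: "B (A y) = y" for y
    using assms(2,3) by (metis blinfun_apply_blinfun_compose id_blinfun.rep_eq)+
  have "B (rscale x a) = B (rscale (A (B x)) a)" by (simp add: AB)
  also have "\<dots> = B (A (rscale (B x) a))" by (simp only: right_linear_opsD [OF A])
  finally show "B (rscale x a) = rscale (B x) a" by (simp add: BA)
qed

lemma blinfun_inverse_unique:
  fixes A :: "'b::real_normed_vector \<Rightarrow>\<^sub>L 'b"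
  assumes "A o\<^sub>L B = id_blinfun" "B' o\<^sub>L A = id_blinfun"
  shows "B = B'"
  by (metis assms compose_simps(1,10,11))

lemma op_inv_inverse:
  assumes "op_invertible A"
  shows "A o\<^sub>L op_inv A = id_blinfun" "op_inv A o\<^sub>L A = id_blinfun" "op_inv A \<in> right_linear_ops"
proof -
  obtain B where B: "B \<in> right_linear_ops \<and> A o\<^sub>L B = id_blinfun \<and> B o\<^sub>L A = id_blinfun"
    using assms by (auto simp: op_invertible_def)
  then have "\<exists>!B. B \<in> right_linear_ops \<and> A o\<^sub>L B = id_blinfun \<and> B o\<^sub>L A = id_blinfun"
    using blinfun_inverse_unique by metis
  from theI' [OF this]
  have "op_inv A \<in> right_linear_ops \<and> A o\<^sub>L op_inv A = id_blinfun \<and> op_inv A o\<^sub>L A = id_blinfun"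
    unfolding op_inv_def .
  then show "A o\<^sub>L op_inv A = id_blinfun" "op_inv A o\<^sub>L A = id_blinfun" "op_inv A \<in> right_linear_ops"
    by simp_all
qed

text \<open>Right linearity of the inverse is automatic, so a two-sided inverse among all bounded
  real linear operators suffices.\<close>

lemma op_invertibleI:
  assumes "A \<in> right_linear_ops" "A o\<^sub>L B = id_blinfun" "B o\<^sub>L A = id_blinfun"
  shows "op_invertible A"
  using assms blinfun_inverse_right_linear unfolding op_invertible_def by metis

lemma op_inv_commute:
  assumes "op_invertible A" "A o\<^sub>L C = C o\<^sub>L A"
  shows "op_inv A o\<^sub>L C = C o\<^sub>L op_inv A"
proof -
  have "op_inv A o\<^sub>L C = op_inv A o\<^sub>L (C o\<^sub>L A) o\<^sub>L op_inv A"
    by (simp add: compose_simps op_inv_inverse [OF assms(1)])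
  also have "\<dots> = (op_inv A o\<^sub>L A) o\<^sub>L (C o\<^sub>L op_inv A)"
    by (simp add: compose_simps flip: assms(2))
  finally show ?thesis by (simp add: op_inv_inverse [OF assms(1)] compose_simps)
qed

lemma op_invertible_compose:
  assumes "A \<in> right_linear_ops" "B \<in> right_linear_ops" "op_invertible A" "op_invertible B"
  shows "op_invertible (A o\<^sub>L B)"
proof (rule op_invertibleI)
  have "(A o\<^sub>L B) o\<^sub>L (op_inv B o\<^sub>L op_inv A) = A o\<^sub>L (B o\<^sub>L op_inv B) o\<^sub>L op_inv A"
    by (simp add: compose_simps)
  then show "(A o\<^sub>L B) o\<^sub>L (op_inv B o\<^sub>L op_inv A) = id_blinfun"
    by (simp add: op_inv_inverse assms compose_simps)
  have "(op_inv B o\<^sub>L op_inv A) o\<^sub>L (A o\<^sub>L B) = op_inv B o\<^sub>L (op_inv A o\<^sub>L A) o\<^sub>L B"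
    by (simp add: compose_simps)
  then show "(op_inv B o\<^sub>L op_inv A) o\<^sub>L (A o\<^sub>L B) = id_blinfun"
    by (simp add: op_inv_inverse assms compose_simps)
qed (rule right_linear_ops_closed(4) [OF assms(1,2)])

text \<open>With \<open>?D\<close> the inverse of the product, \<open>C o\<^sub>L ?D\<close> is a
  right and \<open>?D o\<^sub>L C\<close> a left inverse of \<open>A\<close>, and the two coincide.
  This extracts one quadratic polynomial from its product with the conjugate one.\<close>

lemma op_invertible_commuting_factor:
  assumes "A \<in> right_linear_ops" "A o\<^sub>L C = C o\<^sub>L A" "op_invertible (A o\<^sub>L C)"
  shows "op_invertible A"
proof (rule op_invertibleI [OF assms(1)])
  let ?D = "op_inv (A o\<^sub>L C)"
  have 1: "A o\<^sub>L (C o\<^sub>L ?D) = id_blinfun"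
    using op_inv_inverse(1) [OF assms(3)] by (simp add: compose_simps)
  have 2: "(?D o\<^sub>L C) o\<^sub>L A = id_blinfun"
    using op_inv_inverse(2) [OF assms(3)] assms(2) by (simp add: compose_simps)
  show "A o\<^sub>L (C o\<^sub>L ?D) = id_blinfun" "(C o\<^sub>L ?D) o\<^sub>L A = id_blinfun"
    using 1 2 blinfun_inverse_unique [OF 1 2] by simp_all
qed

text \<open>Over a commutative ring a quaternion is invertible iff its conjugate is. The components of
  the inverse commute with those of the operator because the whole inverse does.\<close>

lemma op_invertible_quat_op_conj:
  assumes comm: "\<And>a b. a \<in> {w0, w1, w2, w3} \<Longrightarrow> b \<in> {w0, w1, w2, w3} \<Longrightarrow> a o\<^sub>L b = b o\<^sub>L a"
    and inv: "op_invertible (quat_op w0 w1 w2 w3)"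
  shows "op_invertible (quat_op w0 (- w1) (- w2) (- w3))"
proof -
  let ?W = "quat_op w0 w1 w2 w3"
  let ?B = "op_inv ?W"
  obtain b0 b1 b2 b3 where B: "?B = quat_op b0 b1 b2 b3"
    using right_linear_ops_eq_quat_op [OF op_inv_inverse(3) [OF inv]] by metis
  have cb: "b o\<^sub>L a = a o\<^sub>L b" if a: "a \<in> {w0, w1, w2, w3}" and b: "b \<in> {b0, b1, b2, b3}" for a b
  proof -
    have "?W o\<^sub>L quat_op a 0 0 0 = quat_op a 0 0 0 o\<^sub>L ?W"
      unfolding quat_op_compose quat_op_inject using comm [OF _ a] by simp
    then have "quat_op b0 b1 b2 b3 o\<^sub>L quat_op a 0 0 0 = quat_op a 0 0 0 o\<^sub>L quat_op b0 b1 b2 b3"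
      unfolding B [symmetric] by (rule op_inv_commute [OF inv])
    then show ?thesis
      unfolding quat_op_compose quat_op_inject using b by auto
  qed
  have id: "id_blinfun = quat_op id_blinfun 0 0 0"
    by (rule quat_op_eqI) (simp add: quat_op_apply)
  note WB = op_inv_inverse(1) [OF inv, unfolded B id quat_op_compose quat_op_inject]
  note BW = op_inv_inverse(2) [OF inv, unfolded B id quat_op_compose quat_op_inject]
  show ?thesis
  proof (rule op_invertibleI [OF quat_op_right_linear])
    \<comment> \<open>Conjugation reverses the order of the units. Because every \<open>b\<close>
      commutes with every \<open>w\<close>, the conjugate of \<open>?W o\<^sub>L ?B\<close> is the
      conjugate of \<open>?B\<close> times the conjugate of \<open>?W\<close>, and likewise with the
      factors exchanged; the \<open>b\<close> need not commute with each other.\<close>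
    show "quat_op w0 (- w1) (- w2) (- w3) o\<^sub>L quat_op b0 (- b1) (- b2) (- b3) = id_blinfun"
      "quat_op b0 (- b1) (- b2) (- b3) o\<^sub>L quat_op w0 (- w1) (- w2) (- w3) = id_blinfun"
      unfolding id quat_op_compose quat_op_inject
      using WB BW by (simp_all add: compose_simps cb cb [symmetric] algebra_simps)
  qed
qed

section \<open>Neumann series and continuity of inversion\<close>

primrec blinfun_power :: "('b::real_normed_vector \<Rightarrow>\<^sub>L 'b) \<Rightarrow> nat \<Rightarrow> 'b \<Rightarrow>\<^sub>L 'b" where
  "blinfun_power K 0 = id_blinfun"
| "blinfun_power K (Suc n) = K o\<^sub>L blinfun_power K n"

lemma Neumann_series:
  fixes K :: "'b::banach \<Rightarrow>\<^sub>L 'b"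
  assumes "norm K < 1"
  obtains S where "(id_blinfun - K) o\<^sub>L S = id_blinfun" "S o\<^sub>L (id_blinfun - K) = id_blinfun"
proof -
  have le: "norm (blinfun_power K n) \<le> norm K ^ n" for n
  proof (induction n)
    case 0
    show ?case by (simp add: norm_blinfun_id_le)
  next
    case (Suc n)
    have "norm (blinfun_power K (Suc n)) \<le> norm K * norm (blinfun_power K n)"
      by (simp add: norm_blinfun_compose)
    also have "\<dots> \<le> norm K * norm K ^ n" by (rule mult_left_mono [OF Suc]) simp
    finally show ?case by simp
  qed
  have sm: "summable (blinfun_power K)"
    by (rule summable_comparison_test' [OF summable_geometric, of "norm K" 0]) (use assms le in auto)
  have comm: "blinfun_power K n o\<^sub>L K = K o\<^sub>L blinfun_power K n" for n
    by (induction n) (simp_all add: compose_simps)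
  define S where "S = (\<Sum>n. blinfun_power K n)"
  have split: "S = id_blinfun + (\<Sum>n. K o\<^sub>L blinfun_power K n)"
    unfolding S_def using suminf_split_head [OF sm] by (simp add: algebra_simps)
  have "K o\<^sub>L S = (\<Sum>n. K o\<^sub>L blinfun_power K n)"
    unfolding S_def
    by (rule bounded_linear.suminf [OF _ sm]) (rule bounded_linear_compose_op(2))
  moreover have "S o\<^sub>L K = (\<Sum>n. blinfun_power K n o\<^sub>L K)"
    unfolding S_def
    by (rule bounded_linear.suminf [OF _ sm]) (rule bounded_linear_compose_op(1))
  ultimately show thesis
    using split comm by (intro that [of S]) (simp_all add: compose_simps algebra_simps)
qed

text \<open>\<open>A'\<close> is \<open>A\<close> composed with \<open>id_blinfun - ?K\<close>, and
  the smallness assumption makes the norm of \<open>?K\<close> less than one.\<close>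

lemma op_invertible_perturbation:
  fixes A A' :: "'a::banach qop"
  assumes inv: "op_invertible A" and A: "A \<in> right_linear_ops" "A' \<in> right_linear_ops"
    and small: "norm (op_inv A) * norm (A - A') < 1"
  shows "op_invertible A'"
proof -
  let ?K = "op_inv A o\<^sub>L (A - A')"
  have "norm ?K < 1" using norm_blinfun_compose small by (rule le_less_trans)
  then obtain S where S: "(id_blinfun - ?K) o\<^sub>L S = id_blinfun" "S o\<^sub>L (id_blinfun - ?K) = id_blinfun"
    by (rule Neumann_series)
  have K: "id_blinfun - ?K = op_inv A o\<^sub>L A'"
    by (simp add: compose_simps op_inv_inverse [OF inv])
  have 1: "A' o\<^sub>L (S o\<^sub>L op_inv A) = id_blinfun"
  proof -
    have cancel: "A o\<^sub>L (op_inv A o\<^sub>L X) = X" for X :: "'a qop"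
      by (simp add: op_inv_inverse [OF inv] compose_simps(10) flip: compose_simps(1))
    have "A' o\<^sub>L (S o\<^sub>L op_inv A) = (A o\<^sub>L (op_inv A o\<^sub>L (A' o\<^sub>L S))) o\<^sub>L op_inv A"
      by (simp add: cancel compose_simps(1))
    also have "op_inv A o\<^sub>L (A' o\<^sub>L S) = id_blinfun"
      using S(1) by (simp add: K compose_simps(1))
    finally show ?thesis by (simp add: op_inv_inverse [OF inv] compose_simps)
  qed
  show ?thesis
    by (rule op_invertibleI [OF A(2) 1]) (use S(2) in \<open>simp add: K compose_simps(1)\<close>)
qed

lemma op_inv_difference:
  assumes "op_invertible A" "op_invertible B"
  shows "op_inv A - op_inv B = op_inv A o\<^sub>L (B - A) o\<^sub>L op_inv B"
proof -
  have "op_inv A o\<^sub>L (B - A) o\<^sub>L op_inv B = (op_inv A o\<^sub>L (B o\<^sub>L op_inv B)) - ((op_inv A o\<^sub>L A) o\<^sub>L op_inv B)"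
    by (simp add: compose_simps)
  then show ?thesis by (simp add: op_inv_inverse assms compose_simps)
qed

text \<open>The difference identity bounds the error by \<open>norm (op_inv (F z))\<close> times
  \<open>norm (A - F z) * ?c\<close>, which still contains the inverse to be controlled. Once the
  second factor is below 1/2, the first is absorbed and is at most \<open>2 * ?c\<close>.\<close>

lemma tendsto_op_inv:
  assumes lim: "(F \<longlongrightarrow> A) G" and A: "op_invertible A" and ev: "\<forall>\<^sub>F z in G. op_invertible (F z)"
  shows "((\<lambda>z. op_inv (F z)) \<longlongrightarrow> op_inv A) G"
proof -
  let ?c = "norm (op_inv A)"
  have d0: "((\<lambda>z. norm (A - F z)) \<longlongrightarrow> 0) G"
    using tendsto_norm [OF tendsto_diff [OF tendsto_const lim, of A]] by simp
  then have "((\<lambda>z. norm (A - F z) * ?c) \<longlongrightarrow> 0 * ?c) G" by (intro tendsto_mult tendsto_const)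
  then have sm: "\<forall>\<^sub>F z in G. norm (A - F z) * ?c < 1/2" by (intro order_tendstoD) auto
  have "((\<lambda>z. op_inv (F z) - op_inv A) \<longlongrightarrow> 0) G"
  proof (rule Lim_null_comparison)
    show "\<forall>\<^sub>F z in G. norm (op_inv (F z) - op_inv A) \<le> (2 * ?c) * (norm (A - F z) * ?c)"
      using sm ev
    proof eventually_elim
      case (elim z)
      have b: "norm (op_inv (F z) - op_inv A) \<le> norm (op_inv (F z)) * (norm (A - F z) * ?c)"
        unfolding op_inv_difference [OF elim(2) A]
        by (metis (no_types, lifting) mult.assoc mult_right_mono norm_blinfun_compose norm_ge_zero order_trans)
      also have "\<dots> \<le> norm (op_inv (F z)) * (1/2)"
        using elim(1) by (intro mult_left_mono) auto
      finally have "norm (op_inv (F z)) \<le> 2 * ?c"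
        using norm_triangle_ineq2 [of "op_inv (F z)" "op_inv A"] by simp
      then have "norm (op_inv (F z)) * (norm (A - F z) * ?c) \<le> (2 * ?c) * (norm (A - F z) * ?c)"
        by (intro mult_right_mono) auto
      with b show ?case by linarith
    qed
    have "((\<lambda>z. (2 * ?c) * (norm (A - F z) * ?c)) \<longlongrightarrow> (2 * ?c) * (0 * ?c)) G"
      by (intro tendsto_mult tendsto_const d0)
    then show "((\<lambda>z. (2 * ?c) * (norm (A - F z) * ?c)) \<longlongrightarrow> 0) G" by simp
  qed
  then show ?thesis by (simp add: LIM_zero_iff)
qed

section \<open>Complex slices of the operator algebra\<close>

lemma imag_units_facts:
  assumes "J \<in> imag_units"
  shows "QRe J = 0" "norm J = 1" "J * J = - 1" "J \<noteq> 0"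
proof -
  show JJ: "J * J = - 1" using assms by (simp add: imag_units_def)
  then have "norm J * norm J = 1" by (metis norm_minus_cancel norm_mult norm_one)
  then have "(norm J)\<^sup>2 = 1" by (simp add: power2_eq_square)
  then show n: "norm J = 1" by (simp add: power2_eq_1_iff) (smt (verit) norm_ge_zero)
  show "J \<noteq> 0" using n by auto
  have "QRe (J * J) = 2 * (QRe J)\<^sup>2 - (norm J)\<^sup>2"
    by (simp add: times_quat_def norm_quat_def power2_eq_square)
  then show "QRe J = 0" by (simp add: JJ n uminus_quat_def one_quat_def)
qed

lemma imag_units_minus: "J \<in> imag_units \<Longrightarrow> - J \<in> imag_units"
  by (simp add: imag_units_def)

lemma of_real_quat: "of_real r = Quat r 0 0 0"
  by (simp add: of_real_def scaleR_quat_def one_quat_def)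

lemma qe_imag_units: "qe1 \<in> imag_units" "qe2 \<in> imag_units" "qe3 \<in> imag_units"
  by (simp_all add: imag_units_def qe_times)

text \<open>The complex linear functional with real part \<open>\<phi>\<close> for the complex
  structure given by left composition with \<open>lmul J\<close>, as in the passage from the real to
  the complex Hahn-Banach theorem. The minus sign makes composition with \<open>lmul J\<close> act
  as multiplication by \<open>\<i>\<close>.\<close>

definition slice_functional :: "quat \<Rightarrow> ('a::real_normed_vector qop \<Rightarrow> real) \<Rightarrow> 'a qop \<Rightarrow> complex" where
  "slice_functional J \<phi> B = Complex (\<phi> B) (- \<phi> (lmul J o\<^sub>L B))"

context
  fixes J assumes J: "J \<in> imag_units"
begin

lemma to_slice_scaleR_form: "to_slice J z = Re z *\<^sub>R 1 + Im z *\<^sub>R J"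
  by (simp add: to_slice_def of_real_def)

lemma to_slice_mult: "to_slice J (z * w) = to_slice J z * to_slice J w"
  by (simp add: to_slice_scaleR_form algebra_simps imag_units_facts [OF J])

lemma to_slice_add: "to_slice J (z + w) = to_slice J z + to_slice J w"
  by (simp add: to_slice_scaleR_form algebra_simps)

lemma to_slice_diff: "to_slice J (z - w) = to_slice J z - to_slice J w"
  by (simp add: to_slice_scaleR_form algebra_simps)

lemma to_slice_of_real: "to_slice J (of_real r) = of_real r"
  by (simp add: to_slice_def)

lemma to_slice_ii: "to_slice J \<i> = J"
  by (simp add: to_slice_def)

lemma to_slice_scaleR: "to_slice J (r *\<^sub>R z) = r *\<^sub>R to_slice J z"
  by (simp add: to_slice_scaleR_form algebra_simps)

lemma QRe_to_slice: "QRe (to_slice J z) = Re z"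
  by (simp add: to_slice_scaleR_form plus_quat_def scaleR_quat_def one_quat_def imag_units_facts [OF J])

lemma norm_to_slice: "norm (to_slice J z) = cmod z"
proof -
  have "norm J = 1" by (rule imag_units_facts [OF J])
  then have "(QI1 J)\<^sup>2 + (QI2 J)\<^sup>2 + (QI3 J)\<^sup>2 = 1"
    by (simp add: norm_quat_def imag_units_facts(1) [OF J])
  then have "(Im z)\<^sup>2 * ((QI1 J)\<^sup>2 + (QI2 J)\<^sup>2 + (QI3 J)\<^sup>2) = (Im z)\<^sup>2" by simp
  then show ?thesis
    by (simp add: norm_quat_def cmod_def to_slice_scaleR_form plus_quat_def scaleR_quat_def one_quat_def
        imag_units_facts(1) [OF J] power_mult_distrib algebra_simps)
qed

lemma bounded_linear_to_slice: "bounded_linear (to_slice J)"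
  by (rule bounded_linear_intro [where K = 1])
    (simp_all add: to_slice_add to_slice_scaleR norm_to_slice)

lemma to_slice_minus_unit: "to_slice (- J) z = to_slice J (cnj z)"
  by (simp add: to_slice_def)

lemma to_slice_intertwine: "h * J = K * h \<Longrightarrow> h * to_slice J z = to_slice K z * h"
  by (simp add: to_slice_def algebra_simps of_real_def mult.assoc [symmetric])

lemmas bounded_linear_lmul_slice = bounded_linear_compose [OF bounded_linear_lmul bounded_linear_to_slice]

lemma slice_functional_eq: "slice_functional J \<phi> B = of_real (\<phi> B) - \<i> * of_real (\<phi> (lmul J o\<^sub>L B))"
  by (simp add: slice_functional_def complex_eq_iff)

lemma bounded_linear_slice_functional:
  assumes "bounded_linear \<phi>"
  shows "bounded_linear (slice_functional J \<phi>)"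
  unfolding slice_functional_eq [abs_def]
  by (intro bounded_linear_sub bounded_linear_compose [OF bounded_linear_of_real assms]
      bounded_linear_compose [OF bounded_linear_mult_right]
      bounded_linear_compose [OF bounded_linear_of_real bounded_linear_compose [OF assms]]
      bounded_linear_compose_op(2))

lemma slice_functional_slice:
  assumes "bounded_linear \<phi>"
  shows "slice_functional J \<phi> (lmul (to_slice J z) o\<^sub>L B) = z * slice_functional J \<phi> B"
proof -
  have "lmul J o\<^sub>L (lmul J o\<^sub>L B) = - B"
    by (simp add: imag_units_facts [OF J] lmul_minus lmul_1 compose_simps
        flip: compose_simps(1) lmul_mult)
  then show ?thesis
    by (simp add: slice_functional_def to_slice_scaleR_form lmul_add lmul_scaleR lmul_1
        compose_simps linear_simps [OF assms] complex_eq_iff algebra_simps)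
qed

end

lemma blinfun_eqI_slice_functional:
  fixes A B :: "'a::real_normed_vector qop"
  assumes "\<And>\<phi>. bounded_linear \<phi> \<Longrightarrow> slice_functional J \<phi> A = slice_functional J \<phi> B"
  shows "A = B"
proof (rule eq_if_functionals_eq)
  fix \<phi> :: "'a qop \<Rightarrow> real" assume "bounded_linear \<phi>"
  from assms [OF this] show "\<phi> A = \<phi> B" by (simp add: slice_functional_def)
qed

section \<open>Operators with commuting components\<close>

lemma scaleR_quat_op: "r *\<^sub>R quat_op t0 t1 t2 t3 = quat_op (r *\<^sub>R t0) (r *\<^sub>R t1) (r *\<^sub>R t2) (r *\<^sub>R t3)"
  by (rule quat_op_eqI) (simp add: quat_op_apply blinfun.bilinear_simps algebra_simps)

lemma quat_op_diff:
  "quat_op a0 a1 a2 a3 - quat_op b0 b1 b2 b3 = quat_op (a0 - b0) (a1 - b1) (a2 - b2) (a3 - b3)"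
  by (rule quat_op_eqI) (simp add: quat_op_apply blinfun.bilinear_simps)

lemma id_blinfun_eq_quat_op: "id_blinfun = quat_op id_blinfun 0 0 0"
  by (rule quat_op_eqI) (simp add: quat_op_apply)

locale commuting_operator =
  fixes T :: "'a::banach qop"
  assumes commuting: "T \<in> commuting_ops"
begin

text \<open>\<open>tr\<close> and \<open>nm\<close> are the trace and the norm of \<open>T\<close>
  as a quaternion over its components, the coefficients of the quadratic equation satisfied by
  \<open>T\<close>. Both turn out to be componentwise, so they commute with all quaternions, and
  \<open>Qc\<close> is a polynomial in the slice variable with these coefficients.\<close>

definition tr where "tr = T + op_conj T"
definition nm where "nm = (T o\<^sub>L op_conj T)"

definition parts where "parts = {op_part0 T, op_part1 T, op_part2 T, op_part3 T}"

lemma T_eq: "T = quat_op (op_part0 T) (op_part1 T) (op_part2 T) (op_part3 T)"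
  using commuting by (auto simp: commuting_ops_def op_part_quat_op)

lemma parts_commute: "a \<in> parts \<Longrightarrow> b \<in> parts \<Longrightarrow> a o\<^sub>L b = b o\<^sub>L a"
  using commuting unfolding parts_def commuting_ops_def by (auto simp: op_part_quat_op)

lemma parts_commute': "(a :: 'a \<Rightarrow>\<^sub>L 'a) \<in> parts \<Longrightarrow> b \<in> parts \<Longrightarrow> a o\<^sub>L (b o\<^sub>L c) = b o\<^sub>L (a o\<^sub>L (c :: 'a \<Rightarrow>\<^sub>L 'a))"
  using parts_commute by (simp flip: compose_simps(1))

lemma in_parts: "op_part0 T \<in> parts" "op_part1 T \<in> parts" "op_part2 T \<in> parts" "op_part3 T \<in> parts"
  by (simp_all add: parts_def)

lemma tr_eq: "tr = ext_op (2 *\<^sub>R op_part0 T)"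
  unfolding tr_def op_conj_def ext_op_eq_quat_op
  by (subst T_eq) (simp add: quat_op_add scaleR_2)

text \<open>The mixed terms cancel in pairs because the components of \<open>T\<close>
  commute.\<close>

lemma nm_eq: "nm = ext_op ((op_part0 T o\<^sub>L op_part0 T) + (op_part1 T o\<^sub>L op_part1 T)
    + (op_part2 T o\<^sub>L op_part2 T) + (op_part3 T o\<^sub>L op_part3 T))"
proof -
  have "nm = quat_op (op_part0 T) (op_part1 T) (op_part2 T) (op_part3 T) o\<^sub>L op_conj T"
    unfolding nm_def by (simp flip: T_eq)
  then show ?thesis
    by (simp add: op_conj_def ext_op_eq_quat_op quat_op_compose quat_op_inject compose_simps
        parts_commute [OF in_parts(1) in_parts(2)] parts_commute [OF in_parts(1) in_parts(3)]
        parts_commute [OF in_parts(1) in_parts(4)] parts_commute [OF in_parts(2) in_parts(3)]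
        parts_commute [OF in_parts(2) in_parts(4)] parts_commute [OF in_parts(3) in_parts(4)])
qed

lemma tr_lmul: "tr o\<^sub>L lmul p = lmul p o\<^sub>L tr" and nm_lmul: "nm o\<^sub>L lmul p = lmul p o\<^sub>L nm"
  by (simp_all add: tr_eq nm_eq ext_op_lmul_commute)

text \<open>\<open>T\<close> and its conjugate are built from quaternion units and componentwise
  operators, so commutation need only be tested on these. The sign \<open>r\<close> treats both at
  once: 1 gives \<open>T\<close>, -1 the conjugate.\<close>

lemma commute_T:
  assumes "\<And>p. C o\<^sub>L lmul p = lmul p o\<^sub>L C" "\<And>R. R \<in> parts \<Longrightarrow> C o\<^sub>L ext_op R = ext_op R o\<^sub>L C"
  shows "C o\<^sub>L T = T o\<^sub>L C" "C o\<^sub>L op_conj T = op_conj T o\<^sub>L C"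
proof -
  have l: "C o\<^sub>L (lmul p o\<^sub>L D) = lmul p o\<^sub>L (C o\<^sub>L D)" for p and D :: "'a qop"
    by (simp add: assms(1) flip: compose_simps(1))
  have e: "C o\<^sub>L (ext_op R o\<^sub>L D) = ext_op R o\<^sub>L (C o\<^sub>L D)" if "R \<in> parts" for R and D :: "'a qop"
    by (simp add: assms(2) that flip: compose_simps(1))
  have "C o\<^sub>L quat_op (op_part0 T) (r *\<^sub>R op_part1 T) (r *\<^sub>R op_part2 T) (r *\<^sub>R op_part3 T)
      = quat_op (op_part0 T) (r *\<^sub>R op_part1 T) (r *\<^sub>R op_part2 T) (r *\<^sub>R op_part3 T) o\<^sub>L C" for r
    by (simp add: quat_op_def compose_simps ext_op_simps l e assms in_parts)
  from this [of 1] this [of "-1"] show "C o\<^sub>L T = T o\<^sub>L C" "C o\<^sub>L op_conj T = op_conj T o\<^sub>L C"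
    by (simp_all add: op_conj_def flip: T_eq)
qed

lemma ext_op_tr: "R \<in> parts \<Longrightarrow> tr o\<^sub>L ext_op R = ext_op R o\<^sub>L tr"
  by (simp add: tr_eq ext_op_simps compose_simps parts_commute in_parts flip: ext_op_simps(4))

lemma ext_op_nm: "R \<in> parts \<Longrightarrow> nm o\<^sub>L ext_op R = ext_op R o\<^sub>L nm"
  by (simp add: nm_eq compose_simps parts_commute' parts_commute in_parts flip: ext_op_simps(4))

lemma tr_T: "tr o\<^sub>L T = T o\<^sub>L tr" and tr_op_conj: "tr o\<^sub>L op_conj T = op_conj T o\<^sub>L tr"
  and nm_T: "nm o\<^sub>L T = T o\<^sub>L nm"
  by (intro commute_T; simp add: tr_lmul nm_lmul ext_op_tr ext_op_nm)+

lemma tr_nm: "tr o\<^sub>L nm = nm o\<^sub>L tr"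
proof -
  have "tr o\<^sub>L nm = T o\<^sub>L (tr o\<^sub>L op_conj T)"
    by (simp add: nm_def tr_T flip: compose_simps(1))
  then show ?thesis by (simp add: tr_op_conj nm_def compose_simps(1))
qed

lemma T_square: "T o\<^sub>L T = (tr o\<^sub>L T) - nm"
proof -
  have "(T o\<^sub>L T) + nm = T o\<^sub>L tr" by (simp add: nm_def tr_def compose_simps)
  then show ?thesis by (simp add: tr_T algebra_simps)
qed

text \<open>The vector part is half the trace minus the conjugate. In this form it meets the
  calculi, where \<open>T\<close> enters only through \<open>tr\<close>, \<open>nm\<close> and
  \<open>op_conj T\<close>.\<close>

lemma op_vec_eq: "op_vec T = (1/2) *\<^sub>R tr - op_conj T"
  unfolding op_vec_def op_conj_def tr_eq ext_op_eq_quat_op scaleR_quat_op quat_op_diff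
  by (simp add: quat_op_inject)

text \<open>Membership of a quaternion in the resolvent set depends only on its real part and its
  norm, so a single set in the complex plane, symmetric under conjugation, describes the resolvent
  set in every slice.\<close>

definition resolvent_plane :: "complex set" where
  "resolvent_plane = {z. op_invertible ((T o\<^sub>L T) - (2 * Re z) *\<^sub>R T + (cmod z)\<^sup>2 *\<^sub>R id_blinfun)}"

lemma to_slice_resolvent:
  assumes "J \<in> imag_units"
  shows "to_slice J z \<in> S_resolvent_set T \<longleftrightarrow> z \<in> resolvent_plane"
  by (simp add: S_resolvent_set_def resolvent_plane_def QRe_to_slice [OF assms] norm_to_slice [OF assms])

lemma cnj_resolvent: "cnj z \<in> resolvent_plane \<longleftrightarrow> z \<in> resolvent_plane"
  by (simp add: resolvent_plane_def)

lemma T_right_linear: "T \<in> right_linear_ops" "op_conj T \<in> right_linear_ops" "tr \<in> right_linear_ops"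
    "nm \<in> right_linear_ops"
proof -
  show T: "T \<in> right_linear_ops" using commuting commuting_ops_subset by blast
  show "op_conj T \<in> right_linear_ops" by (simp add: op_conj_def quat_op_right_linear)
  with T show "tr \<in> right_linear_ops" "nm \<in> right_linear_ops"
    by (simp_all add: tr_def nm_def right_linear_ops_closed)
qed

lemma open_resolvent_plane: "open resolvent_plane"
  unfolding open_dist
proof (intro ballI)
  let ?W = "\<lambda>z. (T o\<^sub>L T) - (2 * Re z) *\<^sub>R T + (cmod z)\<^sup>2 *\<^sub>R id_blinfun"
  have rl: "?W z \<in> right_linear_ops" for z by (intro right_linear_ops_closed T_right_linear)
  fix z assume z: "z \<in> resolvent_plane"
  have "((\<lambda>y. norm (op_inv (?W z)) * norm (?W z - ?W y)) \<longlongrightarrow> norm (op_inv (?W z)) * norm (?W z - ?W z)) (nhds z)"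
    by (intro tendsto_intros tendsto_Re tendsto_ident_at filterlim_ident)
  then have "\<forall>\<^sub>F y in nhds z. norm (op_inv (?W z)) * norm (?W z - ?W y) < 1"
    by (intro order_tendstoD) auto
  then have "\<forall>\<^sub>F y in nhds z. y \<in> resolvent_plane"
    unfolding resolvent_plane_def mem_Collect_eq
    by eventually_elim (rule op_invertible_perturbation [OF _ rl rl],
      use z in \<open>simp_all add: resolvent_plane_def\<close>)
  then show "\<exists>e>0. \<forall>y. dist y z < e \<longrightarrow> y \<in> resolvent_plane"
    by (simp add: eventually_nhds_metric)
qed

lemma Qc_slice:
  assumes "J \<in> imag_units"
  shows "Qc (to_slice J z) T
    = (lmul (to_slice J z) o\<^sub>L lmul (to_slice J z)) - (lmul (to_slice J z) o\<^sub>L tr) + nm"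
  by (simp add: Qc_def tr_def nm_def power2_eq_square lmul_mult)

lemma Qc_right_linear: "Qc s T \<in> right_linear_ops"
  unfolding Qc_def tr_def [symmetric] nm_def [symmetric]
  by (intro right_linear_ops_closed T_right_linear)

text \<open>If everything commuted, \<open>Qc\<close> at \<open>z\<close> would be (z - T)(z - T'),
  with \<open>T'\<close> the conjugate of \<open>T\<close>, and \<open>?W\<close> would be (z -
  T)(cnj z - T). The four factors z - T, z - T', cnj z - T, cnj z - T' can be grouped in either way,
  so \<open>Qc\<close> at \<open>z\<close> times \<open>Qc\<close> at \<open>cnj z\<close> equals
  \<open>?W\<close> times its conjugate \<open>?V\<close>. The latter product is invertible, hence
  so are the commuting factors of the former.\<close>

lemma Qc_invertible:
  assumes J: "J \<in> imag_units" and z: "z \<in> resolvent_plane"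
  shows "op_invertible (Qc (to_slice J z) T)"
proof -
  let ?u = "2 * Re z" and ?n = "(cmod z)\<^sup>2"
  let ?W = "(T o\<^sub>L T) - ?u *\<^sub>R T + ?n *\<^sub>R id_blinfun"
  let ?V = "(op_conj T o\<^sub>L op_conj T) - ?u *\<^sub>R op_conj T + ?n *\<^sub>R id_blinfun"
  define t0 t1 t2 t3 where t: "t0 = op_part0 T" "t1 = op_part1 T" "t2 = op_part2 T" "t3 = op_part3 T"
  have Tq: "T = quat_op t0 t1 t2 t3" unfolding t by (rule T_eq)
  have Vq: "op_conj T = quat_op t0 (- t1) (- t2) (- t3)" unfolding t by (rule op_conj_def)
  have tp: "t0 \<in> parts" "t1 \<in> parts" "t2 \<in> parts" "t3 \<in> parts" unfolding t by (rule in_parts)+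
  have c: "t1 o\<^sub>L t0 = t0 o\<^sub>L t1" "t2 o\<^sub>L t0 = t0 o\<^sub>L t2" "t3 o\<^sub>L t0 = t0 o\<^sub>L t3"
    "t2 o\<^sub>L t1 = t1 o\<^sub>L t2" "t3 o\<^sub>L t1 = t1 o\<^sub>L t3" "t3 o\<^sub>L t2 = t2 o\<^sub>L t3"
    by (rule parts_commute; rule tp)+
  have c': "t1 o\<^sub>L (t0 o\<^sub>L x) = t0 o\<^sub>L (t1 o\<^sub>L x)" "t2 o\<^sub>L (t0 o\<^sub>L x) = t0 o\<^sub>L (t2 o\<^sub>L x)"
    "t3 o\<^sub>L (t0 o\<^sub>L x) = t0 o\<^sub>L (t3 o\<^sub>L x)" "t2 o\<^sub>L (t1 o\<^sub>L x) = t1 o\<^sub>L (t2 o\<^sub>L x)"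
    "t3 o\<^sub>L (t1 o\<^sub>L x) = t1 o\<^sub>L (t3 o\<^sub>L x)" "t3 o\<^sub>L (t2 o\<^sub>L x) = t2 o\<^sub>L (t3 o\<^sub>L x)" for x :: "'a \<Rightarrow>\<^sub>L 'a"
    by (rule parts_commute'; rule tp)+
  define w0 where "w0 = (t0 o\<^sub>L t0) - (t1 o\<^sub>L t1) - (t2 o\<^sub>L t2) - (t3 o\<^sub>L t3) - ?u *\<^sub>R t0 + ?n *\<^sub>R id_blinfun"
  \<comment> \<open>In the square of a quaternion with commuting components the mixed vector terms
    cancel; in front of each unit remains twice the product of \<open>t0\<close> with that
    component.\<close>
  define w where "w ti = 2 *\<^sub>R (t0 o\<^sub>L ti) - ?u *\<^sub>R ti" for ti :: "'a \<Rightarrow>\<^sub>L 'a"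
  have Wq: "?W = quat_op w0 (w t1) (w t2) (w t3)"
    unfolding Tq id_blinfun_eq_quat_op quat_op_compose scaleR_quat_op quat_op_diff quat_op_add quat_op_inject
    by (simp add: w0_def w_def c scaleR_2)
  have Vq': "?V = quat_op w0 (- w t1) (- w t2) (- w t3)"
    unfolding Vq id_blinfun_eq_quat_op quat_op_compose scaleR_quat_op quat_op_diff quat_op_add quat_op_inject
    by (simp add: w0_def w_def c scaleR_2 compose_simps)
  have iW: "op_invertible ?W" using z by (simp add: resolvent_plane_def)
  have iV: "op_invertible ?V"
    unfolding Vq'
  proof (rule op_invertible_quat_op_conj [OF _ iW [unfolded Wq]])
    fix a b assume "a \<in> {w0, w t1, w t2, w t3}" "b \<in> {w0, w t1, w t2, w t3}"
    then show "a o\<^sub>L b = b o\<^sub>L a"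
      by (elim insertE emptyE; simp only: w0_def w_def compose_simps c c'; simp add: algebra_simps)
  qed
  have WV: "op_invertible (?W o\<^sub>L ?V)"
    by (intro op_invertible_compose iW iV right_linear_ops_closed T_right_linear)
  let ?L = "lmul (to_slice J z)"
  define L :: "'a qop" where "L = ?L"
  \<comment> \<open>The slice variable and \<open>T\<close> both satisfy quadratic equations. These
    become the rewrite rules that reduce the product identity to a normal form linear in
    \<open>L\<close> and in \<open>T\<close>, with coefficients in \<open>tr\<close> and
    \<open>nm\<close>.\<close>
  have zz: "z * z = of_real ?u * z - of_real ?n" and cz: "cnj z = of_real ?u - z"
    unfolding cmod_power2 by (simp_all add: complex_eq_iff power2_eq_square algebra_simps)
  have LL: "L o\<^sub>L L = ?u *\<^sub>R L - ?n *\<^sub>R id_blinfun"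
  proof -
    have "to_slice J (z * z) = ?u *\<^sub>R to_slice J z - of_real ?n"
      unfolding zz by (simp only: to_slice_diff [OF J] to_slice_of_real [OF J] to_slice_scaleR [OF J]
          flip: scaleR_conv_of_real)
    then have "lmul (to_slice J z * to_slice J z) = lmul (?u *\<^sub>R to_slice J z - of_real ?n)"
      by (simp only: to_slice_mult [OF J])
    then show ?thesis by (simp only: lmul_mult lmul_diff lmul_scaleR lmul_of_real L_def)
  qed
  have Lc: "lmul (to_slice J (cnj z)) = ?u *\<^sub>R id_blinfun - L"
    unfolding cz to_slice_diff [OF J] lmul_diff to_slice_of_real [OF J] lmul_of_real L_def ..
  have V: "op_conj T = tr - T" by (simp add: tr_def)
  have r: "T o\<^sub>L tr = tr o\<^sub>L T" "T o\<^sub>L nm = nm o\<^sub>L T" "nm o\<^sub>L tr = tr o\<^sub>L nm"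
    "L o\<^sub>L tr = tr o\<^sub>L L" "L o\<^sub>L nm = nm o\<^sub>L L"
    by (simp_all add: tr_T nm_T tr_nm L_def tr_lmul nm_lmul)
  have r': "T o\<^sub>L (tr o\<^sub>L x) = tr o\<^sub>L (T o\<^sub>L x)" "T o\<^sub>L (nm o\<^sub>L x) = nm o\<^sub>L (T o\<^sub>L x)"
    "nm o\<^sub>L (tr o\<^sub>L x) = tr o\<^sub>L (nm o\<^sub>L x)" "L o\<^sub>L (tr o\<^sub>L x) = tr o\<^sub>L (L o\<^sub>L x)"
    "L o\<^sub>L (nm o\<^sub>L x) = nm o\<^sub>L (L o\<^sub>L x)" "T o\<^sub>L (T o\<^sub>L x) = (tr o\<^sub>L (T o\<^sub>L x)) - (nm o\<^sub>L x)"
    "L o\<^sub>L (L o\<^sub>L x) = ?u *\<^sub>R (L o\<^sub>L x) - ?n *\<^sub>R x" for x :: "'a qop"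
    by (simp_all add: r T_square LL compose_simps(4,8,10) flip: compose_simps(1))
  have Q: "Qc (to_slice J z) T = (L o\<^sub>L L) - (L o\<^sub>L tr) + nm"
    unfolding L_def by (rule Qc_slice [OF J])
  have Q': "Qc (to_slice J (cnj z)) T = ((?u *\<^sub>R id_blinfun - L) o\<^sub>L (?u *\<^sub>R id_blinfun - L)) - ((?u *\<^sub>R id_blinfun - L) o\<^sub>L tr) + nm"
    unfolding Qc_slice [OF J] Lc ..
  define u n where "u = ?u" and "n = ?n"
  note rules = T_square LL [folded u_def n_def] r r' [folded u_def n_def] compose_simps
  have "Qc (to_slice J z) T o\<^sub>L Qc (to_slice J (cnj z)) T = ?W o\<^sub>L ?V"
    unfolding Q Q' V unfolding u_def [symmetric] n_def [symmetric]
    by (simp add: rules algebra_simps)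
  moreover have "Qc (to_slice J z) T o\<^sub>L Qc (to_slice J (cnj z)) T = Qc (to_slice J (cnj z)) T o\<^sub>L Qc (to_slice J z) T"
    unfolding Q Q' unfolding u_def [symmetric] n_def [symmetric]
    by (simp add: rules algebra_simps)
  ultimately show ?thesis
    using WV op_invertible_commuting_factor [OF Qc_right_linear] by metis
qed

end

section \<open>Operator-valued contour integrals\<close>

text \<open>Weak holomorphy for the complex structure of \<open>J\<close>. Norm continuity is
  required separately, so that means over segments exist as operators before any functional is
  applied.\<close>

definition slice_holomorphic_on ::
  "quat \<Rightarrow> (complex \<Rightarrow> 'a::banach qop) \<Rightarrow> complex set \<Rightarrow> bool" where
  "slice_holomorphic_on J F S \<longleftrightarrow> continuous_on S F \<and>
    (\<forall>\<phi>. bounded_linear \<phi> \<longrightarrow> (\<lambda>z. slice_functional J \<phi> (F z)) holomorphic_on S)"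

lemma slice_holomorphic_on_subset:
  "slice_holomorphic_on J F S \<Longrightarrow> S' \<subseteq> S \<Longrightarrow> slice_holomorphic_on J F S'"
  unfolding slice_holomorphic_on_def
  by (meson continuous_on_subset holomorphic_on_subset)

lemma slice_holomorphic_on_lmul:
  assumes J: "J \<in> imag_units" and f: "f holomorphic_on S" and F: "slice_holomorphic_on J F S"
  shows "slice_holomorphic_on J (\<lambda>z. lmul (to_slice J (f z)) o\<^sub>L F z) S"
  unfolding slice_holomorphic_on_def
proof (intro conjI allI impI)
  have "continuous_on S (\<lambda>z. lmul (to_slice J (f z)))"
    by (rule bounded_linear.continuous_on [OF bounded_linear_lmul_slice [OF J] holomorphic_on_imp_continuous_on [OF f]])
  then show "continuous_on S (\<lambda>z. lmul (to_slice J (f z)) o\<^sub>L F z)"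
    using F by (intro bounded_bilinear.continuous_on [OF bounded_bilinear_blinfun_compose])
      (simp_all add: slice_holomorphic_on_def)
  fix \<phi> :: "'a qop \<Rightarrow> real" assume \<phi>: "bounded_linear \<phi>"
  show "(\<lambda>z. slice_functional J \<phi> (lmul (to_slice J (f z)) o\<^sub>L F z)) holomorphic_on S"
    unfolding slice_functional_slice [OF J \<phi>]
    using F f \<phi> by (intro holomorphic_intros) (auto simp: slice_holomorphic_on_def)
qed

lemma bounded_linear_compose_functional:
  assumes "bounded_linear \<phi>"
  shows "bounded_linear (\<lambda>X. \<phi> (X o\<^sub>L C))"
  by (rule bounded_linear_compose [OF assms bounded_linear_compose_op(1)])

lemma slice_functional_compose_right:
  "slice_functional J \<phi> (X o\<^sub>L C) = slice_functional J (\<lambda>X. \<phi> (X o\<^sub>L C)) X"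
  by (simp add: slice_functional_def compose_simps(1))

text \<open>The differential stands on the left, where the functionals turn it into a complex
  factor, so that a scalar contour integral results. The factor \<open>- J\<close> of the slice
  differential is left to \<open>Q_calc\<close>.\<close>

definition op_integral ::
  "quat \<Rightarrow> (real \<Rightarrow> complex) \<Rightarrow> (complex \<Rightarrow> 'a::banach qop) \<Rightarrow> 'a qop" where
  "op_integral J \<gamma> F =
    integral {0..1} (\<lambda>t. lmul (to_slice J (vector_derivative \<gamma> (at t within {0..1}))) o\<^sub>L F (\<gamma> t))"

context
  fixes J assumes J: "J \<in> imag_units"
begin

text \<open>The primitive at \<open>w\<close> is \<open>w - a\<close> acting on the mean
  \<open>m a w\<close> of \<open>F\<close> over the segment from \<open>a\<close> to
  \<open>w\<close>. Its difference quotient at \<open>z\<close> is the mean \<open>m z w\<close>,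
  which tends to \<open>F z\<close>.\<close>

lemma slice_holomorphic_local_primitive:
  assumes F: "slice_holomorphic_on J F (ball a r)"
  obtains G where "\<And>z. z \<in> ball a r \<Longrightarrow> (G has_derivative (\<lambda>h. lmul (to_slice J h) o\<^sub>L F z)) (at z)"
proof (cases "r > 0")
  case False
  then show thesis by (intro that [of "\<lambda>_. 0"]) (simp add: ball_empty)
next
  case True
  let ?B = "ball a r"
  have contF: "continuous_on ?B F" using F by (simp add: slice_holomorphic_on_def)
  define m where "m z w = integral (cbox 0 1) (\<lambda>t. F (z + of_real t * (w - z)))" for z w
  have "continuous_on ((?B \<times> ?B) \<times> cbox 0 1) (\<lambda>(p, t). F (fst p + of_real t * (snd p - fst p)))"
    unfolding split_beta
    by (intro continuous_on_compose2 [OF contF] continuous_intros) (use segment_point_in_ball in auto)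
  then have contm: "continuous_on (?B \<times> ?B) (\<lambda>p. m (fst p) (snd p))"
    unfolding m_def by (rule integral_continuous_on_param)
  have intF: "(\<lambda>t. F (z + of_real t * (w - z))) integrable_on cbox 0 1" if "z \<in> ?B" "w \<in> ?B" for z w
    by (intro integrable_continuous continuous_on_compose2 [OF contF] continuous_intros) (use segment_point_in_ball that in auto)
  have mz: "m z z = F z" for z by (simp add: m_def)
  \<comment> \<open>This is Cauchy's theorem for the triangle \<open>a\<close>, \<open>z\<close>,
    \<open>w\<close>. Each functional sees a scalar holomorphic function, whose primitive
    \<open>H\<close> on the disc evaluates all three sides.\<close>
  have key: "(lmul (to_slice J (w - a)) o\<^sub>L m a w) - (lmul (to_slice J (z - a)) o\<^sub>L m a z)
      = lmul (to_slice J (w - z)) o\<^sub>L m z w" if zw: "z \<in> ?B" "w \<in> ?B" for z w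
  proof (rule blinfun_eqI_slice_functional)
    fix \<phi> :: "'a qop \<Rightarrow> real" assume \<phi>: "bounded_linear \<phi>"
    let ?sf = "slice_functional J \<phi>"
    have bl: "bounded_linear ?sf" by (rule bounded_linear_slice_functional [OF J \<phi>])
    have hol: "(\<lambda>z. ?sf (F z)) holomorphic_on ?B" using F \<phi> by (simp add: slice_holomorphic_on_def)
    obtain H where H: "\<And>z. z \<in> ?B \<Longrightarrow> (H has_field_derivative ?sf (F z)) (at z within ?B)"
      using holomorphic_convex_primitive' [OF convex_ball open_ball hol] by blast
    have sf: "?sf (lmul (to_slice J (y - x)) o\<^sub>L m x y) = H y - H x" if "x \<in> ?B" "y \<in> ?B" for x y
    proof -
      have seg: "path_image (linepath x y) \<subseteq> ?B"
        using that by (simp add: closed_segment_subset)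
      have "((\<lambda>t. ?sf (F (linepath x y t)) * (y - x)) has_integral H y - H x) {0..1}"
        using contour_integral_primitive [OF H valid_path_linepath seg]
        by (simp add: has_contour_integral_linepath)
      moreover have "linepath x y t = x + of_real t * (y - x)" for t
        by (simp add: linepath_def scaleR_conv_of_real algebra_simps)
      ultimately have "((\<lambda>t. ?sf (F (x + of_real t * (y - x))) * (y - x)) has_integral H y - H x) {0..1}"
        by simp
      moreover have "((\<lambda>t. ?sf (F (x + of_real t * (y - x)))) has_integral ?sf (m x y)) {0..1}"
        using has_integral_linear [OF integrable_integral [OF intF [OF that]] bl]
        by (simp add: m_def o_def)
      then have "((\<lambda>t. ?sf (F (x + of_real t * (y - x))) * (y - x)) has_integral ?sf (m x y) * (y - x)) {0..1}"
        by (rule has_integral_mult_left)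
      ultimately have "H y - H x = ?sf (m x y) * (y - x)" by (rule has_integral_unique)
      then show ?thesis by (simp add: slice_functional_slice [OF J \<phi>])
    qed
    show "?sf ((lmul (to_slice J (w - a)) o\<^sub>L m a w) - (lmul (to_slice J (z - a)) o\<^sub>L m a z))
        = ?sf (lmul (to_slice J (w - z)) o\<^sub>L m z w)"
      using zw True by (simp add: linear_simps(2) [OF bl] sf)
  qed
  obtain C where C: "\<And>z. norm (lmul (to_slice J z) :: 'a qop) \<le> norm z * C"
    using bounded_linear.bounded [OF bounded_linear_lmul_slice [OF J]] by blast
  show thesis
  proof (rule that)
    fix z assume z: "z \<in> ?B"
    then obtain e where e: "e > 0" "ball z e \<subseteq> ?B" by (meson openE open_ball)
    show "((\<lambda>w. lmul (to_slice J (w - a)) o\<^sub>L m a w) has_derivative (\<lambda>h. lmul (to_slice J h) o\<^sub>L F z)) (at z)"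
    proof (rule has_derivativeI_sandwich [OF e(1)])
      show "bounded_linear (\<lambda>h. lmul (to_slice J h) o\<^sub>L F z)"
        by (rule bounded_linear_compose [OF bounded_linear_compose_op(1)
              bounded_linear_lmul_slice [OF J]])
      fix w assume "w \<noteq> z" "dist w z < e"
      then have w: "w \<in> ?B" by (intro subsetD [OF e(2)]) (simp add: dist_commute)
      have "(lmul (to_slice J (w - a)) o\<^sub>L m a w) - (lmul (to_slice J (z - a)) o\<^sub>L m a z)
          - (lmul (to_slice J (w - z)) o\<^sub>L F z) = lmul (to_slice J (w - z)) o\<^sub>L (m z w - F z)"
        unfolding key [OF z w] by (simp add: compose_simps)
      then have "norm ((lmul (to_slice J (w - a)) o\<^sub>L m a w) - (lmul (to_slice J (z - a)) o\<^sub>L m a z)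
          - (lmul (to_slice J (w - z)) o\<^sub>L F z)) \<le> norm (w - z) * C * norm (m z w - F z)"
        using order_trans [OF norm_blinfun_compose mult_right_mono [OF C norm_ge_zero]] by (simp only:)
      then show "norm ((lmul (to_slice J (w - a)) o\<^sub>L m a w) - (lmul (to_slice J (z - a)) o\<^sub>L m a z)
          - (lmul (to_slice J (w - z)) o\<^sub>L F z)) / norm (w - z) \<le> C * norm (m z w - F z)"
        using \<open>w \<noteq> z\<close> by (simp add: divide_simps mult_ac)
    next
      have "Pair z ` ?B \<subseteq> ?B \<times> ?B" using z by auto
      then have "continuous_on ?B (m z)"
        using continuous_on_compose2 [OF contm continuous_on_Pair [OF continuous_on_const continuous_on_id], of z ?B]
        by simp
      then have "(m z \<longlongrightarrow> m z z) (at z)"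
        using z by (simp add: continuous_on_eq_continuous_at isCont_def)
      then have "((\<lambda>w. C * norm (m z w - F z)) \<longlongrightarrow> C * norm (m z z - F z)) (at z)"
        by (intro tendsto_intros)
      then show "((\<lambda>w. C * norm (m z w - F z)) \<longlongrightarrow> 0) (at z)" by (simp add: mz)
    qed
  qed
qed

lemma op_integrable:
  assumes S: "open S" and F: "slice_holomorphic_on J F S" and \<gamma>: "valid_path \<gamma>" "path_image \<gamma> \<subseteq> S"
  shows "(\<lambda>t. lmul (to_slice J (vector_derivative \<gamma> (at t within {0..1}))) o\<^sub>L F (\<gamma> t)) integrable_on {0..1}"
proof -
  obtain K where K: "finite K" "\<gamma> C1_differentiable_on {0..1} - K" and cont: "continuous_on {0..1} \<gamma>"
    using \<gamma>(1) unfolding valid_path_def piecewise_C1_differentiable_on_def by blast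
  let ?h = "\<lambda>t. lmul (to_slice J (vector_derivative \<gamma> (at t))) o\<^sub>L F (\<gamma> t)"
  have "?h integrable_on cbox 0 1"
  proof (rule integrable_on_little_subintervals, rule ballI)
    fix x :: real assume x: "x \<in> cbox 0 1"
    then have "\<gamma> x \<in> S" using \<gamma>(2) by (auto simp: path_image_def)
    then obtain r where r: "r > 0" "ball (\<gamma> x) r \<subseteq> S" by (meson S openE)
    obtain G where G: "\<And>z. z \<in> ball (\<gamma> x) r \<Longrightarrow> (G has_derivative (\<lambda>h. lmul (to_slice J h) o\<^sub>L F z)) (at z)"
      using slice_holomorphic_local_primitive [OF slice_holomorphic_on_subset [OF F r(2)]] by blast
    obtain d where d: "d > 0" "\<And>y. y \<in> {0..1} \<Longrightarrow> dist y x < d \<Longrightarrow> dist (\<gamma> y) (\<gamma> x) < r"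
      using cont x r(1) unfolding continuous_on_iff by (metis interval_cbox)
    show "\<exists>d>0. \<forall>u v. x \<in> cbox u v \<and> cbox u v \<subseteq> ball x d \<and> cbox u v \<subseteq> cbox 0 1 \<longrightarrow> ?h integrable_on cbox u v"
    proof (intro exI [of _ d] conjI allI impI \<open>d > 0\<close>)
      fix u v assume uv: "x \<in> cbox u v \<and> cbox u v \<subseteq> ball x d \<and> cbox u v \<subseteq> cbox 0 1"
      then have "u \<le> v" by auto
      have g: "\<gamma> t \<in> ball (\<gamma> x) r" if "t \<in> {u..v}" for t
        using d(2) [of t] uv that by (auto simp: subset_iff dist_commute)
      have "(?h has_integral (G \<circ> \<gamma>) v - (G \<circ> \<gamma>) u) {u..v}"
      proof (rule fundamental_theorem_of_calculus_interior_strong [OF \<open>finite K\<close> \<open>u \<le> v\<close>])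
        have "continuous_on (ball (\<gamma> x) r) G"
          using G by (intro has_derivative_continuous_on) (auto intro: has_derivative_at_withinI)
        moreover have "{u..v} \<subseteq> {0..1}" using uv by simp
        then have "continuous_on {u..v} \<gamma>" by (rule continuous_on_subset [OF cont])
        ultimately show "continuous_on {u..v} (G \<circ> \<gamma>)"
          unfolding o_def by (rule continuous_on_compose2) (use g in blast)
        fix t assume t: "t \<in> {u<..<v} - K"
        then have "t \<in> {0..1} - K" using uv by (auto simp: subset_iff)
        then have "\<gamma> differentiable at t" using K(2) by (meson C1_differentiable_on_eq)
        then have "(\<gamma> has_derivative (\<lambda>s. s *\<^sub>R vector_derivative \<gamma> (at t))) (at t)"
          by (simp add: vector_derivative_works has_vector_derivative_def)
        then have "((\<lambda>t. G (\<gamma> t)) has_derivative (\<lambda>s. lmul (to_slice J (s *\<^sub>R vector_derivative \<gamma> (at t))) o\<^sub>L F (\<gamma> t))) (at t)"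
          by (rule has_derivative_compose [OF _ G]) (use g t in auto)
        then show "((G \<circ> \<gamma>) has_vector_derivative ?h t) (at t)"
          by (simp add: has_vector_derivative_def o_def to_slice_scaleR [OF J] lmul_scaleR compose_simps)
      qed
      then show "?h integrable_on cbox u v" by (auto simp: integrable_on_def)
    qed
  qed
  then have h: "?h integrable_on {0..1}" by simp
  \<comment> \<open>Only at the two endpoints can the derivative within the interval differ from the
    two-sided one.\<close>
  have vd: "vector_derivative \<gamma> (at t within {0..1}) = vector_derivative \<gamma> (at t)"
    if "t \<in> {0..1} - {0, 1}" for t
  proof -
    have "t \<in> interior {0..1}" using that by auto
    then show ?thesis by (simp only: at_within_interior)
  qed
  show ?thesis
  proof (rule integrable_spike_finite [OF _ _ h])
    show "finite {0, 1 :: real}" by simp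
  qed (simp only: vd)
qed

lemma op_integral_compose:
  assumes S: "open S" "slice_holomorphic_on J F S" "valid_path \<gamma>" "path_image \<gamma> \<subseteq> S"
  shows "op_integral J \<gamma> (\<lambda>z. F z o\<^sub>L C) = op_integral J \<gamma> F o\<^sub>L C"
proof -
  have bl: "bounded_linear (\<lambda>X. X o\<^sub>L C)"
    by (rule bounded_linear_compose_op(1))
  show ?thesis
    using integral_linear [OF op_integrable [OF S] bl]
    by (simp add: op_integral_def o_def compose_simps(1))
qed

lemma slice_functional_op_integral:
  assumes S: "open S" "slice_holomorphic_on J F S" "valid_path \<gamma>" "path_image \<gamma> \<subseteq> S"
    and \<phi>: "bounded_linear \<phi>"
  shows "slice_functional J \<phi> (op_integral J \<gamma> F) = contour_integral \<gamma> (\<lambda>z. slice_functional J \<phi> (F z))"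
proof -
  have bl: "bounded_linear (slice_functional J \<phi>)" by (rule bounded_linear_slice_functional [OF J \<phi>])
  have "((\<lambda>z. slice_functional J \<phi> (F z)) has_contour_integral slice_functional J \<phi> (op_integral J \<gamma> F)) \<gamma>"
    using has_integral_linear [OF integrable_integral [OF op_integrable [OF S]] bl]
    by (simp add: has_contour_integral_def op_integral_def o_def slice_functional_slice [OF J \<phi>] mult.commute)
  then show ?thesis by (simp add: contour_integral_unique)
qed

end

section \<open>Rules for operator-valued integrals\<close>

lemma integral_sandwich_sum:
  fixes F :: "'k \<Rightarrow> real \<Rightarrow> 'b::banach \<Rightarrow>\<^sub>L 'b"
  assumes "\<And>k. k \<in> K \<Longrightarrow> F k integrable_on S" and "finite K"
  shows "integral S (\<lambda>t. \<Sum>k\<in>K. A k o\<^sub>L F k t o\<^sub>L B k) = (\<Sum>k\<in>K. A k o\<^sub>L integral S (F k) o\<^sub>L B k)"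
    and "(\<lambda>t. \<Sum>k\<in>K. A k o\<^sub>L F k t o\<^sub>L B k) integrable_on S"
proof -
  have bl: "bounded_linear (\<lambda>X. A k o\<^sub>L X o\<^sub>L B k)" for k
    using bounded_linear_compose [OF bounded_linear_compose_op(1)
        bounded_linear_compose_op(2)] .
  have "((\<lambda>t. A k o\<^sub>L F k t o\<^sub>L B k) has_integral (A k o\<^sub>L integral S (F k) o\<^sub>L B k)) S" if "k \<in> K" for k
    using has_integral_linear [OF integrable_integral [OF assms(1) [OF that]] bl] by (simp add: o_def)
  then have h: "((\<lambda>t. \<Sum>k\<in>K. A k o\<^sub>L F k t o\<^sub>L B k) has_integral (\<Sum>k\<in>K. A k o\<^sub>L integral S (F k) o\<^sub>L B k)) S"
    by (rule has_integral_sum [OF \<open>finite K\<close>])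
  show "integral S (\<lambda>t. \<Sum>k\<in>K. A k o\<^sub>L F k t o\<^sub>L B k) = (\<Sum>k\<in>K. A k o\<^sub>L integral S (F k) o\<^sub>L B k)"
    by (rule integral_unique [OF h])
  show "(\<lambda>t. \<Sum>k\<in>K. A k o\<^sub>L F k t o\<^sub>L B k) integrable_on S"
    by (rule has_integral_integrable [OF h])
qed

text \<open>An operator that intertwines two complex structures carries integrals in one slice to
  integrals in the other. With \<open>J' = J\<close> this is commutation; with different units it
  compares slices.\<close>

lemma op_integral_compose_left:
  assumes J: "J \<in> imag_units" and "J' \<in> imag_units"
    and F: "open S" "slice_holomorphic_on J F S" "valid_path \<gamma>" "path_image \<gamma> \<subseteq> S"
    and C: "\<And>z. (C :: 'a::banach qop) o\<^sub>L lmul (to_slice J z) = lmul (to_slice J' z) o\<^sub>L C"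
  shows "C o\<^sub>L op_integral J \<gamma> F = op_integral J' \<gamma> (\<lambda>z. C o\<^sub>L F z)"
proof -
  have bl: "bounded_linear ((o\<^sub>L) C)"
    by (rule bounded_linear_compose_op(2))
  have "C o\<^sub>L (lmul (to_slice J z) o\<^sub>L X) = lmul (to_slice J' z) o\<^sub>L (C o\<^sub>L X)" for z and X :: "'a qop"
    by (simp add: C flip: compose_simps(1))
  then show ?thesis
    using integral_linear [OF op_integrable [OF J F] bl]
    by (simp add: op_integral_def o_def)
qed

lemma slice_holomorphic_on_add:
  assumes "J \<in> imag_units" "slice_holomorphic_on J F S" "slice_holomorphic_on J G S"
  shows "slice_holomorphic_on J (\<lambda>z. F z + G z) S"
  using assms unfolding slice_holomorphic_on_def
  by (auto intro!: continuous_intros holomorphic_intros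
      simp: linear_simps(1) [OF bounded_linear_slice_functional [OF assms(1)]])

lemma slice_holomorphic_on_compose_right:
  assumes "slice_holomorphic_on J F S"
  shows "slice_holomorphic_on J (\<lambda>z. F z o\<^sub>L C) S"
  unfolding slice_holomorphic_on_def
proof (intro conjI allI impI)
  show "continuous_on S (\<lambda>z. F z o\<^sub>L C)"
    using assms unfolding slice_holomorphic_on_def
    by (intro bounded_linear.continuous_on [OF bounded_linear_compose_op(1)]) simp
  fix \<phi> :: "'a qop \<Rightarrow> real" assume "bounded_linear \<phi>"
  then have "bounded_linear (\<lambda>X. \<phi> (X o\<^sub>L C))" by (rule bounded_linear_compose_functional)
  then show "(\<lambda>z. slice_functional J \<phi> (F z o\<^sub>L C)) holomorphic_on S"
    unfolding slice_functional_compose_right using assms by (simp add: slice_holomorphic_on_def)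
qed

lemma op_integral_add:
  assumes J: "J \<in> imag_units" and S: "open S" "valid_path \<gamma>" "path_image \<gamma> \<subseteq> S"
    and F: "slice_holomorphic_on J F S" "slice_holomorphic_on J G S"
  shows "op_integral J \<gamma> (\<lambda>z. F z + G z) = op_integral J \<gamma> F + op_integral J \<gamma> G"
  using integral_add [OF op_integrable [OF J S(1) F(1) S(2,3)] op_integrable [OF J S(1) F(2) S(2,3)]]
  by (simp add: op_integral_def compose_simps)

lemma op_integral_cong:
  assumes "\<And>z. z \<in> path_image \<gamma> \<Longrightarrow> F z = G z"
  shows "op_integral J \<gamma> F = op_integral J \<gamma> G"
  unfolding op_integral_def
  by (rule integral_cong) (simp add: assms path_image_def)

text \<open>Replacing \<open>J\<close> by \<open>- J\<close> conjugates the plane, so the path can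
  be conjugated instead. The derivatives match off the endpoints and the finitely many exceptional
  points.\<close>

lemma op_integral_cnj:
  assumes J: "J \<in> imag_units" and \<gamma>: "valid_path \<gamma>"
  shows "op_integral (- J) \<gamma> F = op_integral J (cnj \<circ> \<gamma>) (\<lambda>z. F (cnj z))"
proof -
  obtain K where K: "finite K" "\<gamma> C1_differentiable_on {0..1} - K"
    using \<gamma> unfolding valid_path_def piecewise_C1_differentiable_on_def by blast
  show ?thesis
    unfolding op_integral_def
  proof (rule integral_spike)
    show "negligible (insert 0 (insert 1 K))" using K(1) by (simp add: negligible_finite)
    fix t assume t: "t \<in> {0..1} - insert 0 (insert 1 K)"
    then have d: "\<gamma> differentiable at t" using K(2) by (meson C1_differentiable_on_eq Diff_iff insert_iff)
    have "t \<in> interior {0..1}" using t by auto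
    then have "at t within {0..1} = at t" by (rule at_within_interior)
    then show "lmul (to_slice J (vector_derivative (cnj \<circ> \<gamma>) (at t within {0..1}))) o\<^sub>L F (cnj ((cnj \<circ> \<gamma>) t)) =
        lmul (to_slice (- J) (vector_derivative \<gamma> (at t within {0..1}))) o\<^sub>L F (\<gamma> t)"
      using vector_derivative_cnj [OF d] by (simp add: to_slice_minus_unit [OF J] o_def)
  qed
qed

text \<open>Under each functional this is the scalar Cauchy theorem for the first family minus
  \<open>r\<close> times the second, indexed by the disjoint sum. The value 1 of \<open>r\<close>
  compares two contours, the value -1 expresses reversal of orientation.\<close>

lemma op_integral_homologous:
  fixes \<alpha> :: "'i \<Rightarrow> real \<Rightarrow> complex" and \<beta> :: "'j \<Rightarrow> real \<Rightarrow> complex" and r :: real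
  assumes J: "J \<in> imag_units" and fin: "finite A" "finite B"
    and S: "open S" "slice_holomorphic_on J F S"
    and \<alpha>: "\<And>i. i \<in> A \<Longrightarrow> valid_path (\<alpha> i) \<and> pathfinish (\<alpha> i) = pathstart (\<alpha> i) \<and> path_image (\<alpha> i) \<subseteq> S"
    and \<beta>: "\<And>i. i \<in> B \<Longrightarrow> valid_path (\<beta> i) \<and> pathfinish (\<beta> i) = pathstart (\<beta> i) \<and> path_image (\<beta> i) \<subseteq> S"
    and eq: "\<And>w. w \<notin> S \<Longrightarrow> (\<Sum>i\<in>A. winding_number (\<alpha> i) w) = of_real r * (\<Sum>i\<in>B. winding_number (\<beta> i) w)"
  shows "(\<Sum>i\<in>A. op_integral J (\<alpha> i) F) = r *\<^sub>R (\<Sum>i\<in>B. op_integral J (\<beta> i) F)"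
proof (rule blinfun_eqI_slice_functional)
  fix \<phi> :: "'a qop \<Rightarrow> real" assume \<phi>: "bounded_linear \<phi>"
  let ?f = "\<lambda>z. slice_functional J \<phi> (F z)"
  have bl: "bounded_linear (slice_functional J \<phi>)" by (rule bounded_linear_slice_functional [OF J \<phi>])
  have sum: "slice_functional J \<phi> (sum h I) = (\<Sum>i\<in>I. slice_functional J \<phi> (h i))" for h :: "'z \<Rightarrow> _" and I
    using linear_sum [OF bounded_linear.linear [OF bl]] by simp
  have sc: "slice_functional J \<phi> (r *\<^sub>R X) = of_real r * slice_functional J \<phi> X" for X
    by (simp add: linear_simps(5) [OF bl] scaleR_conv_of_real)
  have "(\<Sum>k\<in>A <+> B. case_sum (\<lambda>_. 1) (\<lambda>_. - of_real r) k * contour_integral (case_sum \<alpha> \<beta> k) ?f) = 0"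
  proof (rule Cauchy_theorem_cycle [OF _ S(1)])
    show "?f holomorphic_on S" using S(2) \<phi> by (simp add: slice_holomorphic_on_def)
    show "(\<Sum>k\<in>A <+> B. case_sum (\<lambda>_. 1) (\<lambda>_. - of_real r) k * winding_number (case_sum \<alpha> \<beta> k) w) = 0"
      if "w \<notin> S" for w
      using eq [OF that] fin by (simp add: sum.Plus sum_negf sum_distrib_left)
    show "valid_path (case_sum \<alpha> \<beta> k) \<and> pathfinish (case_sum \<alpha> \<beta> k) = pathstart (case_sum \<alpha> \<beta> k)
        \<and> path_image (case_sum \<alpha> \<beta> k) \<subseteq> S" if "k \<in> A <+> B" for k
      using that by (elim PlusE) (simp_all add: \<alpha> \<beta>)
  qed (use fin in simp)
  then have "(\<Sum>i\<in>A. contour_integral (\<alpha> i) ?f) = of_real r * (\<Sum>i\<in>B. contour_integral (\<beta> i) ?f)"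
    using fin by (simp add: sum.Plus sum_negf sum_distrib_left)
  then show "slice_functional J \<phi> (\<Sum>i\<in>A. op_integral J (\<alpha> i) F)
      = slice_functional J \<phi> (r *\<^sub>R (\<Sum>i\<in>B. op_integral J (\<beta> i) F))"
    unfolding sc sum using \<alpha> \<beta> by (simp add: slice_functional_op_integral [OF J S _ _ \<phi>])
qed

section \<open>The kernel as a holomorphic function\<close>

context commuting_operator
begin

definition Q_resolvent :: "quat \<Rightarrow> complex \<Rightarrow> 'a qop" where
  "Q_resolvent J z = op_inv (Qc (to_slice J z) T)"

lemma Qc_commute:
  assumes J: "J \<in> imag_units" and C: "C o\<^sub>L tr = tr o\<^sub>L C" "C o\<^sub>L nm = nm o\<^sub>L C"
    and CL: "C o\<^sub>L lmul (to_slice J z) = lmul (to_slice K z) o\<^sub>L C" and K: "K \<in> imag_units"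
  shows "C o\<^sub>L Qc (to_slice J z) T = Qc (to_slice K z) T o\<^sub>L C"
proof -
  have l: "C o\<^sub>L (lmul (to_slice J z) o\<^sub>L X) = lmul (to_slice K z) o\<^sub>L (C o\<^sub>L X)" for X :: "'a qop"
    by (simp add: CL flip: compose_simps(1))
  show ?thesis by (simp add: Qc_slice J K compose_simps l CL C)
qed

text \<open>\<open>tr\<close> and \<open>nm\<close> are the same in all slices, so an operator that
  commutes with them and moves the slice variable from \<open>J\<close> to \<open>K\<close> moves
  \<open>Qc\<close>, and hence its inverse.\<close>

lemma Q_resolvent_intertwine:
  assumes J: "J \<in> imag_units" and K: "K \<in> imag_units" and z: "z \<in> resolvent_plane"
    and C: "C o\<^sub>L tr = tr o\<^sub>L C" "C o\<^sub>L nm = nm o\<^sub>L C"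
    and CL: "C o\<^sub>L lmul (to_slice J z) = lmul (to_slice K z) o\<^sub>L C"
  shows "C o\<^sub>L Q_resolvent J z = Q_resolvent K z o\<^sub>L C"
proof -
  note iJ = op_inv_inverse [OF Qc_invertible [OF J z]] and iK = op_inv_inverse [OF Qc_invertible [OF K z]]
  have "C o\<^sub>L Q_resolvent J z = (Q_resolvent K z o\<^sub>L Qc (to_slice K z) T) o\<^sub>L (C o\<^sub>L Q_resolvent J z)"
    by (simp add: Q_resolvent_def iK compose_simps(10))
  also have "\<dots> = Q_resolvent K z o\<^sub>L ((Qc (to_slice K z) T o\<^sub>L C) o\<^sub>L Q_resolvent J z)"
    by (simp add: compose_simps(1))
  also have "Qc (to_slice K z) T o\<^sub>L C = C o\<^sub>L Qc (to_slice J z) T"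
    by (rule Qc_commute [OF J C CL K, symmetric])
  finally show ?thesis by (simp add: Q_resolvent_def iJ compose_simps)
qed

lemma Q_resolvent_commute:
  assumes "J \<in> imag_units" "z \<in> resolvent_plane" 
  shows "lmul (to_slice J w) o\<^sub>L Q_resolvent J z = Q_resolvent J z o\<^sub>L lmul (to_slice J w)"
    "tr o\<^sub>L Q_resolvent J z = Q_resolvent J z o\<^sub>L tr"
    "R \<in> parts \<Longrightarrow> ext_op R o\<^sub>L Q_resolvent J z = Q_resolvent J z o\<^sub>L ext_op R"
proof -
  have "to_slice J w * to_slice J z = to_slice J z * to_slice J w"
    by (simp add: mult.commute flip: to_slice_mult [OF assms(1)])
  then show "lmul (to_slice J w) o\<^sub>L Q_resolvent J z = Q_resolvent J z o\<^sub>L lmul (to_slice J w)"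
    by (intro Q_resolvent_intertwine [OF assms(1,1,2)]) (simp_all add: tr_lmul nm_lmul flip: lmul_mult)
  show "tr o\<^sub>L Q_resolvent J z = Q_resolvent J z o\<^sub>L tr"
    by (intro Q_resolvent_intertwine [OF assms(1,1,2)]) (simp_all add: tr_lmul tr_nm)
  show "ext_op R o\<^sub>L Q_resolvent J z = Q_resolvent J z o\<^sub>L ext_op R" if "R \<in> parts"
    using that
    by (intro Q_resolvent_intertwine [OF assms(1,1,2)]) (simp_all add: ext_op_tr ext_op_nm ext_op_lmul_commute)
qed

text \<open>In the difference of the two quadratic polynomials \<open>nm\<close> cancels, and the
  rest factors as w - z times w + z - \<open>tr\<close>. This replaces the usual resolvent equation,
  whose second factor would be absent.\<close>

lemma Q_resolvent_equation:
  assumes J: "J \<in> imag_units" and z: "z \<in> resolvent_plane" and w: "w \<in> resolvent_plane"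
  shows "Q_resolvent J z - Q_resolvent J w
    = lmul (to_slice J (w - z)) o\<^sub>L ((lmul (to_slice J (w + z)) - tr) o\<^sub>L (Q_resolvent J z o\<^sub>L Q_resolvent J w))"
proof -
  let ?l = "\<lambda>z. lmul (to_slice J z) :: 'a qop"
  have lz: "?l w o\<^sub>L ?l z = ?l z o\<^sub>L ?l w"
    by (simp add: mult.commute flip: lmul_mult to_slice_mult [OF J])
  have lq: "Q_resolvent J z o\<^sub>L (?l y o\<^sub>L X) = ?l y o\<^sub>L (Q_resolvent J z o\<^sub>L X)"
    "Q_resolvent J z o\<^sub>L (tr o\<^sub>L X) = tr o\<^sub>L (Q_resolvent J z o\<^sub>L X)" for y and X :: "'a qop"
    by (simp_all add: Q_resolvent_commute [OF J z] flip: compose_simps(1))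
  have "Q_resolvent J z - Q_resolvent J w
      = Q_resolvent J z o\<^sub>L (Qc (to_slice J w) T - Qc (to_slice J z) T) o\<^sub>L Q_resolvent J w"
    unfolding Q_resolvent_def by (rule op_inv_difference [OF Qc_invertible [OF J z] Qc_invertible [OF J w]])
  then show ?thesis
    by (simp add: Qc_slice [OF J] to_slice_diff [OF J] to_slice_add [OF J] lmul_diff lmul_add
        compose_simps lq lz)
      (simp add: lz flip: compose_simps(1))
qed

lemma tendsto_Q_resolvent:
  assumes J: "J \<in> imag_units" and w: "w \<in> resolvent_plane"
  shows "(Q_resolvent J \<longlongrightarrow> Q_resolvent J w) (at w)"
  unfolding Q_resolvent_def
proof (rule tendsto_op_inv [OF _ Qc_invertible [OF J w]])
  have l: "((\<lambda>z. lmul (to_slice J z) :: 'a qop) \<longlongrightarrow> lmul (to_slice J w)) (at w)"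
    by (rule bounded_linear.tendsto [OF bounded_linear_lmul_slice [OF J] tendsto_ident_at])
  show "((\<lambda>z. Qc (to_slice J z) T) \<longlongrightarrow> Qc (to_slice J w) T) (at w)"
    unfolding Qc_slice [OF J]
    by (intro tendsto_intros bounded_bilinear.tendsto [OF bounded_bilinear_blinfun_compose] l)
  have "\<forall>\<^sub>F z in at w. z \<in> resolvent_plane"
    using open_resolvent_plane w by (rule eventually_at_in_open')
  then show "\<forall>\<^sub>F z in at w. op_invertible (Qc (to_slice J z) T)"
    by eventually_elim (rule Qc_invertible [OF J])
qed

text \<open>Dividing the resolvent equation by \<open>z - w\<close> and letting \<open>z\<close>
  tend to \<open>w\<close> gives the derivative, once continuity of inversion is known.\<close>

lemma slice_holomorphic_Q_resolvent:
  assumes J: "J \<in> imag_units"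
  shows "slice_holomorphic_on J (Q_resolvent J) resolvent_plane"
  unfolding slice_holomorphic_on_def
proof (intro conjI allI impI)
  show "continuous_on resolvent_plane (Q_resolvent J)"
    unfolding continuous_on_def using tendsto_Q_resolvent [OF J] tendsto_within_subset by blast
  fix \<phi> :: "'a qop \<Rightarrow> real" assume \<phi>: "bounded_linear \<phi>"
  let ?sf = "slice_functional J \<phi>"
  have bl: "bounded_linear ?sf" by (rule bounded_linear_slice_functional [OF J \<phi>])
  have "((\<lambda>z. ?sf (Q_resolvent J z)) has_field_derivative
      - ?sf ((lmul (to_slice J (w + w)) - tr) o\<^sub>L (Q_resolvent J w o\<^sub>L Q_resolvent J w))) (at w)"
    if w: "w \<in> resolvent_plane" for w
    unfolding has_field_derivative_iff
  proof (rule Lim_transform_eventually)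
    have l: "((\<lambda>z. lmul (to_slice J (w + z)) :: 'a qop) \<longlongrightarrow> lmul (to_slice J (w + w))) (at w)"
      by (intro bounded_linear.tendsto [OF bounded_linear_lmul_slice [OF J]] tendsto_intros)
    show "((\<lambda>z. - ?sf ((lmul (to_slice J (w + z)) - tr) o\<^sub>L (Q_resolvent J z o\<^sub>L Q_resolvent J w))) \<longlongrightarrow>
        - ?sf ((lmul (to_slice J (w + w)) - tr) o\<^sub>L (Q_resolvent J w o\<^sub>L Q_resolvent J w))) (at w)"
      by (intro tendsto_minus bounded_linear.tendsto [OF bl] bounded_bilinear.tendsto [OF bounded_bilinear_blinfun_compose]
          tendsto_diff tendsto_const l tendsto_Q_resolvent [OF J w])
    have "\<forall>\<^sub>F z in at w. z \<in> resolvent_plane \<and> z \<noteq> w"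
      using eventually_at_in_open' [OF open_resolvent_plane w] eventually_neq_at_within
      by (rule eventually_conj)
    then show "\<forall>\<^sub>F z in at w. - ?sf ((lmul (to_slice J (w + z)) - tr) o\<^sub>L (Q_resolvent J z o\<^sub>L Q_resolvent J w))
        = (?sf (Q_resolvent J z) - ?sf (Q_resolvent J w)) / (z - w)"
    proof eventually_elim
      case (elim z)
      have "?sf (Q_resolvent J z) - ?sf (Q_resolvent J w) = ?sf (Q_resolvent J z - Q_resolvent J w)"
        by (simp add: linear_simps(2) [OF bl])
      also have "\<dots> = (w - z) * ?sf ((lmul (to_slice J (w + z)) - tr) o\<^sub>L (Q_resolvent J z o\<^sub>L Q_resolvent J w))"
        using elim by (simp only: Q_resolvent_equation [OF J _ w] slice_functional_slice [OF J \<phi>])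
      finally show ?case using elim by (simp add: field_simps)
    qed
  qed
  then show "(\<lambda>z. ?sf (Q_resolvent J z)) holomorphic_on resolvent_plane"
    by (auto simp: holomorphic_on_def field_differentiable_def intro: has_field_derivative_at_within)
qed

end

section \<open>The calculus for intrinsic functions\<close>

text \<open>A pair of real components, even and odd in \<open>v\<close>, amounts to a single complex
  function that respects conjugation; the Cauchy-Riemann equations make it holomorphic. One such
  function represents an intrinsic function in all slices at once.\<close>

definition intrinsic_on :: "complex set \<Rightarrow> (complex \<Rightarrow> complex) \<Rightarrow> bool" where
  "intrinsic_on D f \<longleftrightarrow> open D \<and> f holomorphic_on D \<and> (\<forall>z\<in>D. cnj z \<in> D \<and> f (cnj z) = cnj (f z))"

lemma intrinsic_on_mult:
  "intrinsic_on D f \<Longrightarrow> intrinsic_on E g \<Longrightarrow> intrinsic_on (D \<inter> E) (\<lambda>z. f z * g z)"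
  unfolding intrinsic_on_def
  by (auto intro!: holomorphic_on_mult intro: holomorphic_on_subset)

lemma intrinsic_on_times_ident: "intrinsic_on D f \<Longrightarrow> intrinsic_on D (\<lambda>z. z * f z)"
  unfolding intrinsic_on_def by (auto intro!: holomorphic_intros)

context commuting_operator
begin

text \<open>The homological content of an admissible contour: winding number one about the spectrum,
  zero about points outside the domain. Unlike a boundary of a region, this notion passes to a
  larger domain unchanged, so a contour for the product also serves for each factor.\<close>

definition resolvent_cycle :: "complex set \<Rightarrow> (real \<Rightarrow> complex) set \<Rightarrow> bool" where
  "resolvent_cycle D \<Gamma> \<longleftrightarrow> finite \<Gamma> \<and>
    (\<forall>\<gamma>\<in>\<Gamma>. valid_path \<gamma> \<and> pathfinish \<gamma> = pathstart \<gamma> \<and> path_image \<gamma> \<subseteq> D \<inter> resolvent_plane) \<and>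
    (\<forall>z. z \<notin> resolvent_plane \<longrightarrow> z \<in> D \<and> (\<Sum>\<gamma>\<in>\<Gamma>. winding_number \<gamma> z) = 1) \<and>
    (\<forall>z. z \<notin> D \<longrightarrow> (\<Sum>\<gamma>\<in>\<Gamma>. winding_number \<gamma> z) = 0)"

lemma resolvent_cycleD:
  assumes "resolvent_cycle D \<Gamma>"
  shows "finite \<Gamma>" "\<gamma> \<in> \<Gamma> \<Longrightarrow> valid_path \<gamma>" "\<gamma> \<in> \<Gamma> \<Longrightarrow> pathfinish \<gamma> = pathstart \<gamma>"
    "\<gamma> \<in> \<Gamma> \<Longrightarrow> path_image \<gamma> \<subseteq> D \<inter> resolvent_plane"
    "z \<notin> resolvent_plane \<Longrightarrow> z \<in> D" "z \<notin> resolvent_plane \<Longrightarrow> (\<Sum>\<gamma>\<in>\<Gamma>. winding_number \<gamma> z) = 1"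
    "z \<notin> D \<Longrightarrow> (\<Sum>\<gamma>\<in>\<Gamma>. winding_number \<gamma> z) = 0"
  using assms by (simp_all add: resolvent_cycle_def)

lemma resolvent_cycle_mono:
  assumes "resolvent_cycle D \<Gamma>" "D \<subseteq> D'"
  shows "resolvent_cycle D' \<Gamma>"
  unfolding resolvent_cycle_def
proof (intro conjI ballI allI impI)
  show "path_image \<gamma> \<subseteq> D' \<inter> resolvent_plane" if "\<gamma> \<in> \<Gamma>" for \<gamma>
    using resolvent_cycleD(4) [OF assms(1) that] assms(2) by auto
  show "(\<Sum>\<gamma>\<in>\<Gamma>. winding_number \<gamma> z) = 0" if "z \<notin> D'" for z
    by (rule resolvent_cycleD(7) [OF assms(1)]) (use that assms(2) in auto)
  show "z \<in> D'" if "z \<notin> resolvent_plane" for z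
    using resolvent_cycleD(5) [OF assms(1) that] assms(2) by auto
qed (simp_all add: resolvent_cycleD [OF assms(1)])

definition Q_integral :: "quat \<Rightarrow> (real \<Rightarrow> complex) set \<Rightarrow> (complex \<Rightarrow> complex) \<Rightarrow> 'a qop" where
  "Q_integral J \<Gamma> f = (\<Sum>\<gamma>\<in>\<Gamma>. op_integral J \<gamma> (\<lambda>z. lmul (to_slice J (f z)) o\<^sub>L Q_resolvent J z))"

text \<open>For intrinsic \<open>f\<close> this is \<open>- (\<D> f)(T) / 2\<close>.\<close>

definition Q_calc :: "quat \<Rightarrow> (real \<Rightarrow> complex) set \<Rightarrow> (complex \<Rightarrow> complex) \<Rightarrow> 'a qop" where
  "Q_calc J \<Gamma> f = (1 / (2 * pi)) *\<^sub>R (Q_integral J \<Gamma> f o\<^sub>L lmul (- J))"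

lemma slice_holomorphic_kernel:
  assumes "J \<in> imag_units" "f holomorphic_on S" "S \<subseteq> resolvent_plane"
  shows "slice_holomorphic_on J (\<lambda>z. lmul (to_slice J (f z)) o\<^sub>L Q_resolvent J z) S"
  using slice_holomorphic_on_subset [OF slice_holomorphic_Q_resolvent [OF assms(1)] assms(3)]
  by (intro slice_holomorphic_on_lmul assms)

lemma open_inter_resolvent: "open D \<Longrightarrow> open (D \<inter> resolvent_plane)"
  using open_resolvent_plane by (rule open_Int [rotated])

text \<open>A point where the integrand is not controlled is either in the spectrum, where both
  cycles wind once, or outside \<open>D\<close>, where neither winds.\<close>

lemma Q_integral_cycle_independent:
  assumes J: "J \<in> imag_units" and D: "open D" "f holomorphic_on D"
    and \<Gamma>: "resolvent_cycle D \<Gamma>" "resolvent_cycle D \<Gamma>'"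
  shows "Q_integral J \<Gamma> f = Q_integral J \<Gamma>' f"
proof -
  note d = resolvent_cycleD [OF \<Gamma>(1)] and d' = resolvent_cycleD [OF \<Gamma>(2)]
  have "Q_integral J \<Gamma> f = 1 *\<^sub>R Q_integral J \<Gamma>' f"
    unfolding Q_integral_def
  proof (rule op_integral_homologous [OF J d(1) d'(1) open_inter_resolvent [OF D(1)]])
    show "slice_holomorphic_on J (\<lambda>z. lmul (to_slice J (f z)) o\<^sub>L Q_resolvent J z) (D \<inter> resolvent_plane)"
      using D(2) by (intro slice_holomorphic_kernel J) (auto intro: holomorphic_on_subset)
    fix w assume "w \<notin> D \<inter> resolvent_plane"
    then show "(\<Sum>\<gamma>\<in>\<Gamma>. winding_number \<gamma> w) = of_real 1 * (\<Sum>\<gamma>\<in>\<Gamma>'. winding_number \<gamma> w)"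
      by (cases "w \<in> D") (simp_all add: d d')
  qed (intro conjI d d'; assumption)+
  then show ?thesis by simp
qed

lemma Q_integral_intertwine:
  assumes J: "J \<in> imag_units" and K: "K \<in> imag_units" and D: "open D" "f holomorphic_on D"
    and \<Gamma>: "resolvent_cycle D \<Gamma>"
    and C: "C o\<^sub>L tr = tr o\<^sub>L C" "C o\<^sub>L nm = nm o\<^sub>L C"
    and CL: "\<And>z. C o\<^sub>L lmul (to_slice J z) = lmul (to_slice K z) o\<^sub>L C"
  shows "C o\<^sub>L Q_integral J \<Gamma> f = Q_integral K \<Gamma> f o\<^sub>L C"
proof -
  note d = resolvent_cycleD [OF \<Gamma>]
  let ?S = "D \<inter> resolvent_plane"
  have oS: "open ?S" by (rule open_inter_resolvent [OF D(1)])
  have fS: "f holomorphic_on ?S" using D(2) by (rule holomorphic_on_subset) simp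
  have l: "C o\<^sub>L (lmul (to_slice J z) o\<^sub>L X) = lmul (to_slice K z) o\<^sub>L (C o\<^sub>L X)" for z and X :: "'a qop"
    by (simp add: CL flip: compose_simps(1))
  have "C o\<^sub>L op_integral J \<gamma> (\<lambda>z. lmul (to_slice J (f z)) o\<^sub>L Q_resolvent J z)
      = op_integral K \<gamma> (\<lambda>z. lmul (to_slice K (f z)) o\<^sub>L Q_resolvent K z) o\<^sub>L C" if g: "\<gamma> \<in> \<Gamma>" for \<gamma>
  proof -
    have "C o\<^sub>L op_integral J \<gamma> (\<lambda>z. lmul (to_slice J (f z)) o\<^sub>L Q_resolvent J z)
        = op_integral K \<gamma> (\<lambda>z. C o\<^sub>L (lmul (to_slice J (f z)) o\<^sub>L Q_resolvent J z))"
      by (rule op_integral_compose_left [OF J K oS slice_holomorphic_kernel [OF J fS] d(2) [OF g] d(4) [OF g] CL]) simp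
    also have "\<dots> = op_integral K \<gamma> (\<lambda>z. (lmul (to_slice K (f z)) o\<^sub>L Q_resolvent K z) o\<^sub>L C)"
    proof (rule op_integral_cong)
      fix z assume "z \<in> path_image \<gamma>"
      then have "z \<in> resolvent_plane" using d(4) [OF g] by auto
      then show "C o\<^sub>L (lmul (to_slice J (f z)) o\<^sub>L Q_resolvent J z) = (lmul (to_slice K (f z)) o\<^sub>L Q_resolvent K z) o\<^sub>L C"
        by (simp add: l Q_resolvent_intertwine [OF J K _ C CL] compose_simps(1))
    qed
    also have "\<dots> = op_integral K \<gamma> (\<lambda>z. lmul (to_slice K (f z)) o\<^sub>L Q_resolvent K z) o\<^sub>L C"
      by (rule op_integral_compose [OF K oS slice_holomorphic_kernel [OF K fS] d(2) [OF g] d(4) [OF g]]) simp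
    finally show ?thesis .
  qed
  then show ?thesis by (simp add: Q_integral_def compose_sum)
qed

text \<open>Conjugation of the plane reverses the orientation of a cycle.\<close>

lemma Q_integral_minus_unit:
  assumes J: "J \<in> imag_units" and f: "intrinsic_on D f" and \<Gamma>: "resolvent_cycle D \<Gamma>"
  shows "Q_integral (- J) \<Gamma> f = - Q_integral J \<Gamma> f"
proof -
  note d = resolvent_cycleD [OF \<Gamma>]
  let ?S = "D \<inter> resolvent_plane" and ?F = "\<lambda>z. lmul (to_slice J (f z)) o\<^sub>L Q_resolvent J z"
  have D: "open D" "f holomorphic_on D" and sym: "\<And>z. z \<in> D \<Longrightarrow> cnj z \<in> D \<and> f (cnj z) = cnj (f z)"
    using f by (auto simp: intrinsic_on_def)
  have im: "path_image (cnj \<circ> \<gamma>) \<subseteq> ?S" if "\<gamma> \<in> \<Gamma>" for \<gamma>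
    using d(4) [OF that] sym by (auto simp: path_image_def cnj_resolvent)
  have "Q_integral (- J) \<Gamma> f = (\<Sum>\<gamma>\<in>\<Gamma>. op_integral J (cnj \<circ> \<gamma>) ?F)"
    unfolding Q_integral_def
  proof (rule sum.cong [OF refl])
    fix \<gamma> assume g: "\<gamma> \<in> \<Gamma>"
    have "op_integral (- J) \<gamma> (\<lambda>z. lmul (to_slice (- J) (f z)) o\<^sub>L Q_resolvent (- J) z)
        = op_integral J (cnj \<circ> \<gamma>) (\<lambda>z. lmul (to_slice (- J) (f (cnj z))) o\<^sub>L Q_resolvent (- J) (cnj z))"
      by (rule op_integral_cnj [OF J d(2) [OF g]])
    also have "\<dots> = op_integral J (cnj \<circ> \<gamma>) ?F"
    proof (rule op_integral_cong)
      fix z assume "z \<in> path_image (cnj \<circ> \<gamma>)"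
      then have "z \<in> D" using im [OF g] by auto
      then show "lmul (to_slice (- J) (f (cnj z))) o\<^sub>L Q_resolvent (- J) (cnj z) = ?F z"
        by (simp add: sym to_slice_minus_unit [OF J] Q_resolvent_def)
    qed
    finally show "op_integral (- J) \<gamma> (\<lambda>z. lmul (to_slice (- J) (f z)) o\<^sub>L Q_resolvent (- J) z)
        = op_integral J (cnj \<circ> \<gamma>) ?F" .
  qed
  also have "\<dots> = (- 1) *\<^sub>R (\<Sum>\<gamma>\<in>\<Gamma>. op_integral J \<gamma> ?F)"
  proof (rule op_integral_homologous [OF J d(1) d(1) open_inter_resolvent [OF D(1)]])
    show "slice_holomorphic_on J ?F ?S"
      using D(2) by (intro slice_holomorphic_kernel J) (auto intro: holomorphic_on_subset)
    show "valid_path (cnj \<circ> \<gamma>) \<and> pathfinish (cnj \<circ> \<gamma>) = pathstart (cnj \<circ> \<gamma>) \<and> path_image (cnj \<circ> \<gamma>) \<subseteq> ?S"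
      if "\<gamma> \<in> \<Gamma>" for \<gamma>
      using d(2,3) [OF that] by (intro conjI im [OF that]) (simp_all add: valid_path_cnj pathfinish_compose pathstart_compose)
    fix w assume w: "w \<notin> ?S"
    then have w': "cnj w \<notin> ?S" using sym by (auto simp: cnj_resolvent dest: sym)
    have wn: "winding_number (cnj \<circ> \<gamma>) w = - cnj (winding_number \<gamma> (cnj w))" if "\<gamma> \<in> \<Gamma>" for \<gamma>
    proof -
      have "cnj w \<notin> path_image \<gamma>" using w' d(4) [OF that] by auto
      then show ?thesis
        using winding_number_cnj [of \<gamma> "cnj w"] d(2) [OF that] by (simp add: valid_path_imp_path)
    qed
    have "(\<Sum>\<gamma>\<in>\<Gamma>. winding_number (cnj \<circ> \<gamma>) w) = - cnj (\<Sum>\<gamma>\<in>\<Gamma>. winding_number \<gamma> (cnj w))"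
      by (simp add: wn sum_negf)
    \<comment> \<open>Both the spectrum and the complement of \<open>D\<close> are symmetric under
      conjugation, and the prescribed sums 1 and 0 are real.\<close>
    also have "cnj (\<Sum>\<gamma>\<in>\<Gamma>. winding_number \<gamma> (cnj w)) = (\<Sum>\<gamma>\<in>\<Gamma>. winding_number \<gamma> w)"
    proof (cases "w \<in> D")
      case True
      then have "w \<notin> resolvent_plane" using w by simp
      then show ?thesis by (simp add: d cnj_resolvent)
    next
      case False
      then have "cnj w \<notin> D" using sym [of "cnj w"] by auto
      then show ?thesis using False by (simp add: d)
    qed
    finally show "(\<Sum>\<gamma>\<in>\<Gamma>. winding_number (cnj \<circ> \<gamma>) w) = of_real (- 1) * (\<Sum>\<gamma>\<in>\<Gamma>. winding_number \<gamma> w)"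
      by (simp only: of_real_minus of_real_1 mult_minus_left mult_1)
  qed (intro conjI d; assumption)+
  finally show ?thesis by (simp add: Q_integral_def)
qed

lemma Q_calc_intertwine:
  assumes J: "J \<in> imag_units" and K: "K \<in> imag_units" and f: "intrinsic_on D f"
    and \<Gamma>: "resolvent_cycle D \<Gamma>" and h: "h * J = K * h"
  shows "lmul h o\<^sub>L Q_calc J \<Gamma> f = Q_calc K \<Gamma> f o\<^sub>L lmul h"
proof -
  have "open D" "f holomorphic_on D" using f by (auto simp: intrinsic_on_def)
  then have i: "lmul h o\<^sub>L Q_integral J \<Gamma> f = Q_integral K \<Gamma> f o\<^sub>L lmul h"
    by (rule Q_integral_intertwine [OF J K _ _ \<Gamma>])
      (simp_all add: tr_lmul nm_lmul to_slice_intertwine [OF J h] flip: lmul_mult)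
  have "lmul h o\<^sub>L (Q_integral J \<Gamma> f o\<^sub>L lmul (- J)) = Q_integral K \<Gamma> f o\<^sub>L (lmul h o\<^sub>L lmul (- J))"
    by (simp add: i flip: compose_simps(1))
  also have "lmul h o\<^sub>L lmul (- J) = (lmul (- K) o\<^sub>L lmul h :: 'a qop)"
    by (simp add: h flip: lmul_mult)
  finally show ?thesis by (simp add: Q_calc_def compose_simps)
qed

text \<open>The sign from the reversed orientation cancels against the sign of the factor
  \<open>- J\<close> in the slice differential.\<close>

lemma Q_calc_minus_unit:
  assumes "J \<in> imag_units" "intrinsic_on D f" "resolvent_cycle D \<Gamma>"
  shows "Q_calc (- J) \<Gamma> f = Q_calc J \<Gamma> f"
  by (simp add: Q_calc_def Q_integral_minus_unit [OF assms] lmul_minus compose_simps)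

lemma Q_calc_lmul_commute:
  assumes f: "intrinsic_on D f" and \<Gamma>: "resolvent_cycle D \<Gamma>"
  shows "lmul p o\<^sub>L Q_calc qe1 \<Gamma> f = Q_calc qe1 \<Gamma> f o\<^sub>L lmul p"
proof -
  let ?P = "Q_calc qe1 \<Gamma> f"
  have 1: "lmul qe1 o\<^sub>L ?P = ?P o\<^sub>L lmul qe1"
    by (rule Q_calc_intertwine [OF qe_imag_units(1) qe_imag_units(1) f \<Gamma>]) simp
  \<comment> \<open>\<open>qe2\<close> anticommutes with \<open>qe1\<close>, so it intertwines the
    slices of \<open>qe1\<close> and \<open>- qe1\<close>, over which the calculus has the same
    value.\<close>
  have 2: "lmul qe2 o\<^sub>L ?P = ?P o\<^sub>L lmul qe2"
    using Q_calc_intertwine [OF qe_imag_units(1) imag_units_minus [OF qe_imag_units(1)] f \<Gamma>, of qe2]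
      Q_calc_minus_unit [OF qe_imag_units(1) f \<Gamma>] by (simp add: qe_times)
  have "lmul qe3 o\<^sub>L ?P = lmul qe1 o\<^sub>L (lmul qe2 o\<^sub>L ?P)"
    by (simp add: qe_times flip: lmul_mult compose_simps(1))
  also have "\<dots> = (lmul qe1 o\<^sub>L ?P) o\<^sub>L lmul qe2" by (simp add: 2 compose_simps(1))
  also have "\<dots> = ?P o\<^sub>L lmul qe3" by (simp add: 1 qe_times compose_simps(1) flip: lmul_mult)
  finally have 3: "lmul qe3 o\<^sub>L ?P = ?P o\<^sub>L lmul qe3" .
  show ?thesis
    by (subst (1 2) lmul_expansion) (simp add: compose_simps 1 2 3)
qed

lemma Q_calc_unit_independent:
  assumes J: "J \<in> imag_units" and f: "intrinsic_on D f" and \<Gamma>: "resolvent_cycle D \<Gamma>"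
  shows "Q_calc J \<Gamma> f = Q_calc qe1 \<Gamma> f"
proof -
  \<comment> \<open>The sum of two imaginary units conjugates one into the other, as J (J + e) = -1
    + J e = (J + e) e for units J and e. It vanishes only for opposite units, where any unit
    orthogonal to both works.\<close>
  obtain h where h: "h * qe1 = J * h" "h \<noteq> 0"
  proof (cases "J = - qe1")
    case True
    then show thesis
      using imag_units_facts(4) [OF qe_imag_units(2)] by (intro that [of qe2]) (simp_all add: qe_times)
  next
    case False
    then have "J + qe1 \<noteq> 0" by (simp add: eq_neg_iff_add_eq_0)
    then show thesis
      by (intro that [of "J + qe1"]) (simp_all add: algebra_simps qe_times imag_units_facts [OF J])
  qed
  have "Q_calc J \<Gamma> f o\<^sub>L lmul h = lmul h o\<^sub>L Q_calc qe1 \<Gamma> f"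
    by (rule Q_calc_intertwine [OF qe_imag_units(1) J f \<Gamma> h(1), symmetric])
  then have eq: "Q_calc J \<Gamma> f o\<^sub>L lmul h = Q_calc qe1 \<Gamma> f o\<^sub>L lmul h"
    by (simp add: Q_calc_lmul_commute [OF f \<Gamma>])
  have hh: "lmul h o\<^sub>L lmul (inverse h) = (id_blinfun :: 'a qop)"
    using h(2) by (simp add: lmul_1 flip: lmul_mult)
  have "(Q_calc J \<Gamma> f o\<^sub>L lmul h) o\<^sub>L lmul (inverse h) = (Q_calc qe1 \<Gamma> f o\<^sub>L lmul h) o\<^sub>L lmul (inverse h)"
    by (simp only: eq)
  then show ?thesis by (simp add: compose_simps hh)
qed

lemma Q_calc_cycle_independent:
  assumes J: "J \<in> imag_units" "J' \<in> imag_units" and f: "intrinsic_on D f"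
    and \<Gamma>: "resolvent_cycle D \<Gamma>" "resolvent_cycle D \<Gamma>'"
  shows "Q_calc J \<Gamma> f = Q_calc J' \<Gamma>' f"
proof -
  have "open D" "f holomorphic_on D" using f by (auto simp: intrinsic_on_def)
  then have "Q_calc qe1 \<Gamma> f = Q_calc qe1 \<Gamma>' f"
    by (simp add: Q_calc_def Q_integral_cycle_independent [OF qe_imag_units(1) _ _ \<Gamma>])
  then show ?thesis
    using Q_calc_unit_independent [OF J(1) f \<Gamma>(1)] Q_calc_unit_independent [OF J(2) f \<Gamma>(2)] by simp
qed

lemma Q_calc_commute:
  assumes J: "J \<in> imag_units" and f: "intrinsic_on D f" and \<Gamma>: "resolvent_cycle D \<Gamma>"
  shows "Q_calc J \<Gamma> f o\<^sub>L lmul p = lmul p o\<^sub>L Q_calc J \<Gamma> f"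
    and "Q_calc J \<Gamma> f o\<^sub>L op_conj T = op_conj T o\<^sub>L Q_calc J \<Gamma> f"
    and "Q_calc J \<Gamma> f o\<^sub>L tr = tr o\<^sub>L Q_calc J \<Gamma> f"
proof -
  let ?P = "Q_calc J \<Gamma> f"
  show l: "?P o\<^sub>L lmul p = lmul p o\<^sub>L ?P" for p
    unfolding Q_calc_unit_independent [OF J f \<Gamma>] by (rule Q_calc_lmul_commute [OF f \<Gamma>, symmetric])
  have D: "open D" "f holomorphic_on D" using f by (auto simp: intrinsic_on_def)
  have e: "?P o\<^sub>L ext_op R = ext_op R o\<^sub>L ?P" if "R \<in> parts" for R
  proof -
    have i: "ext_op R o\<^sub>L Q_integral J \<Gamma> f = Q_integral J \<Gamma> f o\<^sub>L ext_op R"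
      by (rule Q_integral_intertwine [OF J J D \<Gamma>])
        (simp_all add: ext_op_tr ext_op_nm ext_op_lmul_commute that)
    have "ext_op R o\<^sub>L (Q_integral J \<Gamma> f o\<^sub>L lmul (- J)) = Q_integral J \<Gamma> f o\<^sub>L (ext_op R o\<^sub>L lmul (- J))"
      by (simp add: i flip: compose_simps(1))
    then show ?thesis
      by (simp add: Q_calc_def compose_simps ext_op_lmul_commute)
  qed
  have "?P o\<^sub>L T = T o\<^sub>L ?P" by (rule commute_T(1)) (simp_all add: l e)
  moreover show "?P o\<^sub>L op_conj T = op_conj T o\<^sub>L ?P" by (rule commute_T(2)) (simp_all add: l e)
  ultimately show "?P o\<^sub>L tr = tr o\<^sub>L ?P" by (simp add: tr_def compose_simps)
qed

end

section \<open>The product formula for intrinsic functions\<close>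

lemma slice_functional_compose_left:
  assumes "C o\<^sub>L lmul J = lmul J o\<^sub>L C"
  shows "slice_functional J \<phi> (C o\<^sub>L X) = slice_functional J (\<lambda>X. \<phi> (C o\<^sub>L X)) X"
proof -
  have "lmul J o\<^sub>L (C o\<^sub>L X) = C o\<^sub>L (lmul J o\<^sub>L X)"
    by (simp add: assms flip: compose_simps(1))
  then show ?thesis by (simp add: slice_functional_def)
qed

lemma slice_holomorphic_on_compose_left:
  assumes F: "slice_holomorphic_on J F S" and C: "C o\<^sub>L lmul J = lmul J o\<^sub>L C"
  shows "slice_holomorphic_on J (\<lambda>z. C o\<^sub>L F z) S"
  unfolding slice_holomorphic_on_def
proof (intro conjI allI impI)
  have bl: "bounded_linear ((o\<^sub>L) C)"
    by (rule bounded_linear_compose_op(2))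
  show "continuous_on S (\<lambda>z. C o\<^sub>L F z)"
    using F unfolding slice_holomorphic_on_def by (intro bounded_linear.continuous_on [OF bl]) simp
  fix \<phi> :: "'a qop \<Rightarrow> real" assume "bounded_linear \<phi>"
  then have "bounded_linear (\<lambda>X. \<phi> (C o\<^sub>L X))" using bl by (rule bounded_linear_compose)
  then show "(\<lambda>z. slice_functional J \<phi> (C o\<^sub>L F z)) holomorphic_on S"
    unfolding slice_functional_compose_left [OF C] using F by (simp add: slice_holomorphic_on_def)
qed

context commuting_operator
begin

lemma Q_integral_eq_Q_calc:
  assumes J: "J \<in> imag_units" and f: "intrinsic_on D f" and \<Gamma>: "resolvent_cycle D \<Gamma>"
  shows "Q_integral J \<Gamma> f = (2 * pi) *\<^sub>R (lmul J o\<^sub>L Q_calc J \<Gamma> f)"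
proof -
  have "lmul (- J) o\<^sub>L lmul J = (id_blinfun :: 'a qop)"
    using imag_units_facts(3) [OF J] by (simp add: lmul_1 flip: lmul_mult)
  then have "(2 * pi) *\<^sub>R (Q_calc J \<Gamma> f o\<^sub>L lmul J) = Q_integral J \<Gamma> f"
    by (simp add: Q_calc_def compose_simps)
  then show ?thesis by (simp add: Q_calc_commute(1) [OF J f \<Gamma>])
qed

text \<open>The factor \<open>w - z\<close> of the resolvent equation cancels against the Cauchy
  kernel and leaves \<open>g w\<close> times w + z - \<open>tr\<close> times both kernels. The
  summand w integrates to the calculus of \<open>z * g z\<close>, the summand z - \<open>tr\<close>
  to that of \<open>g\<close>. The factor \<open>2 * pi * \<i>\<close> undoes the normalisation of
  \<open>Q_calc\<close>, with \<open>\<i>\<close> coming from its \<open>- J\<close>. Winding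
  numbers do not enter yet.\<close>

lemma Q_calc_resolvent_identity:
  assumes J: "J \<in> imag_units" and g: "intrinsic_on E g" and \<Gamma>: "resolvent_cycle E \<Gamma>"
    and z: "z \<in> resolvent_plane" "\<And>\<gamma>. \<gamma> \<in> \<Gamma> \<Longrightarrow> z \<notin> path_image \<gamma>" and \<phi>: "bounded_linear \<phi>"
  shows "2 * pi * \<i> * slice_functional J \<phi>
      (Q_resolvent J z o\<^sub>L (Q_calc J \<Gamma> (\<lambda>z. z * g z) + ((lmul (to_slice J z) - tr) o\<^sub>L Q_calc J \<Gamma> g)))
    = (\<Sum>\<gamma>\<in>\<Gamma>. contour_integral \<gamma> (\<lambda>w. g w / (w - z) *
        (slice_functional J \<phi> (Q_resolvent J z) - slice_functional J \<phi> (Q_resolvent J w))))"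
proof -
  note d = resolvent_cycleD [OF \<Gamma>]
  let ?q = "Q_resolvent J" and ?l = "\<lambda>z. lmul (to_slice J z) :: 'a qop"
    and ?sf = "slice_functional J \<phi>"
  let ?S = "E \<inter> resolvent_plane"
  have bl: "bounded_linear ?sf" by (rule bounded_linear_slice_functional [OF J \<phi>])
  have E: "open E" "g holomorphic_on E" using g by (auto simp: intrinsic_on_def)
  have oS: "open ?S" by (rule open_inter_resolvent [OF E(1)])
  have gS: "g holomorphic_on ?S" using E(2) by (rule holomorphic_on_subset) simp
  have zg: "intrinsic_on E (\<lambda>z. z * g z)" using g by (rule intrinsic_on_times_ident)
  define G where "G h w = (?l (h w) o\<^sub>L ?q w)" for h w
  have Gh: "slice_holomorphic_on J (G g) ?S" "slice_holomorphic_on J (G (\<lambda>z. z * g z)) ?S"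
    unfolding G_def [abs_def] by (intro slice_holomorphic_kernel J holomorphic_intros gS; simp)+
  have ll: "?l x o\<^sub>L ?l y = ?l y o\<^sub>L ?l x" for x y
    by (simp add: mult.commute flip: lmul_mult to_slice_mult [OF J])
  have ll': "?l x o\<^sub>L (?l y o\<^sub>L X) = ?l y o\<^sub>L (?l x o\<^sub>L X)" "tr o\<^sub>L (?l y o\<^sub>L X) = ?l y o\<^sub>L (tr o\<^sub>L X)"
    for x y and X :: "'a qop"
    by (simp_all add: ll tr_lmul flip: compose_simps(1))
  have lq: "?q z o\<^sub>L ?l y = ?l y o\<^sub>L ?q z" "?q z o\<^sub>L tr = tr o\<^sub>L ?q z" for y
    by (simp_all add: Q_resolvent_commute [OF J z(1)])
  have lq': "?q z o\<^sub>L (?l y o\<^sub>L X) = ?l y o\<^sub>L (?q z o\<^sub>L X)" "?q z o\<^sub>L (tr o\<^sub>L X) = tr o\<^sub>L (?q z o\<^sub>L X)"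
    for y and X :: "'a qop"
    by (simp_all add: lq flip: compose_simps(1))
  let ?C = "?q z o\<^sub>L (?l z - tr)"
  have Cl: "?C o\<^sub>L ?l y = ?l y o\<^sub>L ?C" for y
    by (simp add: compose_simps lq lq' ll ll' tr_lmul)
  have lJ: "?l \<i> = lmul J" by (simp add: to_slice_ii [OF J])
  have hol1: "slice_holomorphic_on J (\<lambda>w. ?q z o\<^sub>L G (\<lambda>z. z * g z) w) ?S"
    by (rule slice_holomorphic_on_compose_left [OF Gh(2)]) (use lq(1) [of \<i>] in \<open>simp add: lJ\<close>)
  have hol2: "slice_holomorphic_on J (\<lambda>w. ?C o\<^sub>L G g w) ?S"
    by (rule slice_holomorphic_on_compose_left [OF Gh(1)]) (use Cl [of \<i>] in \<open>simp add: lJ\<close>)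
  have pointwise: "(?q z o\<^sub>L G (\<lambda>z. z * g z) w) + (?C o\<^sub>L G g w) = ?l (g w / (w - z)) o\<^sub>L (?q z - ?q w)"
    if "w \<in> resolvent_plane" "w \<noteq> z" for w
  proof -
    have "g w = g w / (w - z) * (w - z)" using that by simp
    then have lg: "?l (g w / (w - z)) o\<^sub>L (?l (w - z) o\<^sub>L X) = ?l (g w) o\<^sub>L X" for X :: "'a qop"
      by (metis compose_simps(1) lmul_mult to_slice_mult [OF J])
    have "?l (g w / (w - z)) o\<^sub>L (?q z - ?q w) = ?l (g w) o\<^sub>L ((?l (w + z) - tr) o\<^sub>L (?q z o\<^sub>L ?q w))"
      unfolding Q_resolvent_equation [OF J z(1) that(1)] lg ..
    then show ?thesis
      by (simp add: G_def to_slice_mult [OF J] to_slice_add [OF J] lmul_mult lmul_add compose_simps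
          lq lq' ll' ll algebra_simps)
  qed
  have int: "?sf ((?q z o\<^sub>L op_integral J \<gamma> (G (\<lambda>z. z * g z))) + (?C o\<^sub>L op_integral J \<gamma> (G g)))
      = contour_integral \<gamma> (\<lambda>w. g w / (w - z) * (?sf (?q z) - ?sf (?q w)))" if \<gamma>: "\<gamma> \<in> \<Gamma>" for \<gamma>
  proof -
    note p = d(2) [OF \<gamma>] d(4) [OF \<gamma>]
    have "(?q z o\<^sub>L op_integral J \<gamma> (G (\<lambda>z. z * g z))) + (?C o\<^sub>L op_integral J \<gamma> (G g))
        = op_integral J \<gamma> (\<lambda>w. ?q z o\<^sub>L G (\<lambda>z. z * g z) w) + op_integral J \<gamma> (\<lambda>w. ?C o\<^sub>L G g w)"
      by (simp only: op_integral_compose_left [OF J J oS Gh(1) p Cl]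
          op_integral_compose_left [OF J J oS Gh(2) p lq(1)])
    also have "\<dots> = op_integral J \<gamma> (\<lambda>w. (?q z o\<^sub>L G (\<lambda>z. z * g z) w) + (?C o\<^sub>L G g w))"
      by (rule op_integral_add [OF J oS p hol1 hol2, symmetric])
    also have "?sf \<dots> = contour_integral \<gamma> (\<lambda>w. ?sf ((?q z o\<^sub>L G (\<lambda>z. z * g z) w) + (?C o\<^sub>L G g w)))"
      by (rule slice_functional_op_integral [OF J oS slice_holomorphic_on_add [OF J hol1 hol2] p \<phi>])
    also have "\<dots> = contour_integral \<gamma> (\<lambda>w. g w / (w - z) * (?sf (?q z) - ?sf (?q w)))"
    proof (rule contour_integral_cong [OF refl])
      fix w assume "w \<in> path_image \<gamma>"
      then have w: "w \<in> resolvent_plane" "w \<noteq> z" using p(2) z(2) [OF \<gamma>] by auto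
      show "?sf ((?q z o\<^sub>L G (\<lambda>z. z * g z) w) + (?C o\<^sub>L G g w)) = g w / (w - z) * (?sf (?q z) - ?sf (?q w))"
        by (simp only: pointwise [OF w] slice_functional_slice [OF J \<phi>] linear_simps(2) [OF bl])
    qed
    finally show ?thesis .
  qed
  let ?P1 = "Q_calc J \<Gamma> (\<lambda>z. z * g z)" and ?P = "Q_calc J \<Gamma> g"
  have "(\<Sum>\<gamma>\<in>\<Gamma>. contour_integral \<gamma> (\<lambda>w. g w / (w - z) * (?sf (?q z) - ?sf (?q w))))
      = ?sf (\<Sum>\<gamma>\<in>\<Gamma>. (?q z o\<^sub>L op_integral J \<gamma> (G (\<lambda>z. z * g z))) + (?C o\<^sub>L op_integral J \<gamma> (G g)))"
    unfolding linear_sum [OF bounded_linear.linear [OF bl]]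
    by (rule sum.cong [OF refl int [symmetric]])
  also have "(\<Sum>\<gamma>\<in>\<Gamma>. (?q z o\<^sub>L op_integral J \<gamma> (G (\<lambda>z. z * g z))) + (?C o\<^sub>L op_integral J \<gamma> (G g)))
      = (?q z o\<^sub>L Q_integral J \<Gamma> (\<lambda>z. z * g z)) + (?C o\<^sub>L Q_integral J \<Gamma> g)"
    by (simp add: Q_integral_def G_def [abs_def] compose_sum sum.distrib)
  also have "\<dots> = (2 * pi) *\<^sub>R (?l \<i> o\<^sub>L (?q z o\<^sub>L (?P1 + ((?l z - tr) o\<^sub>L ?P))))"
    unfolding Q_integral_eq_Q_calc [OF J zg \<Gamma>] Q_integral_eq_Q_calc [OF J g \<Gamma>] lJ [symmetric]
    by (simp add: compose_simps lq lq' ll' algebra_simps del: to_slice_ii)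
  also have "?sf \<dots> = 2 * pi * \<i> * ?sf (?q z o\<^sub>L (?P1 + ((?l z - tr) o\<^sub>L ?P)))"
    by (simp add: linear_simps(5) [OF bl] slice_functional_slice [OF J \<phi>] scaleR_conv_of_real)
  finally show ?thesis by simp
qed

text \<open>Two unrelated cycles occur, \<open>\<Gamma>'\<close> for the Cauchy transform and
  \<open>\<Gamma>\<close> for the outer integral. They may cross or coincide: the paths of
  \<open>\<Gamma>'\<close> lie in the resolvent set, and there the extension \<open>H\<close> is
  given by its explicit formula instead of the Cauchy transform.\<close>

lemma Q_integral_product:
  assumes J: "J \<in> imag_units" and f: "intrinsic_on D f" and g: "intrinsic_on E g"
    and \<Gamma>: "resolvent_cycle (D \<inter> E) \<Gamma>" and \<Gamma>': "resolvent_cycle E \<Gamma>'"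
  shows "Q_integral J \<Gamma> (\<lambda>z. f z * g z) = (Q_integral J \<Gamma> (\<lambda>z. z * f z) o\<^sub>L Q_calc J \<Gamma>' g)
    + (Q_integral J \<Gamma> f o\<^sub>L (Q_calc J \<Gamma>' (\<lambda>z. z * g z) - (tr o\<^sub>L Q_calc J \<Gamma>' g)))"
proof (rule blinfun_eqI_slice_functional)
  fix \<phi> :: "'a qop \<Rightarrow> real" assume \<phi>: "bounded_linear \<phi>"
  note d = resolvent_cycleD [OF \<Gamma>] and d' = resolvent_cycleD [OF \<Gamma>']
  let ?q = "Q_resolvent J" and ?l = "\<lambda>z. lmul (to_slice J z) :: 'a qop"
    and ?sf = "slice_functional J \<phi>"
  let ?P1 = "Q_calc J \<Gamma>' (\<lambda>z. z * g z)" and ?P = "Q_calc J \<Gamma>' g"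
  define Y where "Y z = ?P1 + ((?l z - tr) o\<^sub>L ?P)" for z
  have bl: "bounded_linear ?sf" by (rule bounded_linear_slice_functional [OF J \<phi>])
  have E: "open E" "g holomorphic_on E" and D: "open D" "f holomorphic_on D"
    using f g by (auto simp: intrinsic_on_def)
  have sfq: "(\<lambda>z. slice_functional J \<psi> (?q z)) holomorphic_on resolvent_plane" if "bounded_linear \<psi>" for \<psi>
    using slice_holomorphic_Q_resolvent [OF J] that by (simp add: slice_holomorphic_on_def)
  define h where "h w = g w * ?sf (?q w)" for w
  have gR: "g holomorphic_on E \<inter> resolvent_plane" using E(2) by (rule holomorphic_on_subset) simp
  have sR: "(\<lambda>z. ?sf (?q z)) holomorphic_on E \<inter> resolvent_plane"
    using sfq [OF \<phi>] by (rule holomorphic_on_subset) simp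
  have hR: "h holomorphic_on E \<inter> resolvent_plane"
    unfolding h_def by (intro holomorphic_intros gR sR)
  have oR: "open (E \<inter> resolvent_plane)" by (rule open_inter_resolvent [OF E(1)])
  define C where "C z = (\<Sum>\<gamma>\<in>\<Gamma>'. contour_integral \<gamma> (\<lambda>w. h w / (w - z)))" for z
  \<comment> \<open>The points about which \<open>\<Gamma>'\<close> winds once. They include the
    spectrum, so together with the resolvent set they cover \<open>E\<close>; and they lie in
    \<open>E\<close>, because the winding number is zero outside.\<close>
  define V where "V = {z \<in> - (\<Union>\<gamma>\<in>\<Gamma>'. path_image \<gamma>). (\<Sum>\<gamma>\<in>\<Gamma>'. 1 * winding_number \<gamma> z) = 1}"
  have "open V"
    unfolding V_def using open_winding_number_sum_level [OF d'(1), of "\<lambda>\<gamma>. \<gamma>" "\<lambda>_. 1" 1] d'(2,3)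
    by (simp add: valid_path_imp_path)
  have VE: "z \<in> E" if "z \<in> V" for z
    using that d'(7) [of z] by (auto simp: V_def)
  have V: "z \<notin> path_image \<gamma>" if "z \<in> V" "\<gamma> \<in> \<Gamma>'" for z \<gamma>
    using that by (auto simp: V_def)
  have EV: "V \<union> (E \<inter> resolvent_plane) = E"
  proof -
    have "z \<in> V" if "z \<notin> resolvent_plane" for z
      using d'(4,6) that by (auto simp: V_def)
    then show ?thesis using VE by auto
  qed
  have agree: "C z / (2 * pi * \<i>) = g z * ?sf (?q z) - ?sf (?q z o\<^sub>L Y z)" if z: "z \<in> V" "z \<in> resolvent_plane" for z
  proof -
    have ci: "contour_integral \<gamma> (\<lambda>w. g w / (w - z) * (?sf (?q z) - ?sf (?q w)))
        = ?sf (?q z) * contour_integral \<gamma> (\<lambda>w. g w / (w - z)) - contour_integral \<gamma> (\<lambda>w. h w / (w - z))"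
      if \<gamma>: "\<gamma> \<in> \<Gamma>'" for \<gamma>
    proof -
      have o: "open (E \<inter> resolvent_plane - {z})" and im: "path_image \<gamma> \<subseteq> E \<inter> resolvent_plane - {z}"
        using oR d'(4) [OF \<gamma>] V [OF z(1) \<gamma>] by (auto simp: open_delete)
      have i1: "(\<lambda>w. g w / (w - z)) contour_integrable_on \<gamma>"
        by (rule contour_integrable_holomorphic_simple [OF _ o d'(2) [OF \<gamma>] im])
          (auto intro!: holomorphic_intros holomorphic_on_subset [OF gR])
      have i2: "(\<lambda>w. h w / (w - z)) contour_integrable_on \<gamma>"
        by (rule contour_integrable_holomorphic_simple [OF _ o d'(2) [OF \<gamma>] im])
          (auto intro!: holomorphic_intros holomorphic_on_subset [OF hR])
      have "contour_integral \<gamma> (\<lambda>w. g w / (w - z) * (?sf (?q z) - ?sf (?q w)))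
          = contour_integral \<gamma> (\<lambda>w. ?sf (?q z) * (g w / (w - z)) - h w / (w - z))"
        by (simp add: h_def algebra_simps)
      also have "\<dots> = contour_integral \<gamma> (\<lambda>w. ?sf (?q z) * (g w / (w - z))) - contour_integral \<gamma> (\<lambda>w. h w / (w - z))"
        by (rule contour_integral_diff [OF contour_integrable_lmul [OF i1] i2])
      finally show ?thesis by (simp only: contour_integral_lmul [OF i1])
    qed
    \<comment> \<open>Here winding number one is used: the part of the integral with the constant
      factor \<open>?sf (?q z)\<close> reproduces \<open>g z\<close>.\<close>
    have "(\<Sum>\<gamma>\<in>\<Gamma>'. 1 * contour_integral \<gamma> (\<lambda>w. g w / (w - z))) = 2 * pi * \<i> * g z * (\<Sum>\<gamma>\<in>\<Gamma>'. 1 * winding_number \<gamma> z)"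
      using E d' VE [OF z(1)] V [OF z(1)] by (intro Cauchy_integral_formula_cycle) auto
    then have cif: "(\<Sum>\<gamma>\<in>\<Gamma>'. contour_integral \<gamma> (\<lambda>w. g w / (w - z))) = 2 * pi * \<i> * g z"
      using z(1) by (simp add: V_def)
    have "2 * pi * \<i> * ?sf (?q z o\<^sub>L Y z)
        = (\<Sum>\<gamma>\<in>\<Gamma>'. contour_integral \<gamma> (\<lambda>w. g w / (w - z) * (?sf (?q z) - ?sf (?q w))))"
      unfolding Y_def by (rule Q_calc_resolvent_identity [OF J g \<Gamma>' z(2) V [OF z(1)] \<phi>])
    also have "\<dots> = (\<Sum>\<gamma>\<in>\<Gamma>'. ?sf (?q z) * contour_integral \<gamma> (\<lambda>w. g w / (w - z))
        - contour_integral \<gamma> (\<lambda>w. h w / (w - z)))"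
      by (rule sum.cong [OF refl ci])
    also have "\<dots> = ?sf (?q z) * (2 * pi * \<i> * g z) - C z"
      unfolding C_def cif [symmetric] by (simp add: sum_subtractf sum_distrib_left)
    finally have "2 * pi * \<i> * ?sf (?q z o\<^sub>L Y z) = ?sf (?q z) * (2 * pi * \<i> * g z) - C z" .
    then show ?thesis by (simp add: field_simps)
  qed
  define H where "H z = (if z \<in> V then C z / (2 * pi * \<i>) else g z * ?sf (?q z) - ?sf (?q z o\<^sub>L Y z))" for z
  have H: "H z = g z * ?sf (?q z) - ?sf (?q z o\<^sub>L Y z)" if "z \<in> resolvent_plane" for z
    using that agree by (simp add: H_def)
  have qY: "?q z o\<^sub>L Y z = (?q z o\<^sub>L ?P1) + (?l z o\<^sub>L (?q z o\<^sub>L ?P)) - (?q z o\<^sub>L (tr o\<^sub>L ?P))"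
    if "z \<in> resolvent_plane" for z
  proof -
    have "?q z o\<^sub>L (?l z o\<^sub>L ?P) = ?l z o\<^sub>L (?q z o\<^sub>L ?P)"
      by (simp add: Q_resolvent_commute [OF J that] flip: compose_simps(1))
    then show ?thesis by (simp add: Y_def compose_simps)
  qed
  have "(\<lambda>z. ?sf (?q z o\<^sub>L Y z)) holomorphic_on resolvent_plane"
  proof -
    have "(\<lambda>z. slice_functional J (\<lambda>X. \<phi> (X o\<^sub>L ?P1)) (?q z) + z * slice_functional J (\<lambda>X. \<phi> (X o\<^sub>L ?P)) (?q z)
        - slice_functional J (\<lambda>X. \<phi> (X o\<^sub>L (tr o\<^sub>L ?P))) (?q z)) holomorphic_on resolvent_plane"
      by (intro holomorphic_intros sfq bounded_linear_compose_functional \<phi>)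
    then show ?thesis
      by (rule holomorphic_transform)
        (simp add: qY linear_simps(1,2) [OF bl] slice_functional_slice [OF J \<phi>],
          simp only: slice_functional_compose_right)
  qed
  then have "(\<lambda>z. g z * ?sf (?q z) - ?sf (?q z o\<^sub>L Y z)) holomorphic_on E \<inter> resolvent_plane"
    by (intro holomorphic_intros gR sR) (rule holomorphic_on_subset, auto)
  moreover have "(\<lambda>z. C z / (2 * pi * \<i>)) holomorphic_on V"
    unfolding C_def
  proof (intro holomorphic_intros)
    fix \<gamma> assume "\<gamma> \<in> \<Gamma>'"
    then show "(\<lambda>z. contour_integral \<gamma> (\<lambda>w. h w / (w - z))) holomorphic_on V"
      using oR hR d'(2,4) V by (intro holomorphic_on_subset [OF Cauchy_transform_holomorphic [of "E \<inter> resolvent_plane"]]) auto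
  qed simp
  ultimately have "H holomorphic_on V \<union> (E \<inter> resolvent_plane)"
    unfolding H_def by (intro holomorphic_on_If_Un \<open>open V\<close> oR) (use agree in auto)
  then have HE: "H holomorphic_on E" by (simp only: EV)
  \<comment> \<open>\<open>F\<close> is the integrand of the right side. On the paths
    \<open>f z * H z\<close> is the functional of the left integrand minus that of \<open>F\<close>,
    so the vanishing of its integral is the asserted identity.\<close>
  define F where "F z = ((?l (z * f z) o\<^sub>L ?q z) o\<^sub>L ?P) + ((?l (f z) o\<^sub>L ?q z) o\<^sub>L (?P1 - (tr o\<^sub>L ?P)))" for z
  have "(\<Sum>\<gamma>\<in>\<Gamma>. 1 * contour_integral \<gamma> (\<lambda>z. f z * H z)) = 0"
  proof (rule Cauchy_theorem_cycle [OF d(1) open_Int [OF D(1) E(1)]])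
    show "(\<lambda>z. f z * H z) holomorphic_on D \<inter> E"
      by (intro holomorphic_intros) (auto intro: holomorphic_on_subset [OF D(2)] holomorphic_on_subset [OF HE])
    show "valid_path \<gamma> \<and> pathfinish \<gamma> = pathstart \<gamma> \<and> path_image \<gamma> \<subseteq> D \<inter> E" if "\<gamma> \<in> \<Gamma>" for \<gamma>
      using d(2-4) [OF that] by auto
  qed (simp add: d)
  moreover have "contour_integral \<gamma> (\<lambda>z. f z * H z) = ?sf (op_integral J \<gamma> (\<lambda>z. ?l (f z * g z) o\<^sub>L ?q z))
      - ?sf (op_integral J \<gamma> F)"
    and "op_integral J \<gamma> F = (op_integral J \<gamma> (\<lambda>z. ?l (z * f z) o\<^sub>L ?q z) o\<^sub>L ?P)
      + (op_integral J \<gamma> (\<lambda>z. ?l (f z) o\<^sub>L ?q z) o\<^sub>L (?P1 - (tr o\<^sub>L ?P)))"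
    if \<gamma>: "\<gamma> \<in> \<Gamma>" for \<gamma>
  proof -
    let ?S = "D \<inter> E \<inter> resolvent_plane"
    note p = d(2) [OF \<gamma>] d(4) [OF \<gamma>]
    have oS: "open ?S" by (rule open_inter_resolvent [OF open_Int [OF D(1) E(1)]])
    have fS: "f holomorphic_on ?S" "g holomorphic_on ?S"
      by (auto intro: holomorphic_on_subset [OF D(2)] holomorphic_on_subset [OF E(2)])
    have k: "slice_holomorphic_on J (\<lambda>z. ?l (k z) o\<^sub>L ?q z) ?S" if "k holomorphic_on ?S" for k
      by (rule slice_holomorphic_kernel [OF J that]) auto
    note kf = k [OF fS(1)] and kzf = k [OF holomorphic_on_mult [OF holomorphic_on_ident fS(1)]]
      and kfg = k [OF holomorphic_on_mult [OF fS]]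
    note c1 = slice_holomorphic_on_compose_right [OF kzf, of ?P]
      and c2 = slice_holomorphic_on_compose_right [OF kf, of "?P1 - (tr o\<^sub>L ?P)"]
    show "op_integral J \<gamma> F = (op_integral J \<gamma> (\<lambda>z. ?l (z * f z) o\<^sub>L ?q z) o\<^sub>L ?P)
      + (op_integral J \<gamma> (\<lambda>z. ?l (f z) o\<^sub>L ?q z) o\<^sub>L (?P1 - (tr o\<^sub>L ?P)))"
      unfolding F_def [abs_def]
      by (simp only: op_integral_add [OF J oS p c1 c2] op_integral_compose [OF J oS kzf p]
          op_integral_compose [OF J oS kf p])
    have Fh: "slice_holomorphic_on J F ?S"
      unfolding F_def [abs_def] by (rule slice_holomorphic_on_add [OF J c1 c2])
    have i: "(\<lambda>z. ?sf (K z)) contour_integrable_on \<gamma>" if "slice_holomorphic_on J K ?S" for K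
      by (rule contour_integrable_holomorphic_simple [OF _ oS p])
        (use that \<phi> in \<open>simp add: slice_holomorphic_on_def\<close>)
    have "contour_integral \<gamma> (\<lambda>z. f z * H z) = contour_integral \<gamma> (\<lambda>z. ?sf (?l (f z * g z) o\<^sub>L ?q z) - ?sf (F z))"
    proof (rule contour_integral_cong [OF refl])
      fix z assume "z \<in> path_image \<gamma>"
      then have zr: "z \<in> resolvent_plane" using p(2) by auto
      have "F z = ?l (f z) o\<^sub>L (?q z o\<^sub>L Y z)"
        by (simp add: F_def qY [OF zr] to_slice_mult [OF J] lmul_mult compose_simps algebra_simps)
          (simp add: mult.commute flip: compose_simps(1) lmul_mult to_slice_mult [OF J])
      then have "?sf (F z) = f z * ?sf (?q z o\<^sub>L Y z)"
        by (simp only: slice_functional_slice [OF J \<phi>])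
      then show "f z * H z = ?sf (?l (f z * g z) o\<^sub>L ?q z) - ?sf (F z)"
        by (simp add: H [OF zr] slice_functional_slice [OF J \<phi>] algebra_simps)
    qed
    also have "\<dots> = contour_integral \<gamma> (\<lambda>z. ?sf (?l (f z * g z) o\<^sub>L ?q z)) - contour_integral \<gamma> (\<lambda>z. ?sf (F z))"
      by (rule contour_integral_diff [OF i [OF kfg] i [OF Fh]])
    finally show "contour_integral \<gamma> (\<lambda>z. f z * H z) = ?sf (op_integral J \<gamma> (\<lambda>z. ?l (f z * g z) o\<^sub>L ?q z))
      - ?sf (op_integral J \<gamma> F)"
      by (simp only: slice_functional_op_integral [OF J oS kfg p \<phi>]
          slice_functional_op_integral [OF J oS Fh p \<phi>])
  qed
  ultimately have "(\<Sum>\<gamma>\<in>\<Gamma>. ?sf (op_integral J \<gamma> (\<lambda>z. ?l (f z * g z) o\<^sub>L ?q z)))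
      = (\<Sum>\<gamma>\<in>\<Gamma>. ?sf ((op_integral J \<gamma> (\<lambda>z. ?l (z * f z) o\<^sub>L ?q z) o\<^sub>L ?P)
      + (op_integral J \<gamma> (\<lambda>z. ?l (f z) o\<^sub>L ?q z) o\<^sub>L (?P1 - (tr o\<^sub>L ?P)))))"
    by (simp add: sum_subtractf)
  then show "?sf (Q_integral J \<Gamma> (\<lambda>z. f z * g z)) = ?sf ((Q_integral J \<Gamma> (\<lambda>z. z * f z) o\<^sub>L ?P)
    + (Q_integral J \<Gamma> f o\<^sub>L (?P1 - (tr o\<^sub>L ?P))))"
    by (simp add: Q_integral_def linear_sum [OF bounded_linear.linear [OF bl]] compose_sum
        sum.distrib linear_simps(1) [OF bl])
qed

text \<open>The factor \<open>- J\<close> of the outer integral ends up to the right of the inner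
  calculi. It moves back to the outer integral because those of intrinsic functions commute with all
  quaternions.\<close>

lemma Q_calc_product:
  assumes J: "J \<in> imag_units" and f: "intrinsic_on D f" and g: "intrinsic_on E g"
    and \<Gamma>: "resolvent_cycle (D \<inter> E) \<Gamma>"
  shows "Q_calc J \<Gamma> (\<lambda>z. f z * g z) = (Q_calc J \<Gamma> (\<lambda>z. z * f z) o\<^sub>L Q_calc J \<Gamma> g)
    + (Q_calc J \<Gamma> f o\<^sub>L Q_calc J \<Gamma> (\<lambda>z. z * g z)) - (Q_calc J \<Gamma> f o\<^sub>L (tr o\<^sub>L Q_calc J \<Gamma> g))"
proof -
  have \<Gamma>': "resolvent_cycle E \<Gamma>" by (rule resolvent_cycle_mono [OF \<Gamma>]) simp
  note c = Q_calc_commute(1) [OF J g \<Gamma>'] Q_calc_commute(1) [OF J intrinsic_on_times_ident [OF g] \<Gamma>']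
  have c': "lmul p o\<^sub>L (tr o\<^sub>L X) = tr o\<^sub>L (lmul p o\<^sub>L X)" for p and X :: "'a qop"
    by (simp add: tr_lmul flip: compose_simps(1))
  show ?thesis
    unfolding Q_calc_def [of J \<Gamma> "\<lambda>z. f z * g z"] Q_integral_product [OF J f g \<Gamma> \<Gamma>']
    unfolding Q_calc_def [of J \<Gamma> "\<lambda>z. z * f z"] Q_calc_def [of J \<Gamma> f]
    by (simp add: compose_simps c c' scaleR_right_diff_distrib scaleR_right_distrib algebra_simps)
qed

end

section \<open>Intrinsic components\<close>

definition unit_index :: "nat \<Rightarrow> quat" where "unit_index k = [1, qe1, qe2, qe3] ! k"
definition quat_component :: "nat \<Rightarrow> quat \<Rightarrow> real" where "quat_component k = [QRe, QI1, QI2, QI3] ! k"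

lemma quat_component_expansion:
  "(\<Sum>k<4. of_real (quat_component k p) * unit_index k) = p"
  "(\<Sum>k<4. unit_index k * of_real (quat_component k p)) = p"
  by (simp_all add: eval_nat_numeral unit_index_def quat_component_def quat_eq_iff of_real_quat plus_quat_def
      zero_quat_def times_quat_def one_quat_def qe1_def qe2_def qe3_def)

lemma bounded_linear_quat_component: "k < 4 \<Longrightarrow> bounded_linear (quat_component k)"
  using bounded_linear_quat_components
  by (auto simp: quat_component_def eval_nat_numeral less_Suc_eq)

abbreviation plane :: "quat set \<Rightarrow> complex set" where "plane U \<equiv> slice qe1 U"

lemma slice_eq_plane:
  assumes "axially_symmetric U" "J \<in> imag_units"
  shows "slice J U = plane U"
  using assms qe_imag_units(1) unfolding axially_symmetric_def slice_def to_slice_def by blast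

lemma open_slice:
  assumes "J \<in> imag_units" "open U"
  shows "open (slice J U)"
  unfolding slice_def
  using open_vimage [OF assms(2) linear_continuous_on [OF bounded_linear_to_slice [OF assms(1)]]]
  by (simp add: vimage_def)

text \<open>A bounded real linear functional preserves the Cauchy-Riemann equations and the
  parities, so each quaternion coordinate of the pair of components yields an intrinsic
  function.\<close>

lemma intrinsic_on_components:
  assumes ab: "slice_components U \<alpha> \<beta>" and c: "bounded_linear c"
  shows "intrinsic_on (plane U) (\<lambda>z. Complex (c (\<alpha> (Re z, Im z))) (c (\<beta> (Re z, Im z))))"
    (is "intrinsic_on _ ?f")
proof -
  have op: "open U" and ax: "axially_symmetric U" using ab by (simp_all add: slice_components_def)
  have oP: "open (plane U)" by (rule open_slice [OF qe_imag_units(1) op])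
  have all: "\<forall>J\<in>imag_units. of_real (Re z) + J * of_real (Im z) \<in> U" if "z \<in> plane U" for z
    using slice_eq_plane [OF ax] that unfolding slice_def to_slice_def by blast
  have comp: "\<alpha> (Re z, - Im z) = \<alpha> (Re z, Im z) \<and> \<beta> (Re z, - Im z) = - \<beta> (Re z, Im z) \<and>
      (\<exists>A B. (\<alpha> has_derivative A) (at (Re z, Im z)) \<and> (\<beta> has_derivative B) (at (Re z, Im z)) \<and>
        A (1, 0) = B (0, 1) \<and> A (0, 1) = - B (1, 0))" if "z \<in> plane U" for z
    using ab all [OF that] unfolding slice_components_def by blast
  have "cnj z \<in> plane U" if "z \<in> plane U" for z
    using all [OF that] imag_units_minus [OF qe_imag_units(1)] by (auto simp: slice_def to_slice_def)
  moreover have "?f (cnj z) = cnj (?f z)" if "z \<in> plane U" for z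
    using comp [OF that] by (simp add: complex_eq_iff linear_simps [OF c])
  moreover have "?f field_differentiable at z" if z: "z \<in> plane U" for z
  proof -
    obtain A B where A: "(\<alpha> has_derivative A) (at (Re z, Im z))" and B: "(\<beta> has_derivative B) (at (Re z, Im z))"
      and CR: "A (1, 0) = B (0, 1)" "A (0, 1) = - B (1, 0)"
      using comp [OF z] by blast
    have pt: "((\<lambda>z. (Re z, Im z)) has_derivative (\<lambda>h. (Re h, Im h))) (at z)"
      by (intro has_derivative_Pair bounded_linear.has_derivative [OF bounded_linear_Re]
          bounded_linear.has_derivative [OF bounded_linear_Im] has_derivative_ident)
    have lin: "L (Re h, Im h) = Re h *\<^sub>R L (1, 0) + Im h *\<^sub>R L (0, 1)" if "bounded_linear L"
      for L :: "real \<times> real \<Rightarrow> quat" and h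
    proof -
      have "(Re h, Im h) = Re h *\<^sub>R (1, 0) + Im h *\<^sub>R (0, 1 :: real)" by simp
      then show ?thesis by (simp only: linear_simps(1,5) [OF that])
    qed
    note linA = lin [OF has_derivative_bounded_linear [OF A]] and linB = lin [OF has_derivative_bounded_linear [OF B]]
    have "((\<lambda>z. of_real (c (\<alpha> (Re z, Im z))) + \<i> * of_real (c (\<beta> (Re z, Im z)))) has_derivative
        (\<lambda>h. of_real (c (A (Re h, Im h))) + \<i> * of_real (c (B (Re h, Im h))))) (at z)"
      by (intro has_derivative_add has_derivative_mult_right bounded_linear.has_derivative [OF bounded_linear_of_real]
          bounded_linear.has_derivative [OF c] has_derivative_compose [OF pt A] has_derivative_compose [OF pt B])
    moreover have "of_real (c (A (Re h, Im h))) + \<i> * of_real (c (B (Re h, Im h)))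
        = Complex (c (A (1, 0))) (c (B (1, 0))) * h" for h
      by (simp add: complex_eq_iff linA linB linear_simps [OF c] CR algebra_simps)
    ultimately have "(?f has_field_derivative Complex (c (A (1, 0))) (c (B (1, 0)))) (at z)"
      by (simp add: has_field_derivative_def Complex_eq)
    then show ?thesis by (auto simp: field_differentiable_def)
  qed
  then have "?f holomorphic_on plane U"
    by (simp add: holomorphic_on_def field_differentiable_at_within)
  ultimately show ?thesis using oP by (simp add: intrinsic_on_def)
qed

definition slice_components_of :: "quat set \<Rightarrow> 'k set \<Rightarrow> ('k \<Rightarrow> complex \<Rightarrow> complex) \<Rightarrow> bool" where
  "slice_components_of D K h \<longleftrightarrow> finite K \<and> (\<forall>k\<in>K. intrinsic_on (plane D) (h k))"

text \<open>The constant coefficients stand on the right, away from the kernel. The index set is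
  left open: \<open>{..<4}\<close> with the quaternion basis serves a general function,
  \<open>{()}\<close> with coefficient 1 an intrinsic one.\<close>

definition left_expansion ::
  "quat set \<Rightarrow> (quat \<Rightarrow> quat) \<Rightarrow> 'k set \<Rightarrow> ('k \<Rightarrow> quat) \<Rightarrow> ('k \<Rightarrow> complex \<Rightarrow> complex) \<Rightarrow> bool" where
  "left_expansion D g K e h \<longleftrightarrow> slice_components_of D K h \<and>
    (\<forall>J\<in>imag_units. \<forall>z\<in>plane D. g (to_slice J z) = (\<Sum>k\<in>K. to_slice J (h k z) * e k))"

definition right_expansion ::
  "quat set \<Rightarrow> (quat \<Rightarrow> quat) \<Rightarrow> 'k set \<Rightarrow> ('k \<Rightarrow> quat) \<Rightarrow> ('k \<Rightarrow> complex \<Rightarrow> complex) \<Rightarrow> bool" where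
  "right_expansion D g K e h \<longleftrightarrow> slice_components_of D K h \<and>
    (\<forall>J\<in>imag_units. \<forall>z\<in>plane D. g (to_slice J z) = (\<Sum>k\<in>K. e k * to_slice J (h k z)))"

lemma in_planeD:
  assumes "axially_symmetric D" "J \<in> imag_units" "z \<in> plane D"
  shows "of_real (Re z) + J * of_real (Im z) \<in> D"
  using assms slice_eq_plane [OF assms(1,2)] by (auto simp: slice_def to_slice_def)

lemma left_expansion_exists:
  assumes "left_slice_hyperholomorphic_on D g"
  obtains h where "left_expansion D g {..<4} unit_index h"
proof -
  obtain \<alpha> \<beta> where ab: "slice_components D \<alpha> \<beta>"
    and g: "\<forall>u v. \<forall>J\<in>imag_units. of_real u + J * of_real v \<in> D \<longrightarrow>
      g (of_real u + J * of_real v) = \<alpha> (u, v) + J * \<beta> (u, v)"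
    using assms by (auto simp: left_slice_hyperholomorphic_on_def)
  have ax: "axially_symmetric D" using ab by (simp add: slice_components_def)
  define h where "h k z = Complex (quat_component k (\<alpha> (Re z, Im z))) (quat_component k (\<beta> (Re z, Im z)))" for k z
  have "g (to_slice J z) = (\<Sum>k<4. to_slice J (h k z) * unit_index k)" if "J \<in> imag_units" "z \<in> plane D" for J z
  proof -
    have "g (to_slice J z) = \<alpha> (Re z, Im z) + J * \<beta> (Re z, Im z)"
      using g in_planeD [OF ax that] that(1) by (simp add: to_slice_def)
    also have "\<dots> = (\<Sum>k<4. of_real (quat_component k (\<alpha> (Re z, Im z))) * unit_index k)
        + J * (\<Sum>k<4. of_real (quat_component k (\<beta> (Re z, Im z))) * unit_index k)"
      by (simp only: quat_component_expansion)
    also have "\<dots> = (\<Sum>k<4. to_slice J (h k z) * unit_index k)"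
      by (simp add: h_def to_slice_def sum_distrib_left distrib_right mult.assoc flip: sum.distrib)
    finally show ?thesis .
  qed
  then have "left_expansion D g {..<4} unit_index h"
    unfolding left_expansion_def slice_components_of_def h_def
    using intrinsic_on_components [OF ab bounded_linear_quat_component] by simp
  then show thesis by (rule that)
qed

lemma right_expansion_exists:
  assumes "right_slice_hyperholomorphic_on D g"
  obtains h where "right_expansion D g {..<4} unit_index h"
proof -
  obtain \<alpha> \<beta> where ab: "slice_components D \<alpha> \<beta>"
    and g: "\<forall>u v. \<forall>J\<in>imag_units. of_real u + J * of_real v \<in> D \<longrightarrow>
      g (of_real u + J * of_real v) = \<alpha> (u, v) + \<beta> (u, v) * J"
    using assms by (auto simp: right_slice_hyperholomorphic_on_def)
  have ax: "axially_symmetric D" using ab by (simp add: slice_components_def)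
  define h where "h k z = Complex (quat_component k (\<alpha> (Re z, Im z))) (quat_component k (\<beta> (Re z, Im z)))" for k z
  have "g (to_slice J z) = (\<Sum>k<4. unit_index k * to_slice J (h k z))" if "J \<in> imag_units" "z \<in> plane D" for J z
  proof -
    have "g (to_slice J z) = \<alpha> (Re z, Im z) + \<beta> (Re z, Im z) * J"
      using g in_planeD [OF ax that] that(1) by (simp add: to_slice_def)
    also have "\<dots> = (\<Sum>k<4. unit_index k * of_real (quat_component k (\<alpha> (Re z, Im z))))
        + (\<Sum>k<4. unit_index k * of_real (quat_component k (\<beta> (Re z, Im z)))) * J"
      by (simp only: quat_component_expansion)
    also have "\<dots> = (\<Sum>k<4. unit_index k * to_slice J (h k z))"
      by (simp add: h_def to_slice_def sum_distrib_right distrib_left mult.assoc of_real_def flip: sum.distrib)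
    finally show ?thesis .
  qed
  then have "right_expansion D g {..<4} unit_index h"
    unfolding right_expansion_def slice_components_of_def h_def
    using intrinsic_on_components [OF ab bounded_linear_quat_component] by simp
  then show thesis by (rule that)
qed

lemma intrinsic_plane_function:
  assumes "intrinsic_slice_hyperholomorphic_on D f"
  obtains h where "intrinsic_on (plane D) h" "axially_symmetric D"
    "\<And>J z. J \<in> imag_units \<Longrightarrow> z \<in> plane D \<Longrightarrow> f (to_slice J z) = to_slice J (h z)"
proof -
  obtain \<alpha> \<beta> where ab: "slice_components D \<alpha> \<beta>"
    and f: "\<forall>u v. \<forall>J\<in>imag_units. of_real u + J * of_real v \<in> D \<longrightarrow>
      \<alpha> (u, v) \<in> range of_real \<and> \<beta> (u, v) \<in> range of_real \<and>
      f (of_real u + J * of_real v) = \<alpha> (u, v) + J * \<beta> (u, v)"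
    using assms by (auto simp: intrinsic_slice_hyperholomorphic_on_def)
  have ax: "axially_symmetric D" using ab by (simp add: slice_components_def)
  let ?h = "\<lambda>z. Complex (QRe (\<alpha> (Re z, Im z))) (QRe (\<beta> (Re z, Im z)))"
  have real: "p = of_real (QRe p)" if "p \<in> range of_real" for p :: quat
    using that by (auto simp: of_real_quat)
  have "f (to_slice J z) = to_slice J (?h z)" if "J \<in> imag_units" "z \<in> plane D" for J z
    using f in_planeD [OF ax that] that(1) real [of "\<alpha> (Re z, Im z)"] real [of "\<beta> (Re z, Im z)"]
    by (simp add: to_slice_def)
  then show thesis
    by (rule that [OF intrinsic_on_components [OF ab bounded_linear_quat_components(1)] ax])
qed

section \<open>The functional calculi in terms of intrinsic components\<close>

context commuting_operator
begin

text \<open>By axial symmetry the domain has the same trace in all slices, so a contour drawn in one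
  slice can be judged in the plane. It is disjoint from the open set it bounds, which contains the
  spectrum, and it stays in the closure, hence in \<open>D\<close>.\<close>

lemma calc_contours_resolvent_cycle:
  assumes C: "(J, \<Gamma>) \<in> calc_contours T D" and ax: "axially_symmetric D"
  shows "J \<in> imag_units" "resolvent_cycle (plane D) \<Gamma>"
proof -
  obtain U where J: "J \<in> imag_units" and U: "slice_cauchy_domain U" "S_spectrum T \<subseteq> U" "closure U \<subseteq> D"
    and ob: "oriented_boundary \<Gamma> (slice J U)"
    using C by (auto simp: calc_contours_def)
  show "J \<in> imag_units" by (rule J)
  let ?V = "slice J U"
  have "open ?V" using U(1) by (intro open_slice J) (simp add: slice_cauchy_domain_def)
  have jb: "jordan_boundary \<Gamma> ?V" and w1: "\<And>z. z \<in> ?V \<Longrightarrow> (\<Sum>\<gamma>\<in>\<Gamma>. winding_number \<gamma> z) = 1"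
    and w0: "\<And>z. z \<notin> closure ?V \<Longrightarrow> (\<Sum>\<gamma>\<in>\<Gamma>. winding_number \<gamma> z) = 0"
    using ob by (auto simp: oriented_boundary_def)
  have "closed {z. to_slice J z \<in> closure U}"
    using closed_vimage [OF closed_closure linear_continuous_on [OF bounded_linear_to_slice [OF J]]]
    by (simp add: vimage_def)
  moreover have "?V \<subseteq> {z. to_slice J z \<in> closure U}"
    using closure_subset by (auto simp: slice_def)
  ultimately have "closure ?V \<subseteq> {z. to_slice J z \<in> closure U}" by (rule closure_minimal [rotated])
  also have "\<dots> \<subseteq> slice J D"
    unfolding slice_def using U(3) by auto
  also have "slice J D = plane D" by (rule slice_eq_plane [OF ax J])
  finally have cl: "closure ?V \<subseteq> plane D" .
  have sp: "z \<in> ?V" if "z \<notin> resolvent_plane" for z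
    using to_slice_resolvent [OF J, of z] that U(2) by (auto simp: S_spectrum_def slice_def)
  have im: "path_image \<gamma> \<subseteq> closure ?V - ?V" if "\<gamma> \<in> \<Gamma>" for \<gamma>
  proof -
    have "path_image \<gamma> \<subseteq> frontier ?V" using jb that by (auto simp: jordan_boundary_def)
    then show ?thesis using \<open>open ?V\<close> by (simp add: frontier_def interior_open)
  qed
  show "resolvent_cycle (plane D) \<Gamma>"
    unfolding resolvent_cycle_def
  proof (intro conjI ballI allI impI)
    show "finite \<Gamma>" using jb by (simp add: jordan_boundary_def)
    show "valid_path \<gamma>" "pathfinish \<gamma> = pathstart \<gamma>" if "\<gamma> \<in> \<Gamma>" for \<gamma>
      using jb that by (simp_all add: jordan_boundary_def)
    show "path_image \<gamma> \<subseteq> plane D \<inter> resolvent_plane" if "\<gamma> \<in> \<Gamma>" for \<gamma>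
      using im [OF that] cl sp by auto
    fix z
    show "z \<in> plane D" "(\<Sum>\<gamma>\<in>\<Gamma>. winding_number \<gamma> z) = 1" if "z \<notin> resolvent_plane"
      using sp [OF that] w1 closure_subset [of ?V] cl by auto
    show "(\<Sum>\<gamma>\<in>\<Gamma>. winding_number \<gamma> z) = 0" if "z \<notin> plane D"
      using w0 [of z] that cl by auto
  qed
qed

text \<open>A common form of the four calculi: the constants which need not commute with the slice
  are collected in \<open>A\<close> and \<open>B\<close> outside the integral, and what remains
  inside is a scalar function times the kernel.\<close>

lemma sum_integral_kernel:
  fixes A B :: "'k \<Rightarrow> 'a qop"
  assumes J: "J \<in> imag_units" and \<Gamma>: "resolvent_cycle D \<Gamma>" and K: "finite K"
    and h: "\<And>k. k \<in> K \<Longrightarrow> intrinsic_on D (h k)"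
    and I: "\<And>\<gamma> t. \<gamma> \<in> \<Gamma> \<Longrightarrow> t \<in> {0..1} \<Longrightarrow> \<gamma> t \<in> D \<Longrightarrow> \<gamma> t \<in> resolvent_plane \<Longrightarrow> I \<gamma> t = (\<Sum>k\<in>K. A k o\<^sub>L
      (lmul (to_slice J (vector_derivative \<gamma> (at t within {0..1}))) o\<^sub>L
        (lmul (to_slice J (h k (\<gamma> t))) o\<^sub>L Q_resolvent J (\<gamma> t))) o\<^sub>L B k)"
  shows "(\<Sum>\<gamma>\<in>\<Gamma>. integral {0..1} (I \<gamma>)) = (\<Sum>k\<in>K. A k o\<^sub>L Q_integral J \<Gamma> (h k) o\<^sub>L B k)"
proof -
  note d = resolvent_cycleD [OF \<Gamma>]
  let ?F = "\<lambda>k z. lmul (to_slice J (h k z)) o\<^sub>L Q_resolvent J z"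
  have "integral {0..1} (I \<gamma>) = (\<Sum>k\<in>K. A k o\<^sub>L op_integral J \<gamma> (?F k) o\<^sub>L B k)" if \<gamma>: "\<gamma> \<in> \<Gamma>" for \<gamma>
  proof -
    let ?G = "\<lambda>k t. lmul (to_slice J (vector_derivative \<gamma> (at t within {0..1}))) o\<^sub>L ?F k (\<gamma> t)"
    have int: "?G k integrable_on {0..1}" if "k \<in> K" for k
    proof (rule op_integrable [OF J _ _ d(2) [OF \<gamma>] d(4) [OF \<gamma>]])
      have "open D" "h k holomorphic_on D" using h [OF that] by (auto simp: intrinsic_on_def)
      then show "open (D \<inter> resolvent_plane)" "slice_holomorphic_on J (?F k) (D \<inter> resolvent_plane)"
        by (auto intro!: open_inter_resolvent slice_holomorphic_kernel J intro: holomorphic_on_subset)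
    qed
    have "integral {0..1} (I \<gamma>) = integral {0..1} (\<lambda>t. \<Sum>k\<in>K. A k o\<^sub>L ?G k t o\<^sub>L B k)"
    proof (rule integral_cong)
      fix t :: real assume t: "t \<in> {0..1}"
      then have "\<gamma> t \<in> path_image \<gamma>" by (simp add: path_image_def)
      then have "\<gamma> t \<in> D" "\<gamma> t \<in> resolvent_plane" using d(4) [OF \<gamma>] by auto
      then show "I \<gamma> t = (\<Sum>k\<in>K. A k o\<^sub>L ?G k t o\<^sub>L B k)" by (rule I [OF \<gamma> t])
    qed
    also have "\<dots> = (\<Sum>k\<in>K. A k o\<^sub>L integral {0..1} (?G k) o\<^sub>L B k)"
      by (rule integral_sandwich_sum(1) [OF int K])
    finally show ?thesis by (simp only: op_integral_def)
  qed
  then have "(\<Sum>\<gamma>\<in>\<Gamma>. integral {0..1} (I \<gamma>)) = (\<Sum>k\<in>K. \<Sum>\<gamma>\<in>\<Gamma>. A k o\<^sub>L op_integral J \<gamma> (?F k) o\<^sub>L B k)"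
    by (simp add: sum.swap [of _ K \<Gamma>])
  then show ?thesis by (simp add: Q_integral_def compose_sum)
qed

lemma scaleR_Q_integral:
  fixes A B :: "'a qop"
  shows "(1 / (2 * pi)) *\<^sub>R (A o\<^sub>L Q_integral J \<Gamma> f o\<^sub>L (lmul (- J) o\<^sub>L B)) = A o\<^sub>L Q_calc J \<Gamma> f o\<^sub>L B"
  by (simp add: Q_calc_def compose_simps)

section \<open>The four calculi over a single contour\<close>

context
  fixes D J \<Gamma> assumes ax: "axially_symmetric D" and C: "(J, \<Gamma>) \<in> calc_contours T D"
begin

lemma calc_contour_unit: "J \<in> imag_units"
  and calc_contour_cycle: "resolvent_cycle (plane D) \<Gamma>"
  using calc_contours_resolvent_cycle [OF C ax] by auto

lemma kernel_commute:
  fixes X :: "'a qop"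
  assumes "z \<in> resolvent_plane"
  shows "Q_resolvent J z o\<^sub>L (lmul (to_slice J w) o\<^sub>L X) = lmul (to_slice J w) o\<^sub>L (Q_resolvent J z o\<^sub>L X)"
    "Q_resolvent J z o\<^sub>L (lmul (- J) o\<^sub>L X) = lmul (- J) o\<^sub>L (Q_resolvent J z o\<^sub>L X)"
    "lmul (to_slice J v) o\<^sub>L (lmul (to_slice J w) o\<^sub>L X) = lmul (to_slice J w) o\<^sub>L (lmul (to_slice J v) o\<^sub>L X)"
    "lmul (- J) o\<^sub>L (lmul (to_slice J w) o\<^sub>L X) = lmul (to_slice J w) o\<^sub>L (lmul (- J) o\<^sub>L X)"
    "Q_resolvent J z o\<^sub>L lmul (to_slice J w) = lmul (to_slice J w) o\<^sub>L Q_resolvent J z"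
    "Q_resolvent J z o\<^sub>L lmul (- J) = lmul (- J) o\<^sub>L Q_resolvent J z"
proof -
  have ll: "lmul (to_slice J v) o\<^sub>L lmul (to_slice J w) = (lmul (to_slice J w) o\<^sub>L lmul (to_slice J v) :: 'a qop)" for v w
    by (simp add: mult.commute flip: lmul_mult to_slice_mult [OF calc_contour_unit])
  have mJ: "- J = to_slice J (- \<i>)" by (simp add: to_slice_def)
  note q = Q_resolvent_commute(1) [OF calc_contour_unit assms, symmetric]
  show "Q_resolvent J z o\<^sub>L lmul (to_slice J w) = lmul (to_slice J w) o\<^sub>L Q_resolvent J z" by (rule q)
  show "Q_resolvent J z o\<^sub>L lmul (- J) = lmul (- J) o\<^sub>L Q_resolvent J z" unfolding mJ by (rule q)
  have q': "Q_resolvent J z o\<^sub>L (lmul (to_slice J w) o\<^sub>L X) = lmul (to_slice J w) o\<^sub>L (Q_resolvent J z o\<^sub>L X)" for w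
    by (simp add: q flip: compose_simps(1))
  have ll': "lmul (to_slice J v) o\<^sub>L (lmul (to_slice J w) o\<^sub>L X) = lmul (to_slice J w) o\<^sub>L (lmul (to_slice J v) o\<^sub>L X)" for v w
    by (simp add: ll flip: compose_simps(1))
  show "Q_resolvent J z o\<^sub>L (lmul (to_slice J w) o\<^sub>L X) = lmul (to_slice J w) o\<^sub>L (Q_resolvent J z o\<^sub>L X)"
    "Q_resolvent J z o\<^sub>L (lmul (- J) o\<^sub>L X) = lmul (- J) o\<^sub>L (Q_resolvent J z o\<^sub>L X)"
    "lmul (to_slice J v) o\<^sub>L (lmul (to_slice J w) o\<^sub>L X) = lmul (to_slice J w) o\<^sub>L (lmul (to_slice J v) o\<^sub>L X)"
    "lmul (- J) o\<^sub>L (lmul (to_slice J w) o\<^sub>L X) = lmul (to_slice J w) o\<^sub>L (lmul (- J) o\<^sub>L X)"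
    unfolding mJ by (rule q' ll')+
qed

lemma lmul_sum: "lmul (\<Sum>k\<in>K. f k) = (\<Sum>k\<in>K. lmul (f k))"
  by (rule linear_sum [OF bounded_linear.linear [OF bounded_linear_lmul]])

text \<open>Kernel, differential and intrinsic components lie in one commuting family, so the
  integrand can be rearranged with the coefficients on the right. The factor -2 is the quotient of
  -1/pi by 1/(2 pi).\<close>

lemma left_Q_calc_expansion:
  assumes g: "left_expansion D g K e h"
  shows "left_Q_calc (J, \<Gamma>) T g = (- 2) *\<^sub>R (\<Sum>k\<in>K. Q_calc J \<Gamma> (h k) o\<^sub>L lmul (e k))"
proof -
  have K: "finite K" and h: "\<And>k. k \<in> K \<Longrightarrow> intrinsic_on (plane D) (h k)"
    and ge: "\<And>z. z \<in> plane D \<Longrightarrow> g (to_slice J z) = (\<Sum>k\<in>K. to_slice J (h k z) * e k)"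
    using g calc_contour_unit by (auto simp: left_expansion_def slice_components_of_def)
  have "left_slice_integral J \<Gamma> (\<lambda>s. op_inv (Qc s T)) g
      = (\<Sum>k\<in>K. id_blinfun o\<^sub>L Q_integral J \<Gamma> (h k) o\<^sub>L (lmul (- J) o\<^sub>L lmul (e k)))"
    unfolding left_slice_integral_def
  proof (rule sum_integral_kernel [OF calc_contour_unit calc_contour_cycle K h])
    fix \<gamma> and t :: real assume z: "\<gamma> t \<in> plane D" "\<gamma> t \<in> resolvent_plane"
    show "op_inv (Qc (to_slice J (\<gamma> t)) T) o\<^sub>L lmul (to_slice J (vector_derivative \<gamma> (at t within {0..1})) * - J) o\<^sub>L lmul (g (to_slice J (\<gamma> t)))
      = (\<Sum>k\<in>K. id_blinfun o\<^sub>L (lmul (to_slice J (vector_derivative \<gamma> (at t within {0..1}))) o\<^sub>L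
        (lmul (to_slice J (h k (\<gamma> t))) o\<^sub>L Q_resolvent J (\<gamma> t))) o\<^sub>L (lmul (- J) o\<^sub>L lmul (e k)))"
      unfolding ge [OF z(1)] lmul_sum lmul_mult compose_sum Q_resolvent_def [symmetric]
      by (rule sum.cong) (simp_all add: compose_simps kernel_commute [OF z(2)])
  qed
  then have "left_Q_calc (J, \<Gamma>) T g
      = (- 2) *\<^sub>R (\<Sum>k\<in>K. (1 / (2 * pi)) *\<^sub>R (id_blinfun o\<^sub>L Q_integral J \<Gamma> (h k) o\<^sub>L (lmul (- J) o\<^sub>L lmul (e k))))"
    by (simp add: left_Q_calc_def scaleR_sum_right)
  then show ?thesis unfolding scaleR_Q_integral by (simp only: compose_simps(10))
qed

lemma right_Q_calc_expansion:
  assumes g: "right_expansion D g K e h"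
  shows "right_Q_calc (J, \<Gamma>) T g = (- 2) *\<^sub>R (\<Sum>k\<in>K. lmul (e k) o\<^sub>L Q_calc J \<Gamma> (h k))"
proof -
  have K: "finite K" and h: "\<And>k. k \<in> K \<Longrightarrow> intrinsic_on (plane D) (h k)"
    and ge: "\<And>z. z \<in> plane D \<Longrightarrow> g (to_slice J z) = (\<Sum>k\<in>K. e k * to_slice J (h k z))"
    using g calc_contour_unit by (auto simp: right_expansion_def slice_components_of_def)
  have "right_slice_integral J \<Gamma> (\<lambda>s. op_inv (Qc s T)) g
      = (\<Sum>k\<in>K. lmul (e k) o\<^sub>L Q_integral J \<Gamma> (h k) o\<^sub>L (lmul (- J) o\<^sub>L id_blinfun))"
    unfolding right_slice_integral_def
  proof (rule sum_integral_kernel [OF calc_contour_unit calc_contour_cycle K h])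
    fix \<gamma> and t :: real assume z: "\<gamma> t \<in> plane D" "\<gamma> t \<in> resolvent_plane"
    show "lmul (g (to_slice J (\<gamma> t))) o\<^sub>L lmul (to_slice J (vector_derivative \<gamma> (at t within {0..1})) * - J) o\<^sub>L op_inv (Qc (to_slice J (\<gamma> t)) T)
      = (\<Sum>k\<in>K. lmul (e k) o\<^sub>L (lmul (to_slice J (vector_derivative \<gamma> (at t within {0..1}))) o\<^sub>L
        (lmul (to_slice J (h k (\<gamma> t))) o\<^sub>L Q_resolvent J (\<gamma> t))) o\<^sub>L (lmul (- J) o\<^sub>L id_blinfun))"
      unfolding ge [OF z(1)] lmul_sum lmul_mult compose_sum Q_resolvent_def [symmetric]
      by (rule sum.cong) (simp_all add: compose_simps kernel_commute [OF z(2)])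
  qed
  then have "right_Q_calc (J, \<Gamma>) T g
      = (- 2) *\<^sub>R (\<Sum>k\<in>K. (1 / (2 * pi)) *\<^sub>R (lmul (e k) o\<^sub>L Q_integral J \<Gamma> (h k) o\<^sub>L (lmul (- J) o\<^sub>L id_blinfun)))"
    by (simp add: right_Q_calc_def scaleR_sum_right)
  then show ?thesis unfolding scaleR_Q_integral by (simp only: compose_simps(11))
qed

lemma left_S_calc_expansion:
  assumes g: "left_expansion D g K e h"
  shows "left_S_calc (J, \<Gamma>) T g
    = (\<Sum>k\<in>K. (Q_calc J \<Gamma> (\<lambda>z. z * h k z) - (op_conj T o\<^sub>L Q_calc J \<Gamma> (h k))) o\<^sub>L lmul (e k))"
proof -
  have K: "finite (K \<times> (UNIV :: bool set))" and h: "\<And>k. k \<in> K \<Longrightarrow> intrinsic_on (plane D) (h k)"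
    and ge: "\<And>z. z \<in> plane D \<Longrightarrow> g (to_slice J z) = (\<Sum>k\<in>K. to_slice J (h k z) * e k)"
    using g calc_contour_unit by (auto simp: left_expansion_def slice_components_of_def)
  \<comment> \<open>The resolvent is a difference, so the index is doubled: \<open>True\<close>
    stands for the term with s, absorbed into the scalar function, \<open>False\<close> for the one
    with the conjugate of \<open>T\<close>. The latter need not commute with the slice and stays
    outside on the left as \<open>A\<close>.\<close>
  define h' where "h' = (\<lambda>(k, b) z. if b then z * h k z else h k z)"
  define A where "A = (\<lambda>(k :: 'b, b). if b then id_blinfun else - op_conj T)"
  have h': "intrinsic_on (plane D) (h' p)" if "p \<in> K \<times> UNIV" for p
    using that h intrinsic_on_times_ident [OF h] by (cases p; cases "snd p") (auto simp: h'_def)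
  have "left_slice_integral J \<Gamma> (\<lambda>s. S_left_resolvent s T) g
      = (\<Sum>p\<in>K \<times> UNIV. A p o\<^sub>L Q_integral J \<Gamma> (h' p) o\<^sub>L (lmul (- J) o\<^sub>L lmul (e (fst p))))"
    unfolding left_slice_integral_def
  proof (rule sum_integral_kernel [OF calc_contour_unit calc_contour_cycle K h'])
    fix \<gamma> and t :: real assume z: "\<gamma> t \<in> plane D" "\<gamma> t \<in> resolvent_plane"
    show "S_left_resolvent (to_slice J (\<gamma> t)) T o\<^sub>L lmul (to_slice J (vector_derivative \<gamma> (at t within {0..1})) * - J) o\<^sub>L lmul (g (to_slice J (\<gamma> t)))
      = (\<Sum>p\<in>K \<times> UNIV. A p o\<^sub>L (lmul (to_slice J (vector_derivative \<gamma> (at t within {0..1}))) o\<^sub>L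
        (lmul (to_slice J (h' p (\<gamma> t))) o\<^sub>L Q_resolvent J (\<gamma> t))) o\<^sub>L (lmul (- J) o\<^sub>L lmul (e (fst p))))"
      unfolding ge [OF z(1)] lmul_sum lmul_mult compose_sum S_left_resolvent_def Q_resolvent_def [symmetric]
        sum.cartesian_product' UNIV_bool
      by (rule sum.cong) (simp_all add: A_def h'_def to_slice_mult [OF calc_contour_unit] lmul_mult compose_simps kernel_commute [OF z(2)])
  qed
  then have "left_S_calc (J, \<Gamma>) T g
      = (\<Sum>p\<in>K \<times> UNIV. (1 / (2 * pi)) *\<^sub>R (A p o\<^sub>L Q_integral J \<Gamma> (h' p) o\<^sub>L (lmul (- J) o\<^sub>L lmul (e (fst p)))))"
    by (simp add: left_S_calc_def scaleR_sum_right)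
  also have "\<dots> = (\<Sum>p\<in>K \<times> UNIV. A p o\<^sub>L Q_calc J \<Gamma> (h' p) o\<^sub>L lmul (e (fst p)))"
    by (simp only: scaleR_Q_integral)
  also have "\<dots> = (\<Sum>k\<in>K. (Q_calc J \<Gamma> (\<lambda>z. z * h k z) - (op_conj T o\<^sub>L Q_calc J \<Gamma> (h k))) o\<^sub>L lmul (e k))"
    unfolding sum.cartesian_product' UNIV_bool
    by (rule sum.cong) (simp_all add: A_def h'_def compose_simps)
  finally show ?thesis .
qed

lemma right_S_calc_expansion:
  assumes g: "right_expansion D g K e h"
  shows "right_S_calc (J, \<Gamma>) T g
    = (\<Sum>k\<in>K. lmul (e k) o\<^sub>L (Q_calc J \<Gamma> (\<lambda>z. z * h k z) - (Q_calc J \<Gamma> (h k) o\<^sub>L op_conj T)))"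
proof -
  have K: "finite (K \<times> (UNIV :: bool set))" and h: "\<And>k. k \<in> K \<Longrightarrow> intrinsic_on (plane D) (h k)"
    and ge: "\<And>z. z \<in> plane D \<Longrightarrow> g (to_slice J z) = (\<Sum>k\<in>K. e k * to_slice J (h k z))"
    using g calc_contour_unit by (auto simp: right_expansion_def slice_components_of_def)
  \<comment> \<open>The doubling of the left case, mirrored: the conjugate of \<open>T\<close> now
    leaves the integral on the right, as \<open>B\<close>.\<close>
  define h' where "h' = (\<lambda>(k, b) z. if b then z * h k z else h k z)"
  define B where "B = (\<lambda>(k :: 'b, b). if b then id_blinfun else - op_conj T)"
  have h': "intrinsic_on (plane D) (h' p)" if "p \<in> K \<times> UNIV" for p
    using that h intrinsic_on_times_ident [OF h] by (cases p; cases "snd p") (auto simp: h'_def)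
  have "right_slice_integral J \<Gamma> (\<lambda>s. S_right_resolvent s T) g
      = (\<Sum>p\<in>K \<times> UNIV. lmul (e (fst p)) o\<^sub>L Q_integral J \<Gamma> (h' p) o\<^sub>L (lmul (- J) o\<^sub>L B p))"
    unfolding right_slice_integral_def
  proof (rule sum_integral_kernel [OF calc_contour_unit calc_contour_cycle K h'])
    fix \<gamma> and t :: real assume z: "\<gamma> t \<in> plane D" "\<gamma> t \<in> resolvent_plane"
    show "lmul (g (to_slice J (\<gamma> t))) o\<^sub>L lmul (to_slice J (vector_derivative \<gamma> (at t within {0..1})) * - J) o\<^sub>L S_right_resolvent (to_slice J (\<gamma> t)) T
      = (\<Sum>p\<in>K \<times> UNIV. lmul (e (fst p)) o\<^sub>L (lmul (to_slice J (vector_derivative \<gamma> (at t within {0..1}))) o\<^sub>L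
        (lmul (to_slice J (h' p (\<gamma> t))) o\<^sub>L Q_resolvent J (\<gamma> t))) o\<^sub>L (lmul (- J) o\<^sub>L B p))"
      unfolding ge [OF z(1)] lmul_sum lmul_mult compose_sum S_right_resolvent_def Q_resolvent_def [symmetric]
        sum.cartesian_product' UNIV_bool
      by (rule sum.cong) (simp_all add: B_def h'_def to_slice_mult [OF calc_contour_unit] lmul_mult compose_simps kernel_commute [OF z(2)])
  qed
  then have "right_S_calc (J, \<Gamma>) T g
      = (\<Sum>p\<in>K \<times> UNIV. (1 / (2 * pi)) *\<^sub>R (lmul (e (fst p)) o\<^sub>L Q_integral J \<Gamma> (h' p) o\<^sub>L (lmul (- J) o\<^sub>L B p)))"
    by (simp add: right_S_calc_def scaleR_sum_right)
  also have "\<dots> = (\<Sum>p\<in>K \<times> UNIV. lmul (e (fst p)) o\<^sub>L Q_calc J \<Gamma> (h' p) o\<^sub>L B p)"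
    by (simp only: scaleR_Q_integral)
  also have "\<dots> = (\<Sum>k\<in>K. lmul (e k) o\<^sub>L (Q_calc J \<Gamma> (\<lambda>z. z * h k z) - (Q_calc J \<Gamma> (h k) o\<^sub>L op_conj T)))"
    unfolding sum.cartesian_product' UNIV_bool
    by (rule sum.cong) (simp_all add: B_def h'_def compose_simps)
  finally show ?thesis .
qed

end

end

section \<open>The product formula for slice hyperholomorphic functions\<close>

lemma axially_symmetric_Int:
  "axially_symmetric D \<Longrightarrow> axially_symmetric E \<Longrightarrow> axially_symmetric (D \<inter> E)"
  unfolding axially_symmetric_def by blast

lemma plane_Int: "plane (D \<inter> E) = plane D \<inter> plane E"
  by (auto simp: slice_def)

lemma slice_hyperholomorphic_axially_symmetric:
  "left_slice_hyperholomorphic_on E g \<Longrightarrow> axially_symmetric E"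
  "right_slice_hyperholomorphic_on E g \<Longrightarrow> axially_symmetric E"
  by (auto simp: left_slice_hyperholomorphic_on_def right_slice_hyperholomorphic_on_def slice_components_def)

context commuting_operator
begin

text \<open>Expanding the vector part gives four terms with the conjugate of \<open>T\<close>. Two
  are kept between \<open>b\<close> and \<open>c\<close> and two are moved to the left of
  \<open>b\<close>, the places where the products of the calculi produce them.\<close>

lemma op_vec_compose_halves:
  fixes b c :: "'a qop"
  assumes "b o\<^sub>L op_conj T = op_conj T o\<^sub>L b"
  shows "4 *\<^sub>R (b o\<^sub>L (op_vec T o\<^sub>L c))
    = 2 *\<^sub>R (b o\<^sub>L (tr o\<^sub>L c)) - 2 *\<^sub>R (b o\<^sub>L (op_conj T o\<^sub>L c)) - 2 *\<^sub>R (op_conj T o\<^sub>L (b o\<^sub>L c))"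
proof -
  have "b o\<^sub>L (op_conj T o\<^sub>L c) = op_conj T o\<^sub>L (b o\<^sub>L c)"
    by (simp add: assms flip: compose_simps(1))
  moreover have "4 *\<^sub>R y = 2 *\<^sub>R y + 2 *\<^sub>R y" for y :: "'a qop"
    by (simp flip: scaleR_left_distrib)
  ultimately show ?thesis
    by (simp add: op_vec_eq compose_simps scaleR_diff_right)
qed

context
  fixes D :: "quat set" and f f\<^sub>0
  assumes D: "axially_symmetric D" and f\<^sub>0: "intrinsic_on (plane D) f\<^sub>0"
    and f: "\<And>J z. J \<in> imag_units \<Longrightarrow> z \<in> plane D \<Longrightarrow> f (to_slice J z) = to_slice J (f\<^sub>0 z)"
begin

lemma intrinsic_calc:
  assumes C: "(J, \<Gamma>) \<in> calc_contours T D"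
  shows "left_Q_calc (J, \<Gamma>) T f = (- 2) *\<^sub>R Q_calc J \<Gamma> f\<^sub>0"
    and "left_S_calc (J, \<Gamma>) T f = Q_calc J \<Gamma> (\<lambda>z. z * f\<^sub>0 z) - (op_conj T o\<^sub>L Q_calc J \<Gamma> f\<^sub>0)"
proof -
  have "left_expansion D f {()} (\<lambda>_. 1) (\<lambda>_. f\<^sub>0)"
    using f\<^sub>0 f by (simp add: left_expansion_def slice_components_of_def)
  from left_Q_calc_expansion [OF D C this] left_S_calc_expansion [OF D C this]
  show "left_Q_calc (J, \<Gamma>) T f = (- 2) *\<^sub>R Q_calc J \<Gamma> f\<^sub>0"
    and "left_S_calc (J, \<Gamma>) T f = Q_calc J \<Gamma> (\<lambda>z. z * f\<^sub>0 z) - (op_conj T o\<^sub>L Q_calc J \<Gamma> f\<^sub>0)"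
    by (simp_all add: lmul_1 compose_simps)
qed

text \<open>All five calculi are rewritten over the contour of the product, whose cycle is
  admissible for both factors. The claim is then a sum over \<open>k\<close> of identities between
  fixed operators.\<close>

lemma left_product:
  assumes E: "axially_symmetric E" and g: "left_expansion E g K e h"
    and C: "C\<^sub>1 \<in> calc_contours T (D \<inter> E)" "C\<^sub>2 \<in> calc_contours T D" "C\<^sub>3 \<in> calc_contours T E"
      "C\<^sub>4 \<in> calc_contours T D" "C\<^sub>5 \<in> calc_contours T E"
  shows "left_Q_calc C\<^sub>1 T (\<lambda>s. f s * g s) =
      (left_S_calc C\<^sub>2 T f o\<^sub>L left_Q_calc C\<^sub>3 T g) +
      (left_Q_calc C\<^sub>4 T f o\<^sub>L left_S_calc C\<^sub>5 T g) +
      (left_Q_calc C\<^sub>4 T f o\<^sub>L op_vec T o\<^sub>L left_Q_calc C\<^sub>3 T g)"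
proof -
  obtain J1 \<Gamma>1 J2 \<Gamma>2 J3 \<Gamma>3 J4 \<Gamma>4 J5 \<Gamma>5 where CJ: "C\<^sub>1 = (J1, \<Gamma>1)" "C\<^sub>2 = (J2, \<Gamma>2)" "C\<^sub>3 = (J3, \<Gamma>3)"
    "C\<^sub>4 = (J4, \<Gamma>4)" "C\<^sub>5 = (J5, \<Gamma>5)" by (metis surj_pair)
  note C' = C [unfolded CJ]
  note DE = axially_symmetric_Int [OF D E]
  note c1 = calc_contours_resolvent_cycle [OF C'(1) DE, unfolded plane_Int]
    and c2 = calc_contours_resolvent_cycle [OF C'(2) D] and c3 = calc_contours_resolvent_cycle [OF C'(3) E]
    and c4 = calc_contours_resolvent_cycle [OF C'(4) D] and c5 = calc_contours_resolvent_cycle [OF C'(5) E]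
  have c1D: "resolvent_cycle (plane D) \<Gamma>1" and c1E: "resolvent_cycle (plane E) \<Gamma>1"
    by (rule resolvent_cycle_mono [OF c1(2)]; simp)+
  have h: "intrinsic_on (plane E) (h k)" if "k \<in> K" for k
    using g that by (simp add: left_expansion_def slice_components_of_def)
  have fg: "left_expansion (D \<inter> E) (\<lambda>s. f s * g s) K e (\<lambda>k z. f\<^sub>0 z * h k z)"
    using g f intrinsic_on_mult [OF f\<^sub>0 h]
    by (simp add: left_expansion_def slice_components_of_def plane_Int to_slice_mult sum_distrib_left mult.assoc)
  let ?b = "Q_calc J1 \<Gamma>1 f\<^sub>0" and ?a = "Q_calc J1 \<Gamma>1 (\<lambda>z. z * f\<^sub>0 z)"
    and ?c = "\<lambda>k. Q_calc J1 \<Gamma>1 (h k)" and ?d = "\<lambda>k. Q_calc J1 \<Gamma>1 (\<lambda>z. z * h k z)"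
  have fS: "left_S_calc C\<^sub>2 T f = ?a - (op_conj T o\<^sub>L ?b)"
    unfolding CJ intrinsic_calc [OF C'(2)]
    by (simp only: Q_calc_cycle_independent [OF c2(1) c1(1) f\<^sub>0 c2(2) c1D]
        Q_calc_cycle_independent [OF c2(1) c1(1) intrinsic_on_times_ident [OF f\<^sub>0] c2(2) c1D])
  have fQ: "left_Q_calc C\<^sub>4 T f = (- 2) *\<^sub>R ?b"
    unfolding CJ intrinsic_calc [OF C'(4)]
    by (simp only: Q_calc_cycle_independent [OF c4(1) c1(1) f\<^sub>0 c4(2) c1D])
  have gQ: "left_Q_calc C\<^sub>3 T g = (- 2) *\<^sub>R (\<Sum>k\<in>K. ?c k o\<^sub>L lmul (e k))"
    unfolding CJ left_Q_calc_expansion [OF E C'(3) g]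
    using Q_calc_cycle_independent [OF c3(1) c1(1) h c3(2) c1E] by simp
  have gS: "left_S_calc C\<^sub>5 T g = (\<Sum>k\<in>K. (?d k - (op_conj T o\<^sub>L ?c k)) o\<^sub>L lmul (e k))"
    unfolding CJ left_S_calc_expansion [OF E C'(5) g]
    using Q_calc_cycle_independent [OF c5(1) c1(1) h c5(2) c1E]
      Q_calc_cycle_independent [OF c5(1) c1(1) intrinsic_on_times_ident [OF h] c5(2) c1E] by simp
  have fgQ: "left_Q_calc C\<^sub>1 T (\<lambda>s. f s * g s)
      = (- 2) *\<^sub>R (\<Sum>k\<in>K. ((?a o\<^sub>L ?c k) + (?b o\<^sub>L ?d k) - (?b o\<^sub>L (tr o\<^sub>L ?c k))) o\<^sub>L lmul (e k))"
    unfolding CJ left_Q_calc_expansion [OF DE C'(1) fg]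
    using Q_calc_product [OF c1(1) f\<^sub>0 h c1(2)] by simp
  note sb = Q_calc_commute(2) [OF c1(1) f\<^sub>0 c1D]
  \<comment> \<open>The operators \<open>c\<close>, \<open>d\<close>, \<open>l\<close> are
    arbitrary: the identity rests only on the commutation of \<open>?b\<close> with the conjugate of
    \<open>T\<close>.\<close>
  have "(- 2) *\<^sub>R (((?a o\<^sub>L c) + (?b o\<^sub>L d) - (?b o\<^sub>L (tr o\<^sub>L c))) o\<^sub>L l)
      = ((?a - (op_conj T o\<^sub>L ?b)) o\<^sub>L (- 2) *\<^sub>R (c o\<^sub>L l))
      + (((- 2) *\<^sub>R ?b) o\<^sub>L ((d - (op_conj T o\<^sub>L c)) o\<^sub>L l))
      + ((((- 2) *\<^sub>R ?b) o\<^sub>L op_vec T) o\<^sub>L (- 2) *\<^sub>R (c o\<^sub>L l))" for c d l :: "'a qop"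
    by (simp add: compose_simps op_vec_compose_halves [OF sb] algebra_simps)
  then show ?thesis
    unfolding fS fQ gQ gS fgQ
    by (simp only: scaleR_sum_right compose_sum flip: sum.distrib)
qed

text \<open>The mirror image, with the components of \<open>g\<close> as first factors in the
  intrinsic product formula. Accordingly it is \<open>?c k\<close>, and not \<open>?b\<close>, that
  has to be moved past the conjugate of \<open>T\<close>.\<close>

lemma right_product:
  assumes E: "axially_symmetric E" and g: "right_expansion E g K e h"
    and C: "C\<^sub>1 \<in> calc_contours T (D \<inter> E)" "C\<^sub>2 \<in> calc_contours T E" "C\<^sub>3 \<in> calc_contours T D"
      "C\<^sub>4 \<in> calc_contours T E" "C\<^sub>5 \<in> calc_contours T D"
  shows "right_Q_calc C\<^sub>1 T (\<lambda>s. g s * f s) =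
      (right_S_calc C\<^sub>2 T g o\<^sub>L left_Q_calc C\<^sub>3 T f) +
      (right_Q_calc C\<^sub>4 T g o\<^sub>L left_S_calc C\<^sub>5 T f) +
      (right_Q_calc C\<^sub>4 T g o\<^sub>L op_vec T o\<^sub>L left_Q_calc C\<^sub>3 T f)"
proof -
  obtain J1 \<Gamma>1 J2 \<Gamma>2 J3 \<Gamma>3 J4 \<Gamma>4 J5 \<Gamma>5 where CJ: "C\<^sub>1 = (J1, \<Gamma>1)" "C\<^sub>2 = (J2, \<Gamma>2)" "C\<^sub>3 = (J3, \<Gamma>3)"
    "C\<^sub>4 = (J4, \<Gamma>4)" "C\<^sub>5 = (J5, \<Gamma>5)" by (metis surj_pair)
  note C' = C [unfolded CJ]
  note DE = axially_symmetric_Int [OF D E]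
  note c1 = calc_contours_resolvent_cycle [OF C'(1) DE, unfolded plane_Int]
    and c2 = calc_contours_resolvent_cycle [OF C'(2) E] and c3 = calc_contours_resolvent_cycle [OF C'(3) D]
    and c4 = calc_contours_resolvent_cycle [OF C'(4) E] and c5 = calc_contours_resolvent_cycle [OF C'(5) D]
  have c1D: "resolvent_cycle (plane D) \<Gamma>1" and c1E: "resolvent_cycle (plane E) \<Gamma>1"
    and c1': "resolvent_cycle (plane E \<inter> plane D) \<Gamma>1"
    by (rule resolvent_cycle_mono [OF c1(2)]; simp)+
  have h: "intrinsic_on (plane E) (h k)" if "k \<in> K" for k
    using g that by (simp add: right_expansion_def slice_components_of_def)
  have gf: "right_expansion (D \<inter> E) (\<lambda>s. g s * f s) K e (\<lambda>k z. h k z * f\<^sub>0 z)"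
    using g f intrinsic_on_mult [OF h f\<^sub>0]
    by (simp add: right_expansion_def slice_components_of_def plane_Int to_slice_mult sum_distrib_right mult.assoc
        Int_commute)
  let ?b = "Q_calc J1 \<Gamma>1 f\<^sub>0" and ?a = "Q_calc J1 \<Gamma>1 (\<lambda>z. z * f\<^sub>0 z)"
    and ?c = "\<lambda>k. Q_calc J1 \<Gamma>1 (h k)" and ?d = "\<lambda>k. Q_calc J1 \<Gamma>1 (\<lambda>z. z * h k z)"
  have fS: "left_S_calc C\<^sub>5 T f = ?a - (op_conj T o\<^sub>L ?b)"
    unfolding CJ intrinsic_calc [OF C'(5)]
    by (simp only: Q_calc_cycle_independent [OF c5(1) c1(1) f\<^sub>0 c5(2) c1D]
        Q_calc_cycle_independent [OF c5(1) c1(1) intrinsic_on_times_ident [OF f\<^sub>0] c5(2) c1D])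
  have fQ: "left_Q_calc C\<^sub>3 T f = (- 2) *\<^sub>R ?b"
    unfolding CJ intrinsic_calc [OF C'(3)]
    by (simp only: Q_calc_cycle_independent [OF c3(1) c1(1) f\<^sub>0 c3(2) c1D])
  have gQ: "right_Q_calc C\<^sub>4 T g = (- 2) *\<^sub>R (\<Sum>k\<in>K. lmul (e k) o\<^sub>L ?c k)"
    unfolding CJ right_Q_calc_expansion [OF E C'(4) g]
    using Q_calc_cycle_independent [OF c4(1) c1(1) h c4(2) c1E] by simp
  have gS: "right_S_calc C\<^sub>2 T g = (\<Sum>k\<in>K. lmul (e k) o\<^sub>L (?d k - (?c k o\<^sub>L op_conj T)))"
    unfolding CJ right_S_calc_expansion [OF E C'(2) g]
    using Q_calc_cycle_independent [OF c2(1) c1(1) h c2(2) c1E]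
      Q_calc_cycle_independent [OF c2(1) c1(1) intrinsic_on_times_ident [OF h] c2(2) c1E] by simp
  have gfQ: "right_Q_calc C\<^sub>1 T (\<lambda>s. g s * f s)
      = (- 2) *\<^sub>R (\<Sum>k\<in>K. lmul (e k) o\<^sub>L ((?d k o\<^sub>L ?b) + (?c k o\<^sub>L ?a) - (?c k o\<^sub>L (tr o\<^sub>L ?b))))"
    unfolding CJ right_Q_calc_expansion [OF DE C'(1) gf]
    using Q_calc_product [OF c1(1) h f\<^sub>0 c1'] by simp
  have "(- 2) *\<^sub>R (l o\<^sub>L ((d o\<^sub>L ?b) + (?c k o\<^sub>L ?a) - (?c k o\<^sub>L (tr o\<^sub>L ?b))))
      = ((l o\<^sub>L (d - (?c k o\<^sub>L op_conj T))) o\<^sub>L (- 2) *\<^sub>R ?b)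
      + (((- 2) *\<^sub>R (l o\<^sub>L ?c k)) o\<^sub>L (?a - (op_conj T o\<^sub>L ?b)))
      + ((((- 2) *\<^sub>R (l o\<^sub>L ?c k)) o\<^sub>L op_vec T) o\<^sub>L (- 2) *\<^sub>R ?b)" if "k \<in> K" for k and d l :: "'a qop"
  proof -
    note sc = Q_calc_commute(2) [OF c1(1) h [OF that] c1E]
    have l4: "4 *\<^sub>R (l o\<^sub>L (?c k o\<^sub>L (op_vec T o\<^sub>L ?b))) = l o\<^sub>L 4 *\<^sub>R (?c k o\<^sub>L (op_vec T o\<^sub>L ?b))"
      by (simp add: compose_simps)
    have sc': "?c k o\<^sub>L (op_conj T o\<^sub>L ?b) = op_conj T o\<^sub>L (?c k o\<^sub>L ?b)"
      by (simp add: sc flip: compose_simps(1))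
    show ?thesis
      by (simp add: compose_simps l4 op_vec_compose_halves [OF sc] sc' algebra_simps)
  qed
  then show ?thesis
    unfolding fS fQ gQ gS gfQ
    by (simp add: scaleR_sum_right compose_sum flip: sum.distrib)
qed

end

end

theorem theorem6p4:
  fixes T :: "'a::banach qmod \<Rightarrow>\<^sub>L 'a qmod" and f g :: "quat \<Rightarrow> quat" and D E :: "quat set"
  assumes "T \<in> commuting_ops"
    and "intrinsic_slice_hyperholomorphic_on D f" and "S_spectrum T \<subseteq> D"
  shows "(left_slice_hyperholomorphic_on E g \<and> S_spectrum T \<subseteq> E \<longrightarrow>
      (\<forall>C\<^sub>1\<in>calc_contours T (D \<inter> E). \<forall>C\<^sub>2\<in>calc_contours T D. \<forall>C\<^sub>3\<in>calc_contours T E.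
       \<forall>C\<^sub>4\<in>calc_contours T D. \<forall>C\<^sub>5\<in>calc_contours T E.
        left_Q_calc C\<^sub>1 T (\<lambda>s. f s * g s) =
          (left_S_calc C\<^sub>2 T f o\<^sub>L left_Q_calc C\<^sub>3 T g) +
          (left_Q_calc C\<^sub>4 T f o\<^sub>L left_S_calc C\<^sub>5 T g) +
          (left_Q_calc C\<^sub>4 T f o\<^sub>L op_vec T o\<^sub>L left_Q_calc C\<^sub>3 T g))) \<and>
    (right_slice_hyperholomorphic_on E g \<and> S_spectrum T \<subseteq> E \<longrightarrow>
      (\<forall>C\<^sub>1\<in>calc_contours T (D \<inter> E). \<forall>C\<^sub>2\<in>calc_contours T E. \<forall>C\<^sub>3\<in>calc_contours T D.
       \<forall>C\<^sub>4\<in>calc_contours T E. \<forall>C\<^sub>5\<in>calc_contours T D.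
        right_Q_calc C\<^sub>1 T (\<lambda>s. g s * f s) =
          (right_S_calc C\<^sub>2 T g o\<^sub>L left_Q_calc C\<^sub>3 T f) +
          (right_Q_calc C\<^sub>4 T g o\<^sub>L left_S_calc C\<^sub>5 T f) +
          (right_Q_calc C\<^sub>4 T g o\<^sub>L op_vec T o\<^sub>L left_Q_calc C\<^sub>3 T f)))"
proof -
  interpret commuting_operator T by standard (rule assms(1))
  obtain f\<^sub>0 where f\<^sub>0: "intrinsic_on (plane D) f\<^sub>0" "axially_symmetric D"
    "\<And>J z. J \<in> imag_units \<Longrightarrow> z \<in> plane D \<Longrightarrow> f (to_slice J z) = to_slice J (f\<^sub>0 z)"
    using intrinsic_plane_function [OF assms(2)] by metis
  show ?thesis
  proof (intro conjI impI ballI; elim conjE)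
    assume g: "left_slice_hyperholomorphic_on E g"
    obtain h where h: "left_expansion E g {..<4} unit_index h" by (rule left_expansion_exists [OF g])
    fix C\<^sub>1 C\<^sub>2 C\<^sub>3 C\<^sub>4 C\<^sub>5
    assume c: "C\<^sub>1 \<in> calc_contours T (D \<inter> E)" "C\<^sub>2 \<in> calc_contours T D" "C\<^sub>3 \<in> calc_contours T E"
      "C\<^sub>4 \<in> calc_contours T D" "C\<^sub>5 \<in> calc_contours T E"
    show "left_Q_calc C\<^sub>1 T (\<lambda>s. f s * g s) =
          (left_S_calc C\<^sub>2 T f o\<^sub>L left_Q_calc C\<^sub>3 T g) +
          (left_Q_calc C\<^sub>4 T f o\<^sub>L left_S_calc C\<^sub>5 T g) +
          (left_Q_calc C\<^sub>4 T f o\<^sub>L op_vec T o\<^sub>L left_Q_calc C\<^sub>3 T g)"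
      by (rule left_product [OF f\<^sub>0(2,1) _ slice_hyperholomorphic_axially_symmetric(1) [OF g] h c]) (rule f\<^sub>0(3))
  next
    assume g: "right_slice_hyperholomorphic_on E g"
    obtain h where h: "right_expansion E g {..<4} unit_index h" by (rule right_expansion_exists [OF g])
    fix C\<^sub>1 C\<^sub>2 C\<^sub>3 C\<^sub>4 C\<^sub>5
    assume c: "C\<^sub>1 \<in> calc_contours T (D \<inter> E)" "C\<^sub>2 \<in> calc_contours T E" "C\<^sub>3 \<in> calc_contours T D"
      "C\<^sub>4 \<in> calc_contours T E" "C\<^sub>5 \<in> calc_contours T D"
    show "right_Q_calc C\<^sub>1 T (\<lambda>s. g s * f s) =
          (right_S_calc C\<^sub>2 T g o\<^sub>L left_Q_calc C\<^sub>3 T f) +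
          (right_Q_calc C\<^sub>4 T g o\<^sub>L left_S_calc C\<^sub>5 T f) +
          (right_Q_calc C\<^sub>4 T g o\<^sub>L op_vec T o\<^sub>L left_Q_calc C\<^sub>3 T f)"
      by (rule right_product [OF f\<^sub>0(2,1) _ slice_hyperholomorphic_axially_symmetric(2) [OF g] h c]) (rule f\<^sub>0(3))
  qed
qed

end
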